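(* Let $$X_{\Gamma,\Omega}=\Big\{(x,y,z,t_2,t_6)\in\mathbb{C}^3\times\mathbb{C}^2\ \Big|\ z^2=xy(x+y)-\tfrac12t_2xy+\tfrac14\big(t_6+\tfrac1{108}t_2^3\big)\Big\},$$ let $\alpha^\Omega:X_{\Gamma,\Omega}\to(\mathfrak{h}/W)^\Omega=\mathbb{C}^2$, $(x,y,z,t_2,t_6)\mapsto(t_2,t_6)$, be the semiuniversal deformation of the simple singularity of type $G_2=(D_4,\mathfrak{S}_3)$, and let $\Omega=\mathfrak{S}_3=\langle\sigma,\rho\rangle$ ($\sigma^2=\rho^3=1$) act on $X_{\Gamma,\Omega}$ through the automorphisms given on coordinates by $$\sigma.x=x,\quad \sigma.y=-x-y+\tfrac12t_2,\quad \sigma.z=-z,\qquad \rho.x=y,\quad \rho.y=-x-y+\tfrac12t_2,\quad \rho.z=z,$$ with $t_2,t_6$ fixed. Then every fibre of the quotient morphism $\overline{\alpha^\Omega}:X_{\Gamma,\Omega}/\Omega\to(\mathfrak{h}/W)^\Omega$, which is a deformation of a simple singularity of type $E_7$, is singular.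
   Context: The base field is $\mathbb{C}$. Here $\Gamma=\mathcal{D}_2$ is the binary dihedral group of order 8 and $\Gamma'=\mathcal{O}$ the binary octahedral group in $\mathrm{SU}_2$, $\Omega=\Gamma'/\Gamma$; $\mathfrak{h}$ is a Cartan subalgebra of type $D_4$ and $W$ its Weyl group, with $(\mathfrak{h}/W)^\Omega$ identified with $\mathbb{C}^2$ through the coordinates $(t_2,t_6)$. Since $\alpha^\Omega$ is $\Omega$-invariant, $\Omega$ acts on each fibre; $\overline{\alpha^\Omega}$ is the map induced on the quotient variety, and its fibre over $(t_2,t_6)$ is the quotient of $(\alpha^\Omega)^{-1}(t_2,t_6)$ by $\Omega$. A fibre is singular if it has at least one singular point. *)

theory Defs
  imports Complex_Main "HOL-Library.Extended_Nat" "HOL-Algebra.Algebra"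
begin

section \<open>Regular local rings\<close>

text \<open>Localization of a commutative ring \<open>R\<close> at a multiplicative subset \<open>S\<close>: fractions \<open>a/s\<close> are
  classes of pairs \<open>(a, s)\<close>.\<close>

definition frac_rel :: "('a, 'm) ring_scheme \<Rightarrow> 'a set \<Rightarrow> (('a \<times> 'a) \<times> ('a \<times> 'a)) set"
  where "frac_rel R S =
    {((a, s), (b, t)). a \<in> carrier R \<and> s \<in> S \<and> b \<in> carrier R \<and> t \<in> S \<and>
       (\<exists>u\<in>S. u \<otimes>\<^bsub>R\<^esub> ((a \<otimes>\<^bsub>R\<^esub> t) \<ominus>\<^bsub>R\<^esub> (b \<otimes>\<^bsub>R\<^esub> s)) = \<zero>\<^bsub>R\<^esub>)}"

definition loc_frac :: "('a, 'm) ring_scheme \<Rightarrow> 'a set \<Rightarrow> 'a \<Rightarrow> 'a \<Rightarrow> ('a \<times> 'a) set"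
  where "loc_frac R S a s = frac_rel R S `` {(a, s)}"

definition localization :: "('a, 'm) ring_scheme \<Rightarrow> 'a set \<Rightarrow> ('a \<times> 'a) set ring"
  where "localization R S =
    \<lparr>carrier = (carrier R \<times> S) // frac_rel R S,
     monoid.mult = (\<lambda>U V. \<Union>(a, s)\<in>U. \<Union>(b, t)\<in>V. loc_frac R S (a \<otimes>\<^bsub>R\<^esub> b) (s \<otimes>\<^bsub>R\<^esub> t)),
     monoid.one = loc_frac R S \<one>\<^bsub>R\<^esub> \<one>\<^bsub>R\<^esub>,
     ring.zero = loc_frac R S \<zero>\<^bsub>R\<^esub> \<one>\<^bsub>R\<^esub>,
     ring.add = (\<lambda>U V. \<Union>(a, s)\<in>U. \<Union>(b, t)\<in>V.
              loc_frac R S ((a \<otimes>\<^bsub>R\<^esub> t) \<oplus>\<^bsub>R\<^esub> (b \<otimes>\<^bsub>R\<^esub> s)) (s \<otimes>\<^bsub>R\<^esub> t))\<rparr>"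

definition krull_dim :: "('a, 'm) ring_scheme \<Rightarrow> enat"
  where "krull_dim R =
    Sup {enat n | n. \<exists>P :: nat \<Rightarrow> 'a set.
      (\<forall>i\<le>n. primeideal (P i) R) \<and> (\<forall>i<n. P i \<subset> P (Suc i))}"

definition regular_local_ring :: "('a, 'm) ring_scheme \<Rightarrow> bool"
  where "regular_local_ring R \<longleftrightarrow>
    cring R \<and> noetherian_ring R \<and>
    (\<exists>M. maximalideal M R \<and> (\<forall>M'. maximalideal M' R \<longrightarrow> M' = M) \<and>
      (\<exists>A \<subseteq> carrier R. finite A \<and> enat (card A) \<le> krull_dim R \<and> M = Idl\<^bsub>R\<^esub> A))"

text \<open>The closed points of the affine scheme \<open>Spec R\<close> are the maximal ideals of \<open>R\<close>; such a
  point is singular if the local ring there is not regular.\<close>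

definition singular_point :: "('a, 'm) ring_scheme \<Rightarrow> 'a set \<Rightarrow> bool"
  where "singular_point R M \<longleftrightarrow>
    maximalideal M R \<and> \<not> regular_local_ring (localization R (carrier R - M))"

definition singular :: "('a, 'm) ring_scheme \<Rightarrow> bool"
  where "singular R \<longleftrightarrow> (\<exists>M. singular_point R M)"


section \<open>Affine varieties over the complex numbers\<close>

text \<open>A variety is given by its points and its regular functions, the latter being extensional on
  the points so that equality of functions is equality on the variety.\<close>

record 'p variety =
  pts :: "'p set"
  regfuns :: "('p \<Rightarrow> complex) set"

inductive_set poly_funs :: "('p \<Rightarrow> complex) set \<Rightarrow> ('p \<Rightarrow> complex) set"
  for coords :: "('p \<Rightarrow> complex) set"
  where
    coord: "c \<in> coords \<Longrightarrow> c \<in> poly_funs coords"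
  | const: "(\<lambda>_. k) \<in> poly_funs coords"
  | add: "f \<in> poly_funs coords \<Longrightarrow> g \<in> poly_funs coords \<Longrightarrow> (\<lambda>p. f p + g p) \<in> poly_funs coords"
  | mult: "f \<in> poly_funs coords \<Longrightarrow> g \<in> poly_funs coords \<Longrightarrow> (\<lambda>p. f p * g p) \<in> poly_funs coords"

text \<open>The closed subvariety \<open>Z\<close> of the affine space with coordinate functions \<open>coords\<close>.\<close>

definition affine_variety :: "('p \<Rightarrow> complex) set \<Rightarrow> 'p set \<Rightarrow> 'p variety"
  where "affine_variety coords Z =
    \<lparr>pts = Z, regfuns = {restrict f Z | f. f \<in> poly_funs coords}\<rparr>"

definition coord_ring :: "'p variety \<Rightarrow> ('p \<Rightarrow> complex) ring"
  where "coord_ring V =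
    \<lparr>carrier = regfuns V,
     monoid.mult = (\<lambda>f g. \<lambda>p\<in>pts V. f p * g p),
     monoid.one = (\<lambda>p\<in>pts V. 1),
     ring.zero = (\<lambda>p\<in>pts V. 0),
     ring.add = (\<lambda>f g. \<lambda>p\<in>pts V. f p + g p)\<rparr>"

text \<open>Quotient by a group \<open>G\<close> acting through \<open>\<phi>\<close>: the points are the orbits and the regular
  functions are the invariant regular functions.\<close>

definition quotient_variety ::
    "'p variety \<Rightarrow> ('g, 'm) monoid_scheme \<Rightarrow> ('g \<Rightarrow> 'p \<Rightarrow> 'p) \<Rightarrow> 'p set variety"
  where "quotient_variety V G \<phi> =
    \<lparr>pts = orbits G (pts V) \<phi>,
     regfuns = {f \<in> extensional (orbits G (pts V) \<phi>). (\<lambda>p\<in>pts V. f (orbit G \<phi> p)) \<in> regfuns V}\<rparr>"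

definition pullback :: "'p variety \<Rightarrow> ('p \<Rightarrow> 'q) \<Rightarrow> ('q \<Rightarrow> complex) \<Rightarrow> 'p \<Rightarrow> complex"
  where "pullback V f g = (\<lambda>p\<in>pts V. g (f p))"

definition morphism :: "'p variety \<Rightarrow> 'q variety \<Rightarrow> ('p \<Rightarrow> 'q) \<Rightarrow> bool"
  where "morphism V B f \<longleftrightarrow> f \<in> pts V \<rightarrow> pts B \<and> pullback V f ` regfuns B \<subseteq> regfuns V"

text \<open>The fibre of \<open>f : V \<rightarrow> B\<close> over \<open>b\<close> is the scheme-theoretic one: its coordinate ring is the
  coordinate ring of \<open>V\<close> modulo the ideal generated by the pullbacks of the functions vanishing
  at \<open>b\<close>.\<close>

definition fibre_ideal :: "'p variety \<Rightarrow> 'q variety \<Rightarrow> ('p \<Rightarrow> 'q) \<Rightarrow> 'q \<Rightarrow> ('p \<Rightarrow> complex) set"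
  where "fibre_ideal V B f b = Idl\<^bsub>coord_ring V\<^esub> (pullback V f ` {g \<in> regfuns B. g b = 0})"

definition fibre_ring ::
    "'p variety \<Rightarrow> 'q variety \<Rightarrow> ('p \<Rightarrow> 'q) \<Rightarrow> 'q \<Rightarrow> ('p \<Rightarrow> complex) set ring"
  where "fibre_ring V B f b = coord_ring V Quot fibre_ideal V B f b"

text \<open>Flatness of the coordinate ring of \<open>V\<close> over that of \<open>B\<close>, by the equational criterion (every
  linear relation is a consequence of relations over the base ring); this avoids tensor products.\<close>

definition flat_morphism :: "'p variety \<Rightarrow> 'q variety \<Rightarrow> ('p \<Rightarrow> 'q) \<Rightarrow> bool"
  where "flat_morphism V B f \<longleftrightarrow> morphism V B f \<and>
    (\<forall>(n::nat) a m.
      (\<forall>i<n. a i \<in> regfuns B \<and> m i \<in> regfuns V) \<and>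
      (\<forall>p\<in>pts V. (\<Sum>i<n. a i (f p) * m i p) = 0) \<longrightarrow>
      (\<exists>(k::nat) b m'.
        (\<forall>i<n. \<forall>j<k. b i j \<in> regfuns B) \<and> (\<forall>j<k. m' j \<in> regfuns V) \<and>
        (\<forall>i<n. \<forall>p\<in>pts V. m i p = (\<Sum>j<k. b i j (f p) * m' j p)) \<and>
        (\<forall>j<k. \<forall>q\<in>pts B. (\<Sum>i<n. a i q * b i j q) = 0)))"

text \<open>\<open>f : V \<rightarrow> B\<close> is a deformation of \<open>Z\<close> over the pointed base \<open>(B, b)\<close>: it is flat and its
  fibre over \<open>b\<close> is isomorphic to \<open>Z\<close> over the complex numbers, so the ring isomorphism has to
  respect constants.\<close>

definition deformation ::
    "'p variety \<Rightarrow> 'q variety \<Rightarrow> ('p \<Rightarrow> 'q) \<Rightarrow> 'q \<Rightarrow> 'r variety \<Rightarrow> bool"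
  where "deformation V B f b Z \<longleftrightarrow> flat_morphism V B f \<and> b \<in> pts B \<and>
    (\<exists>h \<in> ring_iso (coord_ring Z) (fibre_ring V B f b).
      \<forall>k. h (\<lambda>p\<in>pts Z. k) = fibre_ideal V B f b +>\<^bsub>coord_ring V\<^esub> (\<lambda>p\<in>pts V. k))"


section \<open>The deformation of type \<open>G\<^sub>2\<close> and its quotient\<close>

text \<open>Points are tuples \<open>(x, y, z, t2, t6)\<close>, the base has points \<open>(t2, t6)\<close>.\<close>

type_synonym point5 = "complex \<times> complex \<times> complex \<times> complex \<times> complex"

definition X_pts :: "point5 set"
  where "X_pts = {(x, y, z, t2, t6).
    z^2 = x * y * (x + y) - 1/2 * t2 * x * y + 1/4 * (t6 + 1/108 * t2^3)}"

definition X_var :: "point5 variety"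
  where "X_var = affine_variety
    {\<lambda>(x, y, z, t2, t6). x, \<lambda>(x, y, z, t2, t6). y, \<lambda>(x, y, z, t2, t6). z,
     \<lambda>(x, y, z, t2, t6). t2, \<lambda>(x, y, z, t2, t6). t6} X_pts"

definition base_var :: "(complex \<times> complex) variety"
  where "base_var = affine_variety {\<lambda>(t2, t6). t2, \<lambda>(t2, t6). t6} UNIV"

definition alpha :: "point5 \<Rightarrow> complex \<times> complex"
  where "alpha = (\<lambda>(x, y, z, t2, t6). (t2, t6))"

definition sigma :: "point5 \<Rightarrow> point5"
  where "sigma = (\<lambda>(x, y, z, t2, t6) \<in> X_pts. (x, - x - y + 1/2 * t2, - z, t2, t6))"

definition rho :: "point5 \<Rightarrow> point5"
  where "rho = (\<lambda>(x, y, z, t2, t6) \<in> X_pts. (y, - x - y + 1/2 * t2, z, t2, t6))"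

text \<open>The group of order 6 generated by \<open>\<sigma>\<close> and \<open>\<rho>\<close> inside the permutations of \<open>X\<close>.\<close>

definition Omega :: "(point5 \<Rightarrow> point5) monoid"
  where "Omega = (BijGroup X_pts)\<lparr>carrier := generate (BijGroup X_pts) {sigma, rho}\<rparr>"

definition X_quot :: "point5 set variety"
  where "X_quot = quotient_variety X_var Omega (\<lambda>g. g)"

text \<open>\<open>alpha\<close> is constant on orbits, so it induces a map on the quotient.\<close>

definition alpha_bar :: "point5 set \<Rightarrow> complex \<times> complex"
  where "alpha_bar orb = the_elem (alpha ` orb)"

text \<open>Normal form \<open>x\<^sup>3 + x y\<^sup>3 + z\<^sup>2 = 0\<close> of the simple singularity of type \<open>E\<^sub>7\<close>.\<close>

definition E7_var :: "(complex \<times> complex \<times> complex) variety"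
  where "E7_var = affine_variety
    {\<lambda>(x, y, z). x, \<lambda>(x, y, z). y, \<lambda>(x, y, z). z}
    {(x, y, z). x^3 + x * y^3 + z^2 = 0}"

lemma X_pts_subst_y:
  fixes x y t2 :: complex
  shows "x * (- x - y + 1/2 * t2) * (x + (- x - y + 1/2 * t2)) - 1/2 * t2 * x * (- x - y + 1/2 * t2) =
    x * y * (x + y) - 1/2 * t2 * x * y"
proof -
  define h where "h = 1/2 * t2"
  have "x * (- x - y + h) * (x + (- x - y + h)) - h * x * (- x - y + h) =
    x * y * (x + y) - h * x * y"
    by (simp add: algebra_simps)
  then show ?thesis by (simp add: h_def)
qed

lemma sigma_in_X: "p \<in> X_pts \<Longrightarrow> sigma p \<in> X_pts"
  using X_pts_subst_y by (cases p) (simp add: sigma_def X_pts_def)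

lemma rho_in_X:
  assumes "p \<in> X_pts"
  shows "rho p \<in> X_pts"
proof (cases p)
  case (fields x y z t2 t6)
  define w where "w = - x - y + 1/2 * t2"
  have "x * y * (x + y) - 1/2 * t2 * x * y = y * x * (y + x) - 1/2 * t2 * y * x"
    by (simp add: ac_simps)
  also have "\<dots> = y * w * (y + w) - 1/2 * t2 * y * w"
    using X_pts_subst_y[of y x t2] unfolding w_def by (simp only: minus_diff_commute)
  finally have "(y, w, z, t2, t6) \<in> X_pts"
    using assms unfolding fields X_pts_def by simp
  moreover have "rho p = (y, w, z, t2, t6)"
    using assms unfolding fields rho_def w_def by simp
  ultimately show ?thesis by simp
qed

lemma sigma_sigma: "p \<in> X_pts \<Longrightarrow> sigma (sigma p) = p"
  using sigma_in_X[of p] by (cases p) (simp add: sigma_def)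

lemma rho_rho_rho: "p \<in> X_pts \<Longrightarrow> rho (rho (rho p)) = p"
  using rho_in_X[of p] rho_in_X[of "rho p"] by (cases p) (simp add: rho_def)

lemma sigma_Bij: "sigma \<in> carrier (BijGroup X_pts)"
proof -
  have "bij_betw sigma X_pts X_pts"
    by (rule bij_betw_byWitness[where f' = sigma]) (auto simp: sigma_in_X sigma_sigma)
  then show ?thesis
    by (simp add: BijGroup_def Bij_def sigma_def)
qed

lemma rho_Bij: "rho \<in> carrier (BijGroup X_pts)"
proof -
  have "bij_betw rho X_pts X_pts"
    by (rule bij_betw_byWitness[where f' = "rho \<circ> rho"]) (auto simp: rho_in_X rho_rho_rho)
  then show ?thesis
    by (simp add: BijGroup_def Bij_def rho_def)
qed

end

theory Submission
  imports Defs "HOL-Computational_Algebra.Fundamental_Theorem_Algebra"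
begin

text \<open>With \<open>w = t2/2 - x - y\<close> the equation of the deformation becomes
\<open>z\<^sup>2 = c - x y w\<close>, \<open>c = (t6 + t2\<^sup>3/108)/4\<close>. So \<open>X\<close> is an affine 4-space with
coordinates \<open>x, y, w, z\<close>, on which the symmetric group permutes \<open>x, y, w\<close> and acts on \<open>z\<close> by the
sign. The invariants are generated by \<open>t2\<close>, \<open>t6\<close>, \<open>p = xy + yw + wx\<close>, \<open>u = z\<^sup>2\<close> and
\<open>v = z (x - y)(x - w)(y - w)\<close>; the only relation is \<open>v\<^sup>2 = u D\<close>, where \<open>D\<close> is the
discriminant of the monic cubic with roots \<open>x, y, w\<close>, whose coefficients are \<open>t2/2\<close>, \<open>p\<close> and
\<open>c - u\<close> up to sign. Hence the coordinate ring of \<open>X/\<Omega>\<close> is free over that of the base, with basis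
\<open>p\<^sup>i u\<^sup>j v\<^sup>l\<close>, \<open>l < 2\<close> (lemmas \<open>invariant_in_span\<close>, \<open>quotient_expansion\<close> and
\<open>coefficients_vanish\<close>); this gives flatness, and it identifies every scheme-theoretic fibre with the
double plane \<open>v\<^sup>2 = u D(p, u)\<close> (theorem \<open>fibre_iso\<close>). Over the origin \<open>D = -4 p\<^sup>3 - 27 u\<^sup>2\<close>,
and a rescaling of the coordinates turns the fibre into \<open>x\<^sup>3 + x y\<^sup>3 + z\<^sup>2 = 0\<close>.

The branch curve \<open>u D = 0\<close> is reducible, and its two components always meet: for \<open>u = 0\<close> the
discriminant is a cubic in \<open>p\<close> with leading coefficient \<open>-4\<close>, so it has a root. There the
branch curve, and with it the double plane, is singular.

That such a point is singular in the sense of regular local rings needs two facts. The maximal ideal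
of the local ring cannot be generated by two elements, because the three partial derivatives survive as
point derivations. The dimension of the local ring is at most two: any three functions on the surface are
algebraically dependent by a count of monomials, and a relation whose lowest term is read off
lexicographically rules out a chain of four primes (lemma \<open>no_long_prime_chain\<close>).\<close>

section \<open>Localizations and their dimension\<close>

locale mult_subset = cring R for R (structure) +
  fixes S
  assumes S_carrier: "S \<subseteq> carrier R"
    and S_one: "\<one> \<in> S"
    and S_mult: "s \<in> S \<Longrightarrow> t \<in> S \<Longrightarrow> s \<otimes> t \<in> S"
begin

abbreviation "fr \<equiv> loc_frac R S"
abbreviation "L \<equiv> localization R S"

lemma S_closed [simp]: "s \<in> S \<Longrightarrow> s \<in> carrier R"
  using S_carrier by blast

lemma frac_rel_iff:
  "((a, s), (b, t)) \<in> frac_rel R S \<longleftrightarrow>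
    a \<in> carrier R \<and> s \<in> S \<and> b \<in> carrier R \<and> t \<in> S \<and> (\<exists>u\<in>S. u \<otimes> (a \<otimes> t) = u \<otimes> (b \<otimes> s))"
proof -
  have "u \<otimes> ((a \<otimes> t) \<ominus> (b \<otimes> s)) = \<zero> \<longleftrightarrow> u \<otimes> (a \<otimes> t) = u \<otimes> (b \<otimes> s)"
    if "a \<in> carrier R" "s \<in> S" "b \<in> carrier R" "t \<in> S" "u \<in> S" for u
  proof -
    have "u \<otimes> ((a \<otimes> t) \<ominus> (b \<otimes> s)) = u \<otimes> (a \<otimes> t) \<ominus> u \<otimes> (b \<otimes> s)"
      using that by (simp add: a_minus_def r_distr r_minus)
    then show ?thesis using that by simp
  qed
  then show ?thesis unfolding frac_rel_def by auto
qed

lemma equiv_frac_rel: "equiv (carrier R \<times> S) (frac_rel R S)"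
proof (rule equivI)
  show "frac_rel R S \<subseteq> (carrier R \<times> S) \<times> (carrier R \<times> S)"
    by (auto simp: frac_rel_def)
  show "refl_on (carrier R \<times> S) (frac_rel R S)"
    by (auto simp: refl_on_def frac_rel_iff intro!: bexI[OF _ S_one])
  show "sym (frac_rel R S)"
    by (rule symI, clarify) (metis frac_rel_iff)
  show "trans (frac_rel R S)"
  proof (rule transI, clarify)
    fix a s b t c q
    assume "((a, s), (b, t)) \<in> frac_rel R S" "((b, t), (c, q)) \<in> frac_rel R S"
    then obtain u w where c: "a \<in> carrier R" "s \<in> S" "b \<in> carrier R" "t \<in> S" "c \<in> carrier R" "q \<in> S"
      "u \<in> S" "w \<in> S" and u: "u \<otimes> (a \<otimes> t) = u \<otimes> (b \<otimes> s)" and w: "w \<otimes> (b \<otimes> q) = w \<otimes> (c \<otimes> t)"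
      unfolding frac_rel_iff by blast
    have "u \<otimes> w \<otimes> t \<otimes> (a \<otimes> q) = w \<otimes> q \<otimes> (u \<otimes> (a \<otimes> t))" using c by (simp add: m_ac)
    also have "\<dots> = u \<otimes> s \<otimes> (w \<otimes> (b \<otimes> q))" unfolding u using c by (simp add: m_ac)
    also have "\<dots> = u \<otimes> w \<otimes> t \<otimes> (c \<otimes> s)" unfolding w using c by (simp add: m_ac)
    finally show "((a, s), (c, q)) \<in> frac_rel R S"
      unfolding frac_rel_iff using c S_mult by blast
  qed
qed

lemma frac_eq_iff:
  assumes "a \<in> carrier R" "s \<in> S" "b \<in> carrier R" "t \<in> S"
  shows "fr a s = fr b t \<longleftrightarrow> (\<exists>u\<in>S. u \<otimes> (a \<otimes> t) = u \<otimes> (b \<otimes> s))"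
  unfolding loc_frac_def using eq_equiv_class_iff[OF equiv_frac_rel] assms
  by (simp add: frac_rel_iff)

lemma frac_carrier [simp]: "a \<in> carrier R \<Longrightarrow> s \<in> S \<Longrightarrow> fr a s \<in> carrier L"
  by (auto simp: localization_def loc_frac_def intro!: quotientI)

lemma carrier_fracE:
  assumes "x \<in> carrier L"
  obtains a s where "a \<in> carrier R" "s \<in> S" "x = fr a s"
  using assms by (auto simp: localization_def loc_frac_def elim!: quotientE)

lemma frac_mult:
  assumes "a \<in> carrier R" "s \<in> S" "b \<in> carrier R" "t \<in> S"
  shows "fr a s \<otimes>\<^bsub>L\<^esub> fr b t = fr (a \<otimes> b) (s \<otimes> t)"
proof -
  have "congruent2 (frac_rel R S) (frac_rel R S) (\<lambda>(a, s) (b, t). fr (a \<otimes> b) (s \<otimes> t))"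
  proof (rule congruent2I', clarify)
    fix a s a' s' b t b' t'
    assume "((a, s), (a', s')) \<in> frac_rel R S" "((b, t), (b', t')) \<in> frac_rel R S"
    then obtain u w where c: "a \<in> carrier R" "s \<in> S" "b \<in> carrier R" "t \<in> S"
      "a' \<in> carrier R" "s' \<in> S" "b' \<in> carrier R" "t' \<in> S" "u \<in> S" "w \<in> S"
      and u: "u \<otimes> (a \<otimes> s') = u \<otimes> (a' \<otimes> s)" and w: "w \<otimes> (b \<otimes> t') = w \<otimes> (b' \<otimes> t)"
      unfolding frac_rel_iff by blast
    have "u \<otimes> w \<otimes> (a \<otimes> b \<otimes> (s' \<otimes> t')) = u \<otimes> (a \<otimes> s') \<otimes> (w \<otimes> (b \<otimes> t'))" using c by (simp add: m_ac)
    also have "\<dots> = u \<otimes> w \<otimes> (a' \<otimes> b' \<otimes> (s \<otimes> t))" unfolding u w using c by (simp add: m_ac)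
    finally show "fr (a \<otimes> b) (s \<otimes> t) = fr (a' \<otimes> b') (s' \<otimes> t')"
      using c S_mult by (subst frac_eq_iff) auto
  qed
  from UN_equiv_class2[OF equiv_frac_rel equiv_frac_rel this, of "(a,s)" "(b,t)"] assms
  show ?thesis by (simp add: localization_def loc_frac_def case_prod_unfold)
qed

lemma frac_add:
  assumes "a \<in> carrier R" "s \<in> S" "b \<in> carrier R" "t \<in> S"
  shows "fr a s \<oplus>\<^bsub>L\<^esub> fr b t = fr ((a \<otimes> t) \<oplus> (b \<otimes> s)) (s \<otimes> t)"
proof -
  have "congruent2 (frac_rel R S) (frac_rel R S) (\<lambda>(a, s) (b, t). fr ((a \<otimes> t) \<oplus> (b \<otimes> s)) (s \<otimes> t))"
  proof (rule congruent2I', clarify)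
    fix a s a' s' b t b' t'
    assume "((a, s), (a', s')) \<in> frac_rel R S" "((b, t), (b', t')) \<in> frac_rel R S"
    then obtain u w where c: "a \<in> carrier R" "s \<in> S" "b \<in> carrier R" "t \<in> S"
      "a' \<in> carrier R" "s' \<in> S" "b' \<in> carrier R" "t' \<in> S" "u \<in> S" "w \<in> S"
      and u: "u \<otimes> (a \<otimes> s') = u \<otimes> (a' \<otimes> s)" and w: "w \<otimes> (b \<otimes> t') = w \<otimes> (b' \<otimes> t)"
      unfolding frac_rel_iff by blast
    have "u \<otimes> w \<otimes> ((a \<otimes> t \<oplus> b \<otimes> s) \<otimes> (s' \<otimes> t')) =
        u \<otimes> (a \<otimes> s') \<otimes> (w \<otimes> (t \<otimes> t')) \<oplus> w \<otimes> (b \<otimes> t') \<otimes> (u \<otimes> (s \<otimes> s'))"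
      using c by (simp add: m_ac r_distr l_distr)
    also have "\<dots> = u \<otimes> w \<otimes> ((a' \<otimes> t' \<oplus> b' \<otimes> s') \<otimes> (s \<otimes> t))"
      unfolding u w using c by (simp add: m_ac r_distr l_distr)
    finally show "fr (a \<otimes> t \<oplus> b \<otimes> s) (s \<otimes> t) = fr (a' \<otimes> t' \<oplus> b' \<otimes> s') (s' \<otimes> t')"
      using c S_mult by (subst frac_eq_iff) auto
  qed
  from UN_equiv_class2[OF equiv_frac_rel equiv_frac_rel this, of "(a,s)" "(b,t)"] assms
  show ?thesis by (simp add: localization_def loc_frac_def case_prod_unfold)
qed

lemma frac_one: "\<one>\<^bsub>L\<^esub> = fr \<one> \<one>" and frac_zero: "\<zero>\<^bsub>L\<^esub> = fr \<zero> \<one>"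
  by (simp_all add: localization_def)

lemma frac_cancel:
  assumes "a \<in> carrier R" "s \<in> S" "t \<in> S"
  shows "fr (a \<otimes> t) (s \<otimes> t) = fr a s"
proof -
  have "\<one> \<otimes> (a \<otimes> t \<otimes> s) = \<one> \<otimes> (a \<otimes> (s \<otimes> t))" using assms by (simp add: m_ac)
  then show ?thesis using assms S_one S_mult by (subst frac_eq_iff) auto
qed

lemma frac_hom: "(\<lambda>r. fr r \<one>) \<in> ring_hom R L"
  by (rule ring_hom_memI) (simp_all add: S_one frac_mult frac_add frac_one)

end

text \<open>A polynomial relation between three elements, divided by the coefficient of its lexicographically
lowest monomial, has exactly this shape. The condition characterizes rings of dimension at most two
(Lombardi); it passes to localizations and quotients, and it refers to no prime ideals.\<close>

definition lex_dependent :: "('a, 'm) ring_scheme \<Rightarrow> bool"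
  where "lex_dependent R \<longleftrightarrow> (\<forall>a\<in>carrier R. \<forall>b\<in>carrier R. \<forall>c\<in>carrier R.
    \<exists>(i::nat) (j::nat) (k::nat). \<exists>x\<in>carrier R. \<exists>y\<in>carrier R. \<exists>z\<in>carrier R.
      a [^]\<^bsub>R\<^esub> (i::nat) \<otimes>\<^bsub>R\<^esub> (b [^]\<^bsub>R\<^esub> (j::nat) \<otimes>\<^bsub>R\<^esub> (c [^]\<^bsub>R\<^esub> k \<otimes>\<^bsub>R\<^esub> (\<one>\<^bsub>R\<^esub> \<oplus>\<^bsub>R\<^esub> c \<otimes>\<^bsub>R\<^esub> z)
        \<oplus>\<^bsub>R\<^esub> b \<otimes>\<^bsub>R\<^esub> y) \<oplus>\<^bsub>R\<^esub> a \<otimes>\<^bsub>R\<^esub> x) = \<zero>\<^bsub>R\<^esub>)"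

lemma lex_relation_hom:
  assumes "cring R" "cring S" "h \<in> ring_hom R S"
    "a \<in> carrier R" "b \<in> carrier R" "c \<in> carrier R" "x \<in> carrier R" "y \<in> carrier R" "z \<in> carrier R"
    and "a [^]\<^bsub>R\<^esub> (i::nat) \<otimes>\<^bsub>R\<^esub> (b [^]\<^bsub>R\<^esub> (j::nat) \<otimes>\<^bsub>R\<^esub> (c [^]\<^bsub>R\<^esub> (k::nat) \<otimes>\<^bsub>R\<^esub> (\<one>\<^bsub>R\<^esub> \<oplus>\<^bsub>R\<^esub> c \<otimes>\<^bsub>R\<^esub> z)
        \<oplus>\<^bsub>R\<^esub> b \<otimes>\<^bsub>R\<^esub> y) \<oplus>\<^bsub>R\<^esub> a \<otimes>\<^bsub>R\<^esub> x) = \<zero>\<^bsub>R\<^esub>"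
  shows "h a [^]\<^bsub>S\<^esub> i \<otimes>\<^bsub>S\<^esub> (h b [^]\<^bsub>S\<^esub> j \<otimes>\<^bsub>S\<^esub> (h c [^]\<^bsub>S\<^esub> k \<otimes>\<^bsub>S\<^esub> (\<one>\<^bsub>S\<^esub> \<oplus>\<^bsub>S\<^esub> h c \<otimes>\<^bsub>S\<^esub> h z)
        \<oplus>\<^bsub>S\<^esub> h b \<otimes>\<^bsub>S\<^esub> h y) \<oplus>\<^bsub>S\<^esub> h a \<otimes>\<^bsub>S\<^esub> h x) = \<zero>\<^bsub>S\<^esub>"
proof -
  interpret R: cring R by fact
  interpret S: cring S by fact
  interpret ring_hom_cring R S h
    using assms(1-3) by (simp add: ring_hom_cring_def ring_hom_cring_axioms_def)
  have "h (a [^]\<^bsub>R\<^esub> (i::nat) \<otimes>\<^bsub>R\<^esub> (b [^]\<^bsub>R\<^esub> (j::nat) \<otimes>\<^bsub>R\<^esub> (c [^]\<^bsub>R\<^esub> (k::nat) \<otimes>\<^bsub>R\<^esub> (\<one>\<^bsub>R\<^esub> \<oplus>\<^bsub>R\<^esub> c \<otimes>\<^bsub>R\<^esub> z)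
        \<oplus>\<^bsub>R\<^esub> b \<otimes>\<^bsub>R\<^esub> y) \<oplus>\<^bsub>R\<^esub> a \<otimes>\<^bsub>R\<^esub> x)) = \<zero>\<^bsub>S\<^esub>"
    using assms(10) by simp
  then show ?thesis using assms(4-9) by (simp add: R.m_closed hom_nat_pow)
qed

lemma lex_dependent_surj:
  assumes "cring R" "cring S" "h \<in> ring_hom R S" "h ` carrier R = carrier S" "lex_dependent R"
  shows "lex_dependent S"
  unfolding lex_dependent_def
proof (intro ballI)
  fix a' b' c' assume "a' \<in> carrier S" "b' \<in> carrier S" "c' \<in> carrier S"
  then obtain a b c where abc: "a \<in> carrier R" "b \<in> carrier R" "c \<in> carrier R"
    "a' = h a" "b' = h b" "c' = h c"
    unfolding assms(4)[symmetric] by blast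
  obtain i j k :: nat and x y z where "x\<in>carrier R" "y\<in>carrier R" "z\<in>carrier R"
      "a [^]\<^bsub>R\<^esub> (i::nat) \<otimes>\<^bsub>R\<^esub> (b [^]\<^bsub>R\<^esub> (j::nat) \<otimes>\<^bsub>R\<^esub> (c [^]\<^bsub>R\<^esub> k \<otimes>\<^bsub>R\<^esub> (\<one>\<^bsub>R\<^esub> \<oplus>\<^bsub>R\<^esub> c \<otimes>\<^bsub>R\<^esub> z)
        \<oplus>\<^bsub>R\<^esub> b \<otimes>\<^bsub>R\<^esub> y) \<oplus>\<^bsub>R\<^esub> a \<otimes>\<^bsub>R\<^esub> x) = \<zero>\<^bsub>R\<^esub>"
    using assms(5)[unfolded lex_dependent_def, rule_format, OF abc(1-3)] by (elim exE bexE)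
  from lex_relation_hom[OF assms(1-3) abc(1-3) this]
  show "\<exists>(i::nat) (j::nat) (k::nat). \<exists>x\<in>carrier S. \<exists>y\<in>carrier S. \<exists>z\<in>carrier S.
      a' [^]\<^bsub>S\<^esub> i \<otimes>\<^bsub>S\<^esub> (b' [^]\<^bsub>S\<^esub> j \<otimes>\<^bsub>S\<^esub> (c' [^]\<^bsub>S\<^esub> k \<otimes>\<^bsub>S\<^esub> (\<one>\<^bsub>S\<^esub> \<oplus>\<^bsub>S\<^esub> c' \<otimes>\<^bsub>S\<^esub> z)
        \<oplus>\<^bsub>S\<^esub> b' \<otimes>\<^bsub>S\<^esub> y) \<oplus>\<^bsub>S\<^esub> a' \<otimes>\<^bsub>S\<^esub> x) = \<zero>\<^bsub>S\<^esub>"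
    unfolding abc(4-6) using ring_hom_closed[OF assms(3)] \<open>x \<in> carrier R\<close> \<open>y \<in> carrier R\<close> \<open>z \<in> carrier R\<close>
    by (intro exI bexI) simp_all
qed

lemma primeideal_pow:
  assumes "primeideal P R" "a \<in> carrier R" "a \<notin> P" "b \<in> carrier R" "a [^]\<^bsub>R\<^esub> (n::nat) \<otimes>\<^bsub>R\<^esub> b \<in> P"
  shows "b \<in> P"
proof -
  interpret primeideal P R by fact
  show ?thesis
    using assms(4,5)
  proof (induction n arbitrary: b)
    case 0
    then show ?case by simp
  next
    case (Suc n)
    have "a [^]\<^bsub>R\<^esub> Suc n \<otimes>\<^bsub>R\<^esub> b = a [^]\<^bsub>R\<^esub> n \<otimes>\<^bsub>R\<^esub> (a \<otimes>\<^bsub>R\<^esub> b)"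
      using assms(2) Suc.prems(1) by (simp add: m_assoc)
    with Suc.prems(2) have "a [^]\<^bsub>R\<^esub> n \<otimes>\<^bsub>R\<^esub> (a \<otimes>\<^bsub>R\<^esub> b) \<in> P" by (simp only:)
    from Suc.IH[OF m_closed[OF assms(2) Suc.prems(1)] this] have "a \<otimes>\<^bsub>R\<^esub> b \<in> P" .
    from I_prime[OF assms(2) Suc.prems(1) this] assms(3) show ?case by (simp only: simp_thms)
  qed
qed

lemma ideal_add_cancel:
  assumes "ideal P R" "a \<in> carrier R" "b \<in> P" "a \<oplus>\<^bsub>R\<^esub> b \<in> P"
  shows "a \<in> P"
proof -
  interpret ideal P R by fact
  have "b \<in> carrier R" using assms(3) a_subset by blast
  then have "(a \<oplus>\<^bsub>R\<^esub> b) \<oplus>\<^bsub>R\<^esub> (\<ominus>\<^bsub>R\<^esub> b) = a" using assms(2) by (simp add: a_assoc r_neg)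
  moreover have "(a \<oplus>\<^bsub>R\<^esub> b) \<oplus>\<^bsub>R\<^esub> (\<ominus>\<^bsub>R\<^esub> b) \<in> P"
    by (rule additive_subgroup.a_closed[OF is_additive_subgroup assms(4)
          additive_subgroup.a_inv_closed[OF is_additive_subgroup assms(3)]])
  ultimately show ?thesis by (simp only:)
qed

text \<open>The relation is unwound along the chain. The power of \<open>a\<close> can be cancelled modulo \<open>P0\<close>, as
\<open>a \<notin> P0\<close>; the summand with \<open>x\<close> then disappears modulo \<open>P1\<close>, as \<open>a \<in> P1\<close>. Two more
such steps leave \<open>1 + c z\<close>, and so \<open>1\<close>, in \<open>P3\<close>.\<close>

lemma no_long_prime_chain:
  assumes R: "cring R"
    and "primeideal P0 R" "primeideal P1 R" "primeideal P2 R" "primeideal P3 R"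
    and c: "a \<in> carrier R" "b \<in> carrier R" "c \<in> carrier R" "x \<in> carrier R" "y \<in> carrier R" "z \<in> carrier R"
    and sub: "P0 \<subseteq> P1" "P1 \<subseteq> P2" "P2 \<subseteq> P3"
    and n: "a \<in> P1" "a \<notin> P0" "b \<in> P2" "b \<notin> P1" "c \<in> P3" "c \<notin> P2"
    and rel: "a [^]\<^bsub>R\<^esub> (i::nat) \<otimes>\<^bsub>R\<^esub> (b [^]\<^bsub>R\<^esub> (j::nat) \<otimes>\<^bsub>R\<^esub> (c [^]\<^bsub>R\<^esub> (k::nat) \<otimes>\<^bsub>R\<^esub> (\<one>\<^bsub>R\<^esub> \<oplus>\<^bsub>R\<^esub> c \<otimes>\<^bsub>R\<^esub> z)
        \<oplus>\<^bsub>R\<^esub> b \<otimes>\<^bsub>R\<^esub> y) \<oplus>\<^bsub>R\<^esub> a \<otimes>\<^bsub>R\<^esub> x) = \<zero>\<^bsub>R\<^esub>"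
  shows False
proof -
  interpret cring R by fact
  interpret P0: primeideal P0 R by fact
  interpret P1: primeideal P1 R by fact
  interpret P2: primeideal P2 R by fact
  interpret P3: primeideal P3 R by fact
  let ?t2 = "\<one>\<^bsub>R\<^esub> \<oplus>\<^bsub>R\<^esub> c \<otimes>\<^bsub>R\<^esub> z"
  let ?t1 = "c [^]\<^bsub>R\<^esub> k \<otimes>\<^bsub>R\<^esub> ?t2 \<oplus>\<^bsub>R\<^esub> b \<otimes>\<^bsub>R\<^esub> y"
  let ?t0 = "b [^]\<^bsub>R\<^esub> j \<otimes>\<^bsub>R\<^esub> ?t1 \<oplus>\<^bsub>R\<^esub> a \<otimes>\<^bsub>R\<^esub> x"
  have t: "?t2 \<in> carrier R" "?t1 \<in> carrier R" "?t0 \<in> carrier R"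
    "c [^]\<^bsub>R\<^esub> k \<otimes>\<^bsub>R\<^esub> ?t2 \<in> carrier R" "b [^]\<^bsub>R\<^esub> j \<otimes>\<^bsub>R\<^esub> ?t1 \<in> carrier R"
    using c by simp_all
  have "a [^]\<^bsub>R\<^esub> i \<otimes>\<^bsub>R\<^esub> ?t0 \<in> P0"
    unfolding rel by (rule P0.zero_closed)
  then have "?t0 \<in> P1"
    using primeideal_pow[OF assms(2) c(1) n(2) t(3)] sub(1) by blast
  then have "b [^]\<^bsub>R\<^esub> j \<otimes>\<^bsub>R\<^esub> ?t1 \<in> P1"
    by (rule ideal_add_cancel[OF P1.is_ideal t(5) P1.I_r_closed[OF n(1) c(4)]])
  then have "?t1 \<in> P2"
    using primeideal_pow[OF assms(3) c(2) n(4) t(2)] sub(2) by blast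
  then have "c [^]\<^bsub>R\<^esub> k \<otimes>\<^bsub>R\<^esub> ?t2 \<in> P2"
    by (rule ideal_add_cancel[OF P2.is_ideal t(4) P2.I_r_closed[OF n(3) c(5)]])
  then have "?t2 \<in> P3"
    using primeideal_pow[OF assms(4) c(3) n(6) t(1)] sub(3) by blast
  then have "\<one>\<^bsub>R\<^esub> \<in> P3"
    by (rule ideal_add_cancel[OF P3.is_ideal one_closed P3.I_r_closed[OF n(5) c(6)]])
  from P3.one_imp_carrier[OF this] P3.I_notcarr show False by metis
qed

text \<open>The elements that separate successive primes of the localization may be taken to be numerators, as
denominators are units. So a relation in the ring itself suffices.\<close>

lemma (in mult_subset) krull_dim_localization_le:
  assumes L: "cring L" and dep: "lex_dependent R"
  shows "krull_dim L \<le> 2"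
proof -
  have "n \<le> 2" if chain: "\<forall>i\<le>n. primeideal (P i) L" "\<forall>i<n. P i \<subset> P (Suc i)" for n and P :: "nat \<Rightarrow> ('a \<times> 'a) set set"
  proof (rule ccontr)
    assume "\<not> n \<le> 2"
    then have n: "3 \<le> n" by simp
    have num: "\<exists>a\<in>carrier R. fr a \<one> \<in> P (Suc i) \<and> fr a \<one> \<notin> P i" if i: "i < n" for i
    proof -
      have Q: "ideal (P (Suc i)) L" and P: "ideal (P i) L"
        using chain(1)[rule_format, of "Suc i"] chain(1)[rule_format, of i] i
        by (simp_all add: primeideal.axioms(1))
      obtain x where x: "x \<in> P (Suc i)" "x \<notin> P i" using chain(2)[rule_format, OF i] by blast
      have "x \<in> carrier L" using ideal.Icarr[OF Q x(1)] .
      then obtain a s where as: "a \<in> carrier R" "s \<in> S" "x = fr a s" by (rule carrier_fracE)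
      have "x \<otimes>\<^bsub>L\<^esub> fr s \<one> = fr a \<one>"
        unfolding as(3) using as(1,2) frac_cancel[of a \<one> s] by (simp add: frac_mult S_one)
      moreover have "fr s \<one> \<in> carrier L" using as(2) S_one by simp
      ultimately have 1: "fr a \<one> \<in> P (Suc i)" using ideal.I_r_closed[OF Q x(1)] by metis
      have "fr a \<one> \<otimes>\<^bsub>L\<^esub> fr \<one> s = x"
        unfolding as(3) using as(1,2) by (simp add: frac_mult S_one)
      moreover have "fr \<one> s \<in> carrier L" using as(2) by simp
      ultimately have "fr a \<one> \<notin> P i" using ideal.I_r_closed[OF P] x(2) by metis
      with 1 as(1) show ?thesis by blast
    qed
    obtain a where a: "a \<in> carrier R" "fr a \<one> \<in> P 1" "fr a \<one> \<notin> P 0"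
      using num[of 0] n by auto
    obtain b where b: "b \<in> carrier R" "fr b \<one> \<in> P 2" "fr b \<one> \<notin> P 1"
      using num[of 1] n by (auto simp: numeral_2_eq_2)
    obtain c where c: "c \<in> carrier R" "fr c \<one> \<in> P 3" "fr c \<one> \<notin> P 2"
      using num[of 2] n by (auto simp: numeral_3_eq_3 numeral_2_eq_2)
    obtain i j k :: nat and x y z where xyz: "x\<in>carrier R" "y\<in>carrier R" "z\<in>carrier R"
      and rel: "a [^]\<^bsub>R\<^esub> (i::nat) \<otimes>\<^bsub>R\<^esub> (b [^]\<^bsub>R\<^esub> (j::nat) \<otimes>\<^bsub>R\<^esub> (c [^]\<^bsub>R\<^esub> k \<otimes>\<^bsub>R\<^esub> (\<one>\<^bsub>R\<^esub> \<oplus>\<^bsub>R\<^esub> c \<otimes>\<^bsub>R\<^esub> z)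
        \<oplus>\<^bsub>R\<^esub> b \<otimes>\<^bsub>R\<^esub> y) \<oplus>\<^bsub>R\<^esub> a \<otimes>\<^bsub>R\<^esub> x) = \<zero>\<^bsub>R\<^esub>"
      using dep[unfolded lex_dependent_def, rule_format, OF a(1) b(1) c(1)] by (elim exE bexE)
    have pr: "primeideal (P 0) L" "primeideal (P 1) L" "primeideal (P 2) L" "primeideal (P 3) L"
      using chain(1)[rule_format, of 0] chain(1)[rule_format, of 1] chain(1)[rule_format, of 2]
        chain(1)[rule_format, of 3] n by simp_all
    have "P 0 \<subset> P 1" "P 1 \<subset> P 2" "P 2 \<subset> P 3"
      using chain(2)[rule_format, of 0] chain(2)[rule_format, of 1] chain(2)[rule_format, of 2] n
      by (auto simp: numeral_3_eq_3 numeral_2_eq_2)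
    then have sub: "P 0 \<subseteq> P 1" "P 1 \<subseteq> P 2" "P 2 \<subseteq> P 3" by auto
    note rel' = lex_relation_hom[OF is_cring L frac_hom a(1) b(1) c(1) xyz rel]
    have cl: "fr r \<one> \<in> carrier L" if "r \<in> carrier R" for r
      using that S_one by simp
    show False
      by (rule no_long_prime_chain[OF L pr cl[OF a(1)] cl[OF b(1)] cl[OF c(1)] cl[OF xyz(1)] cl[OF xyz(2)]
          cl[OF xyz(3)] sub a(2,3) b(2,3) c(2,3) rel'])
  qed
  then show ?thesis
    unfolding krull_dim_def by (auto intro!: Sup_least simp: numeral_eq_enat)
qed

section \<open>A criterion for singular points\<close>

text \<open>The solution is the cross product of the two rows, unless these are parallel.\<close>

lemma linear_system_2x3:
  fixes v1 v2 v3 w1 w2 w3 :: complex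
  obtains l1 l2 l3 where "l1 * v1 + l2 * v2 + l3 * v3 = 0" "l1 * w1 + l2 * w2 + l3 * w3 = 0"
    "\<not> (l1 = 0 \<and> l2 = 0 \<and> l3 = 0)"
proof (cases "v1 = 0 \<and> v2 = 0 \<and> v3 = 0")
  case True
  show ?thesis
  proof (cases "w1 = 0 \<and> w2 = 0")
    case True
    with \<open>v1 = 0 \<and> v2 = 0 \<and> v3 = 0\<close> show ?thesis using that[of 1 0 0] by simp
  next
    case False
    with \<open>v1 = 0 \<and> v2 = 0 \<and> v3 = 0\<close> show ?thesis using that[of "- w2" w1 0] by auto
  qed
next
  case False
  define c1 c2 c3 where c_def: "c1 = v2 * w3 - v3 * w2" "c2 = v3 * w1 - v1 * w3" "c3 = v1 * w2 - v2 * w1"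
  show ?thesis
  proof (cases "c1 = 0 \<and> c2 = 0 \<and> c3 = 0")
    case False
    show ?thesis
      by (rule that[OF _ _ False]) (simp_all add: c_def algebra_simps)
  next
    case True
    then have eq: "v2 * w3 = v3 * w2" "v3 * w1 = v1 * w3" "v1 * w2 = v2 * w1"
      by (simp_all add: c_def)
    consider "v1 \<noteq> 0" | "v2 \<noteq> 0" | "v3 \<noteq> 0" using \<open>\<not> (v1 = 0 \<and> v2 = 0 \<and> v3 = 0)\<close> by blast
    then show ?thesis
    proof cases
      case 1
      then show ?thesis using that[of "- v2" v1 0] eq by (simp add: algebra_simps)
    next
      case 2
      then show ?thesis using that[of v2 "- v1" 0] eq by (simp add: algebra_simps)
    next
      case 3
      then show ?thesis using that[of v3 0 "- v1"] eq by (simp add: algebra_simps)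
    qed
  qed
qed

text \<open>The evaluation \<open>e\<close> makes the complex numbers a module over the ring; these are the derivations
with values in it, that is, the Zariski tangent vectors at the point \<open>e\<close>.\<close>

definition point_derivation :: "('a, 'm) ring_scheme \<Rightarrow> ('a \<Rightarrow> complex) \<Rightarrow> ('a \<Rightarrow> complex) \<Rightarrow> bool"
  where "point_derivation R e D \<longleftrightarrow> (\<forall>a\<in>carrier R. \<forall>b\<in>carrier R.
    D (a \<oplus>\<^bsub>R\<^esub> b) = D a + D b \<and> D (a \<otimes>\<^bsub>R\<^esub> b) = e a * D b + e b * D a)"

lemma point_derivation_lincomb:
  assumes "point_derivation R e D1" "point_derivation R e D2" "point_derivation R e D3"
  shows "point_derivation R e (\<lambda>a. k1 * D1 a + k2 * D2 a + k3 * D3 a)"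
  using assms unfolding point_derivation_def by (auto simp: algebra_simps)

locale complex_point = cring R for R (structure) +
  fixes e :: "'a \<Rightarrow> complex"
  assumes e_mult: "a \<in> carrier R \<Longrightarrow> b \<in> carrier R \<Longrightarrow> e (a \<otimes> b) = e a * e b"
    and e_add: "a \<in> carrier R \<Longrightarrow> b \<in> carrier R \<Longrightarrow> e (a \<oplus> b) = e a + e b"
    and e_one: "e \<one> = 1"
begin

abbreviation "N \<equiv> {a \<in> carrier R. e a \<noteq> 0}"
abbreviation "Q \<equiv> localization R N"
abbreviation "fr \<equiv> loc_frac R N"

lemma mult_subset_N: "mult_subset R N"
  by unfold_locales (auto simp: e_mult e_one)

lemma numerator_of_maximal:
  assumes Q: "cring Q" and M: "maximalideal M' Q" and as: "a \<in> carrier R" "s \<in> N" "fr a s \<in> M'"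
  shows "e a = 0"
proof (rule ccontr)
  interpret S: mult_subset R N by (rule mult_subset_N)
  note S.S_closed [simp del]
  assume "e a \<noteq> 0"
  then have a: "a \<in> N" using as(1) by simp
  have s: "s \<in> carrier R" using as(2) by simp
  have "fr (\<one> \<otimes> (a \<otimes> s)) (\<one> \<otimes> (a \<otimes> s)) = fr \<one> \<one>"
    by (rule S.frac_cancel[OF one_closed S.S_one S.S_mult[OF a as(2)]])
  then have "fr a s \<otimes>\<^bsub>Q\<^esub> fr s a = \<one>\<^bsub>Q\<^esub>"
    unfolding S.frac_mult[OF as(1,2) s a] S.frac_one m_comm[OF s as(1)] using as(1) s by simp
  moreover have "fr a s \<otimes>\<^bsub>Q\<^esub> fr s a \<in> M'"
    by (rule ideal.I_r_closed[OF maximalideal.axioms(1)[OF M] as(3) S.frac_carrier[OF s a]])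
  ultimately have "\<one>\<^bsub>Q\<^esub> \<in> M'" by (simp only:)
  from ideal.one_imp_carrier[OF maximalideal.axioms(1)[OF M] this] maximalideal.I_notcarr[OF M]
  show False by simp
qed

text \<open>Otherwise the maximal ideal and the fraction would generate the unit ideal. Clearing denominators in
the resulting expression for \<open>1\<close> gives an equation between an element outside the kernel of the evaluation
and one inside.\<close>

lemma maximal_contains:
  assumes Q: "cring Q" and M: "maximalideal M' Q" and m: "m \<in> carrier R" "e m = 0"
  shows "fr m \<one> \<in> M'"
proof (rule ccontr)
  interpret S: mult_subset R N by (rule mult_subset_N)
  note S.S_closed [simp del]
  have idl: "ideal M' Q" by (rule maximalideal.axioms(1)[OF M])
  have mc: "fr m \<one> \<in> carrier Q" using m S.S_one by simp
  define J where "J = M' <+>\<^bsub>Q\<^esub> (PIdl\<^bsub>Q\<^esub> (fr m \<one>))"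
  have J: "ideal J Q"
    unfolding J_def by (rule ring.add_ideals[OF cring.axioms(1)[OF Q] idl cring.cgenideal_ideal[OF Q mc]])
  have z: "\<zero>\<^bsub>Q\<^esub> \<in> M'" by (rule additive_subgroup.zero_closed[OF ideal.axioms(1)[OF idl]])
  assume nm: "fr m \<one> \<notin> M'"
  have mJ: "fr m \<one> \<in> J"
    unfolding J_def set_add_def'
    by (intro UnionI CollectI UN_I[OF z] UN_I[OF ring.cgenideal_self[OF cring.axioms(1)[OF Q] mc]])
      (simp add: abelian_monoid.l_zero[OF abelian_group.axioms(1)[OF ring.is_abelian_group[OF cring.axioms(1)[OF Q]]] mc])
  have sub: "M' \<subseteq> J"
  proof
    fix x assume x: "x \<in> M'"
    have z': "\<zero>\<^bsub>Q\<^esub> \<in> PIdl\<^bsub>Q\<^esub> (fr m \<one>)"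
      by (rule additive_subgroup.zero_closed[OF ideal.axioms(1)[OF cring.cgenideal_ideal[OF Q mc]]])
    have "x \<oplus>\<^bsub>Q\<^esub> \<zero>\<^bsub>Q\<^esub> = x"
      by (rule abelian_monoid.r_zero[OF abelian_group.axioms(1)[OF ring.is_abelian_group[OF cring.axioms(1)[OF Q]]]
            ideal.Icarr[OF idl x]])
    then show "x \<in> J" unfolding J_def set_add_def' using x z' by fastforce
  qed
  have "J \<subseteq> carrier Q" using ideal.Icarr[OF J] by (rule subsetI)
  from maximalideal.I_maximal[OF M J sub this] mJ nm have "J = carrier Q" by metis
  moreover have "\<one>\<^bsub>Q\<^esub> \<in> carrier Q" using S.frac_one S.S_one by simp
  ultimately have "\<one>\<^bsub>Q\<^esub> \<in> J" by (simp only:)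
  then obtain x r where x: "x \<in> M'" and r: "r \<in> carrier Q"
    and one: "\<one>\<^bsub>Q\<^esub> = x \<oplus>\<^bsub>Q\<^esub> (r \<otimes>\<^bsub>Q\<^esub> fr m \<one>)"
    unfolding J_def set_add_def' cgenideal_def by blast
  obtain a s where a: "a \<in> carrier R" "s \<in> N" "x = fr a s"
    by (rule S.carrier_fracE[OF ideal.Icarr[OF idl x]])
  obtain b t where b: "b \<in> carrier R" "t \<in> N" "r = fr b t"
    by (rule S.carrier_fracE[OF r])
  have ea: "e a = 0" using numerator_of_maximal[OF Q M a(1,2)] x a(3) by simp
  have "fr \<one> \<one> = fr (a \<otimes> (t \<otimes> \<one>) \<oplus> b \<otimes> m \<otimes> s) (s \<otimes> (t \<otimes> \<one>))"
    using one a b m S.S_mult[OF a(2) b(2)] S.S_one unfolding S.frac_one a(3) b(3)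
    by (simp add: S.frac_mult S.frac_add)
  then obtain u where u: "u \<in> N" "u \<otimes> (\<one> \<otimes> (s \<otimes> (t \<otimes> \<one>))) = u \<otimes> ((a \<otimes> (t \<otimes> \<one>) \<oplus> b \<otimes> m \<otimes> s) \<otimes> \<one>)"
    using S.frac_eq_iff[of \<one> \<one> "a \<otimes> (t \<otimes> \<one>) \<oplus> b \<otimes> m \<otimes> s" "s \<otimes> (t \<otimes> \<one>)"] a b m S.S_one
      S.S_mult[OF a(2) b(2)] by auto
  then have "e (u \<otimes> (\<one> \<otimes> (s \<otimes> (t \<otimes> \<one>)))) = e (u \<otimes> ((a \<otimes> (t \<otimes> \<one>) \<oplus> b \<otimes> m \<otimes> s) \<otimes> \<one>))"
    by (simp only:)
  moreover have "e (u \<otimes> ((a \<otimes> (t \<otimes> \<one>) \<oplus> b \<otimes> m \<otimes> s) \<otimes> \<one>)) = 0"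
    using a b m u(1) ea by (simp add: e_mult e_add)
  moreover have "e (u \<otimes> (\<one> \<otimes> (s \<otimes> (t \<otimes> \<one>)))) \<noteq> 0"
    using a b m u(1) by (simp add: e_mult e_one)
  ultimately show False by simp
qed

text \<open>The fractions whose numerator is killed by both the evaluation and the derivation form an ideal, by the
Leibniz rule. If it contains generators of the maximal ideal, it contains everything that vanishes at
the point. Working with numerators avoids extending the derivation to the localization.\<close>

lemma derivation_vanishes:
  assumes Q: "cring Q" and M: "maximalideal M' Q" and D: "point_derivation R e D"
    and A: "M' = Idl\<^bsub>Q\<^esub> A"
    and van: "\<And>x. x \<in> A \<Longrightarrow> \<exists>a\<in>carrier R. \<exists>s\<in>N. e a = 0 \<and> D a = 0 \<and> x = fr a s"
    and m: "m \<in> carrier R" "e m = 0"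
  shows "D m = 0"
proof -
  interpret S: mult_subset R N by (rule mult_subset_N)
  note S.S_closed [simp del]
  have Dm: "D (a \<otimes> b) = e a * D b + e b * D a" and Da: "D (a \<oplus> b) = D a + D b"
    if "a \<in> carrier R" "b \<in> carrier R" for a b
    using D that unfolding point_derivation_def by blast+
  have e0: "e \<zero> = 0" using e_add[of \<zero> \<zero>] by simp
  have D0: "D \<zero> = 0" using Da[of \<zero> \<zero>] by simp
  define I where "I = {x. \<exists>a\<in>carrier R. \<exists>s\<in>N. e a = 0 \<and> D a = 0 \<and> x = fr a s}"
  have IE: thesis if "x \<in> I"
    and "\<And>a s. \<lbrakk>a \<in> carrier R; s \<in> N; e a = 0; D a = 0; x = fr a s\<rbrakk> \<Longrightarrow> thesis" for x thesis
    using that(1) unfolding I_def by (elim CollectE[where a = x] bexE conjE) (rule that(2))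
  have Ic: "I \<subseteq> carrier Q" unfolding I_def using S.frac_carrier by auto
  have Iadd: "x \<oplus>\<^bsub>Q\<^esub> y \<in> I" if x: "x \<in> I" and y: "y \<in> I" for x y
  proof -
    obtain a s where a: "a \<in> carrier R" "s \<in> N" "e a = 0" "D a = 0" "x = fr a s"
      by (rule IE[OF x])
    obtain b t where b: "b \<in> carrier R" "t \<in> N" "e b = 0" "D b = 0" "y = fr b t"
      by (rule IE[OF y])
    note c = a b
    have "x \<oplus>\<^bsub>Q\<^esub> y = fr (a \<otimes> t \<oplus> b \<otimes> s) (s \<otimes> t)" unfolding c(5,10) by (rule S.frac_add[OF c(1,2,6,7)])
    moreover have "e (a \<otimes> t \<oplus> b \<otimes> s) = 0" "D (a \<otimes> t \<oplus> b \<otimes> s) = 0" "a \<otimes> t \<oplus> b \<otimes> s \<in> carrier R"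
      using c(1-4,6-9) by (simp_all add: e_add e_mult Dm Da)
    ultimately show ?thesis unfolding I_def using S.S_mult[OF c(2,7)] by blast
  qed
  have Imult: "r \<otimes>\<^bsub>Q\<^esub> x \<in> I" if x: "x \<in> I" and r: "r \<in> carrier Q" for x r
  proof -
    obtain a s where c: "a \<in> carrier R" "s \<in> N" "e a = 0" "D a = 0" "x = fr a s"
      by (rule IE[OF x])
    obtain b t where b: "b \<in> carrier R" "t \<in> N" "r = fr b t"
      by (rule S.carrier_fracE[OF r])
    have "r \<otimes>\<^bsub>Q\<^esub> x = fr (b \<otimes> a) (t \<otimes> s)" unfolding c(5) b(3) by (rule S.frac_mult[OF b(1,2) c(1,2)])
    moreover have "e (b \<otimes> a) = 0" "D (b \<otimes> a) = 0" "b \<otimes> a \<in> carrier R"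
      using c(1-4) b(1,2) by (simp_all add: e_mult Dm)
    ultimately show ?thesis unfolding I_def using S.S_mult[OF b(2) c(2)] by blast
  qed
  have "ideal I Q"
  proof (rule idealI)
    interpret Q: cring Q by (rule Q)
    show "ring Q" by (rule Q.ring_axioms)
    show "subgroup I (add_monoid Q)"
    proof (rule Q.add.subgroupI)
      show "I \<subseteq> carrier Q" by (rule Ic)
      have "fr \<zero> \<one> \<in> I" unfolding I_def using e0 D0 S.S_one by blast
      then show "I \<noteq> {}" by blast
    next
      fix x assume x: "x \<in> I"
      then have xc: "x \<in> carrier Q" using Ic by blast
      have "(\<ominus>\<^bsub>Q\<^esub> \<one>\<^bsub>Q\<^esub>) \<otimes>\<^bsub>Q\<^esub> x \<in> I" by (rule Imult[OF x]) simp
      then show "\<ominus>\<^bsub>Q\<^esub> x \<in> I" using xc by (simp add: Q.l_minus)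
    qed (rule Iadd)
    fix x r assume x: "x \<in> I" and r: "r \<in> carrier Q"
    show "r \<otimes>\<^bsub>Q\<^esub> x \<in> I" by (rule Imult[OF x r])
    moreover have "x \<otimes>\<^bsub>Q\<^esub> r = r \<otimes>\<^bsub>Q\<^esub> x" using Ic x r by (intro Q.m_comm) auto
    ultimately show "x \<otimes>\<^bsub>Q\<^esub> r \<in> I" by simp
  qed
  moreover have "A \<subseteq> I" unfolding I_def using van by blast
  ultimately have "M' \<subseteq> I" unfolding A by (rule ring.genideal_minimal[OF cring.axioms(1)[OF Q]])
  then have "fr m \<one> \<in> I" using maximal_contains[OF Q M m] by blast
  then obtain a s where c: "a \<in> carrier R" "s \<in> N" "e a = 0" "D a = 0" "fr m \<one> = fr a s"
    by (rule IE)
  then obtain u where u: "u \<in> N" "u \<otimes> (m \<otimes> s) = u \<otimes> (a \<otimes> \<one>)"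
    using S.frac_eq_iff[OF m(1) S.S_one c(1,2)] by blast
  have "D (u \<otimes> (m \<otimes> s)) = e u * e s * D m"
    using u(1) m c(2) by (simp add: Dm e_mult)
  moreover have "D (u \<otimes> (a \<otimes> \<one>)) = 0"
    using u(1) c by (simp add: Dm e_mult)
  ultimately show ?thesis using u c(2) by auto
qed

lemma maximalideal_kernel:
  assumes const: "\<And>k. \<exists>a\<in>carrier R. e a = k"
  shows "maximalideal {a \<in> carrier R. e a = 0} R"
proof (rule maximalidealI)
  have e0: "e \<zero> = 0" using e_add[of \<zero> \<zero>] by simp
  have em: "e (\<ominus> a) = - e a" if "a \<in> carrier R" for a
    using e_add[of a "\<ominus> a"] that e0 by (simp add: r_neg eq_neg_iff_add_eq_0 add.commute)
  show "ideal {a \<in> carrier R. e a = 0} R"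
  proof (rule idealI)
    show "subgroup {a \<in> carrier R. e a = 0} (add_monoid R)"
      by (rule add.subgroupI) (use e0 in \<open>auto simp: em e_add\<close>)
  qed (auto simp: e_mult ring_axioms)
  have "\<one> \<in> carrier R" "\<one> \<notin> {a \<in> carrier R. e a = 0}" by (simp_all add: e_one)
  then show "carrier R \<noteq> {a \<in> carrier R. e a = 0}" by metis
  fix J assume J: "ideal J R" "{a \<in> carrier R. e a = 0} \<subseteq> J" "J \<subseteq> carrier R"
  show "J = {a \<in> carrier R. e a = 0} \<or> J = carrier R"
  proof (cases "J = {a \<in> carrier R. e a = 0}")
    case False
    then obtain b where b: "b \<in> J" "e b \<noteq> 0" "b \<in> carrier R" using J by blast
    obtain k where k: "k \<in> carrier R" "e k = 1 / e b" using const by blast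
    have "\<one> \<oplus> (\<ominus> (k \<otimes> b)) \<in> J"
      using J(2) k b by (auto simp: e_add em e_mult e_one)
    moreover have "k \<otimes> b \<in> J" by (rule ideal.I_l_closed[OF J(1) b(1) k(1)])
    then have "\<ominus> (k \<otimes> b) \<in> J" by (rule additive_subgroup.a_inv_closed[OF ideal.axioms(1)[OF J(1)]])
    ultimately have "\<one> \<in> J" using ideal_add_cancel[OF J(1) one_closed] by blast
    then show ?thesis using ideal.one_imp_carrier[OF J(1)] by blast
  qed blast
qed

text \<open>A regular local ring of dimension at most two would have a maximal ideal with at most two generators. Some
nontrivial combination of three tangent vectors kills both generators, hence the whole maximal ideal,
which contradicts that the three are independent on it.\<close>

theorem singular_pointI:
  assumes dep: "lex_dependent R"
    and const: "\<And>k. \<exists>a\<in>carrier R. e a = k"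
    and D: "point_derivation R e D1" "point_derivation R e D2" "point_derivation R e D3"
    and m: "m1 \<in> carrier R" "e m1 = 0" "m2 \<in> carrier R" "e m2 = 0" "m3 \<in> carrier R" "e m3 = 0"
    and basis: "D1 m1 = 1" "D2 m1 = 0" "D3 m1 = 0" "D1 m2 = 0" "D2 m2 = 1" "D3 m2 = 0"
      "D1 m3 = 0" "D2 m3 = 0" "D3 m3 = 1"
  shows "singular_point R {a \<in> carrier R. e a = 0}"
  unfolding singular_point_def
proof (intro conjI maximalideal_kernel const notI)
  interpret S: mult_subset R N by (rule mult_subset_N)
  note S.S_closed [simp del]
  have "carrier R - {a \<in> carrier R. e a = 0} = N" by blast
  moreover assume "regular_local_ring (localization R (carrier R - {a \<in> carrier R. e a = 0}))"
  ultimately have "regular_local_ring Q" by simp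
  then obtain M' A where Q: "cring Q" and M: "maximalideal M' Q" and A: "A \<subseteq> carrier Q" "finite A"
    "enat (card A) \<le> krull_dim Q" "M' = Idl\<^bsub>Q\<^esub> A"
    unfolding regular_local_ring_def by blast
  have "enat (card A) \<le> 2" using A(3) S.krull_dim_localization_le[OF Q dep] by (rule order_trans)
  then have "card A \<le> 2" by (simp add: numeral_eq_enat)
  have AM: "A \<subseteq> M'" unfolding A(4) by (rule ring.genideal_self[OF cring.axioms(1)[OF Q] A(1)])
  have "\<exists>num. \<forall>x\<in>A. num x \<in> carrier R \<and> e (num x) = 0 \<and> (\<exists>s\<in>N. x = fr (num x) s)"
  proof (rule bchoice, rule ballI)
    fix x assume x: "x \<in> A"
    obtain a s where a: "a \<in> carrier R" "s \<in> N" "x = fr a s"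
      by (rule S.carrier_fracE[of x]) (use x A(1) in auto)
    moreover have "e a = 0" using numerator_of_maximal[OF Q M a(1,2)] x AM a(3) by blast
    ultimately show "\<exists>a. a \<in> carrier R \<and> e a = 0 \<and> (\<exists>s\<in>N. x = fr a s)" by blast
  qed
  then obtain num where num: "\<And>x. x \<in> A \<Longrightarrow> num x \<in> carrier R \<and> e (num x) = 0 \<and> (\<exists>s\<in>N. x = fr (num x) s)"
    by blast
  have "\<exists>a b. A \<subseteq> {a, b}"
  proof -
    consider "card A = 0" | "card A = 1" | "card A = 2" using \<open>card A \<le> 2\<close> by linarith
    then show ?thesis
      using A(2) by cases (auto simp: card_1_singleton_iff card_2_iff)
  qed
  then obtain x y where xy: "A \<subseteq> {x, y}" by blast
  obtain l1 l2 l3 where l: "l1 * D1 (num x) + l2 * D2 (num x) + l3 * D3 (num x) = 0"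
    "l1 * D1 (num y) + l2 * D2 (num y) + l3 * D3 (num y) = 0" "\<not> (l1 = 0 \<and> l2 = 0 \<and> l3 = 0)"
    by (rule linear_system_2x3)
  let ?D = "\<lambda>a. l1 * D1 a + l2 * D2 a + l3 * D3 a"
  have van: "?D m = 0" if mm: "m \<in> carrier R" "e m = 0" for m
  proof (rule derivation_vanishes[OF Q M point_derivation_lincomb[OF D] A(4) _ mm])
    fix z assume z: "z \<in> A"
    then have "?D (num z) = 0" using xy l by auto
    then show "\<exists>a\<in>carrier R. \<exists>s\<in>N. e a = 0 \<and> ?D a = 0 \<and> z = fr a s"
      using num[OF z] by blast
  qed
  from van[OF m(1,2)] van[OF m(3,4)] van[OF m(5,6)] l(3) show False by (simp add: basis)
qed

end

section \<open>Polynomial functions and their spans\<close>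

lemma poly_funs_sum: "(\<And>i. i \<in> I \<Longrightarrow> f i \<in> poly_funs C) \<Longrightarrow> (\<lambda>p. \<Sum>i\<in>I. f i p) \<in> poly_funs C"
proof (induction I rule: infinite_finite_induct)
  case (insert i I)
  then show ?case using poly_funs.add[of "f i" C "\<lambda>p. \<Sum>i\<in>I. f i p"] by simp
qed (simp_all add: poly_funs.const)

lemma poly_funs_power: "f \<in> poly_funs C \<Longrightarrow> (\<lambda>p. f p ^ n) \<in> poly_funs C"
  by (induction n) (simp_all add: poly_funs.const poly_funs.mult)

lemma poly_funs_uminus: "f \<in> poly_funs C \<Longrightarrow> (\<lambda>p. - f p) \<in> poly_funs C"
  using poly_funs.mult[OF poly_funs.const[of "-1"]] by fastforce

lemma poly_funs_diff: "f \<in> poly_funs C \<Longrightarrow> g \<in> poly_funs C \<Longrightarrow> (\<lambda>p. f p - g p) \<in> poly_funs C"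
  using poly_funs.add[OF _ poly_funs_uminus] by fastforce

lemma poly_funs_divide: "f \<in> poly_funs C \<Longrightarrow> (\<lambda>p. f p / k) \<in> poly_funs C"
  using poly_funs.mult[OF _ poly_funs.const[of "1 / k"]] by fastforce

lemmas poly_funs_intros = poly_funs.const poly_funs.add poly_funs.mult poly_funs_power
  poly_funs_uminus poly_funs_diff poly_funs_divide

lemma poly_funs_subst:
  assumes "f \<in> poly_funs C" "\<And>c. c \<in> C \<Longrightarrow> (\<lambda>p. c (\<phi> p)) \<in> poly_funs D"
  shows "(\<lambda>p. f (\<phi> p)) \<in> poly_funs D"
  using assms(1) by induction (simp_all add: assms(2) poly_funs.intros)

lemma poly_funs_empty: "f \<in> poly_funs {} \<Longrightarrow> \<exists>k. f = (\<lambda>_. k)"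
  by (induction rule: poly_funs.induct) auto

text \<open>Restriction to curves with polynomial parametrization reduces questions about polynomial functions in several
variables to polynomials in one variable.\<close>

lemma poly_funs_curve:
  assumes "f \<in> poly_funs C" "\<And>c. c \<in> C \<Longrightarrow> \<exists>q. \<forall>s. c (\<gamma> s) = poly q s"
  shows "\<exists>q. \<forall>s. f (\<gamma> s) = poly q s"
  using assms(1)
proof induction
  case (const k)
  then show ?case by (intro exI[of _ "[:k:]"]) simp
next
  case (add f g)
  then show ?case by (metis poly_add)
next
  case (mult f g)
  then show ?case by (metis poly_mult)
qed (rule assms(2))

abbreviation poly2 :: "(complex \<times> complex \<Rightarrow> complex) set"
  where "poly2 \<equiv> poly_funs {fst, snd}"

lemma poly2_coords: "fst \<in> poly2" "snd \<in> poly2"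
  by (simp_all add: poly_funs.coord)

text \<open>Along the line that joins \<open>a\<close> to an arbitrary point, both functions become polynomials in one variable, and
the second one is nonzero.\<close>

lemma poly2_domain:
  assumes f: "f \<in> poly2" and g: "g \<in> poly2" "g a \<noteq> 0" and prod: "\<And>q. f q * g q = 0"
  shows "f = (\<lambda>_. 0)"
proof
  fix b :: "complex \<times> complex"
  define \<gamma> where "\<gamma> = (\<lambda>s. (fst a + s * (fst b - fst a), snd a + s * (snd b - snd a)))"
  have \<gamma>: "\<exists>q. \<forall>s. c (\<gamma> s) = poly q s" if "c \<in> {fst, snd}" for c
  proof -
    have "\<forall>s. c (\<gamma> s) = poly [:c a, c b - c a:] s" using that by (auto simp: \<gamma>_def algebra_simps)
    then show ?thesis by blast
  qed
  obtain F G where FG: "\<And>s. f (\<gamma> s) = poly F s" "\<And>s. g (\<gamma> s) = poly G s"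
    using poly_funs_curve[of f "{fst, snd}" \<gamma>, OF f \<gamma>] poly_funs_curve[of g "{fst, snd}" \<gamma>, OF g(1) \<gamma>]
    by blast
  have "\<forall>s. poly (F * G) s = 0" using prod[of "\<gamma> _"] by (simp add: FG)
  then have "F * G = 0" by (simp only: poly_all_0_iff_0)
  moreover have "G \<noteq> 0" using g(2) FG(2)[of 0] by (auto simp: \<gamma>_def)
  ultimately have "F = 0" by simp
  then show "f b = 0" using FG(1)[of 1] by (simp add: \<gamma>_def)
qed

lemma poly2_partial_derivatives:
  assumes "f \<in> poly2"
  shows "\<exists>D. ((\<lambda>s. f (s, u)) has_field_derivative D) (at p)"
    and "\<exists>D. ((\<lambda>s. f (p, s)) has_field_derivative D) (at u)"
proof -
  have "\<exists>q. \<forall>s. f (s, u) = poly q s"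
    by (rule poly_funs_curve[OF assms]) (auto intro: exI[of _ "[:0, 1:]"] exI[of _ "[:u:]"])
  then obtain q where "(\<lambda>s. f (s, u)) = poly q" by blast
  then show "\<exists>D. ((\<lambda>s. f (s, u)) has_field_derivative D) (at p)" by (auto intro!: exI[of _ "poly (pderiv q) p"] poly_DERIV)
  have "\<exists>q. \<forall>s. f (p, s) = poly q s"
    by (rule poly_funs_curve[OF assms]) (auto intro: exI[of _ "[:0, 1:]"] exI[of _ "[:p:]"])
  then obtain q where "(\<lambda>s. f (p, s)) = poly q" by blast
  then show "\<exists>D. ((\<lambda>s. f (p, s)) has_field_derivative D) (at u)" by (auto intro!: exI[of _ "poly (pderiv q) u"] poly_DERIV)
qed

text \<open>Linear combinations of functions in \<open>M\<close> with coefficients in the polynomials in \<open>C\<close>, up to equality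
on \<open>Z\<close>. As an inductive set it needs no bookkeeping of indices in closure proofs; explicit
coefficients are recovered by \<open>modspan_sum\<close>. The case \<open>C = {}\<close> is that of constant
coefficients.\<close>

inductive_set modspan :: "'p set \<Rightarrow> ('p \<Rightarrow> complex) set \<Rightarrow> ('p \<Rightarrow> complex) set \<Rightarrow> ('p \<Rightarrow> complex) set"
  for Z C M
  where
    gen: "m \<in> M \<Longrightarrow> m \<in> modspan Z C M"
  | zero: "(\<lambda>_. 0) \<in> modspan Z C M"
  | add: "f \<in> modspan Z C M \<Longrightarrow> g \<in> modspan Z C M \<Longrightarrow> (\<lambda>p. f p + g p) \<in> modspan Z C M"
  | smult: "s \<in> poly_funs C \<Longrightarrow> f \<in> modspan Z C M \<Longrightarrow> (\<lambda>p. s p * f p) \<in> modspan Z C M"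
  | cong: "f \<in> modspan Z C M \<Longrightarrow> (\<And>p. p \<in> Z \<Longrightarrow> g p = f p) \<Longrightarrow> g \<in> modspan Z C M"

lemma modspan_times:
  assumes "f \<in> modspan Z C M" "\<And>m. m \<in> M \<Longrightarrow> (\<lambda>p. g p * m p) \<in> modspan Z C M'"
  shows "(\<lambda>p. g p * f p) \<in> modspan Z C M'"
  using assms(1)
proof induction
  case (gen m)
  then show ?case by (rule assms(2))
next
  case (add f h)
  then show ?case using modspan.add[OF add.IH] by (simp add: distrib_left)
next
  case (smult s f)
  then show ?case using modspan.smult[OF smult.hyps(1) smult.IH] by (simp add: mult.left_commute)
next
  case (cong f h)
  show ?case by (rule modspan.cong[OF cong.IH]) (simp add: cong.hyps)
qed (simp add: modspan.zero)

lemma modspan_mono: "f \<in> modspan Z C M \<Longrightarrow> M \<subseteq> M' \<Longrightarrow> f \<in> modspan Z C M'"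
  using modspan_times[of f Z C M "\<lambda>_. 1" M'] by (auto intro: modspan.gen)

text \<open>A span that absorbs every generator of an algebra is a module over the algebra.\<close>

lemma modspan_times_poly:
  assumes "f \<in> poly_funs D" "h \<in> modspan Z C M"
    and "\<And>c m. c \<in> D \<Longrightarrow> m \<in> M \<Longrightarrow> (\<lambda>p. c p * m p) \<in> modspan Z C M"
  shows "(\<lambda>p. f p * h p) \<in> modspan Z C M"
  using assms(1,2)
proof (induction arbitrary: h)
  case (coord c)
  then show ?case using modspan_times[of h Z C M c M] assms(3) by blast
next
  case (const k)
  then show ?case by (intro modspan.smult poly_funs.const)
next
  case (add f g)
  then show ?case using modspan.add[OF add.IH(1) add.IH(2)] by (simp add: distrib_right)
next
  case (mult f g)
  then show ?case using mult.IH(1)[OF mult.IH(2)] by (simp add: mult.assoc)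
qed

text \<open>The coefficients are made zero outside the support so that sums over different supports can be compared.\<close>

lemma modspan_sum:
  assumes "f \<in> modspan Z C (m ` I)"
  shows "\<exists>J c. finite J \<and> J \<subseteq> I \<and> (\<forall>i. c i \<in> poly_funs C) \<and> (\<forall>i. i \<notin> J \<longrightarrow> c i = (\<lambda>_. 0)) \<and>
    (\<forall>p\<in>Z. f p = (\<Sum>i\<in>J. c i p * m i p))"
  using assms
proof induction
  case (gen h)
  then obtain i where i: "i \<in> I" "h = m i" by blast
  show ?case
    by (rule exI[of _ "{i}"], rule exI[of _ "\<lambda>k. if k = i then (\<lambda>_. 1) else (\<lambda>_. 0)"])
      (use i in \<open>simp add: poly_funs.const\<close>)
next
  case zero
  show ?case by (rule exI[of _ "{}"], rule exI[of _ "\<lambda>_ _. 0"]) (simp add: poly_funs.const)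
next
  case (add f g)
  from add.IH(1) obtain J c where c: "finite J" "J \<subseteq> I" "\<And>i. c i \<in> poly_funs C" "\<And>i. i \<notin> J \<Longrightarrow> c i = (\<lambda>_. 0)"
    "\<And>p. p \<in> Z \<Longrightarrow> f p = (\<Sum>i\<in>J. c i p * m i p)"
    by blast
  from add.IH(2) obtain J' c' where c': "finite J'" "J' \<subseteq> I" "\<And>i. c' i \<in> poly_funs C" "\<And>i. i \<notin> J' \<Longrightarrow> c' i = (\<lambda>_. 0)"
    "\<And>p. p \<in> Z \<Longrightarrow> g p = (\<Sum>i\<in>J'. c' i p * m i p)" by blast
  have "f p + g p = (\<Sum>i\<in>J \<union> J'. (c i p + c' i p) * m i p)" if p: "p \<in> Z" for p
  proof -
    have "f p = (\<Sum>i\<in>J \<union> J'. c i p * m i p)" unfolding c(5)[OF p]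
      by (rule sum.mono_neutral_left) (use c c' in auto)
    moreover have "g p = (\<Sum>i\<in>J \<union> J'. c' i p * m i p)" unfolding c'(5)[OF p]
      by (rule sum.mono_neutral_left) (use c c' in auto)
    ultimately show ?thesis by (simp add: sum.distrib distrib_right)
  qed
  then show ?case using c(1-4) c'(1-4)
    by (intro exI[of _ "J \<union> J'"] exI[of _ "\<lambda>i p. c i p + c' i p"]) (simp add: poly_funs.add)
next
  case (smult s f)
  then obtain J c where c: "finite J" "J \<subseteq> I" "\<And>i. c i \<in> poly_funs C" "\<And>i. i \<notin> J \<Longrightarrow> c i = (\<lambda>_. 0)"
    "\<And>p. p \<in> Z \<Longrightarrow> f p = (\<Sum>i\<in>J. c i p * m i p)" by blast
  then show ?case
    by (intro exI[of _ J] exI[of _ "\<lambda>i p. s p * c i p"])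
      (simp add: poly_funs.mult smult.hyps sum_distrib_left mult.assoc)
next
  case (cong f g)
  from cong.IH obtain J c where "finite J \<and> J \<subseteq> I \<and> (\<forall>i. c i \<in> poly_funs C) \<and> (\<forall>i. i \<notin> J \<longrightarrow> c i = (\<lambda>_. 0)) \<and>
    (\<forall>p\<in>Z. f p = (\<Sum>i\<in>J. c i p * m i p))" by blast
  then show ?case using cong.hyps(2) by (intro exI[of _ J] exI[of _ c]) simp
qed

lemma modspan_sum_finite:
  assumes "f \<in> modspan Z C (m ` I)" "finite I"
  shows "\<exists>c. (\<forall>i. c i \<in> poly_funs C) \<and> (\<forall>p\<in>Z. f p = (\<Sum>i\<in>I. c i p * m i p))"
proof -
  obtain J c where c: "J \<subseteq> I" "\<And>i. c i \<in> poly_funs C" "\<And>i. i \<notin> J \<Longrightarrow> c i = (\<lambda>_. 0)"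
    "\<And>p. p \<in> Z \<Longrightarrow> f p = (\<Sum>i\<in>J. c i p * m i p)" using modspan_sum[OF assms(1)] by blast
  have "(\<Sum>i\<in>J. c i p * m i p) = (\<Sum>i\<in>I. c i p * m i p)" for p
    by (rule sum.mono_neutral_left) (use assms c in auto)
  then show ?thesis using c by (metis (no_types))
qed

section \<open>Rings of functions\<close>

text \<open>The property of the regular functions that makes the coordinate ring a commutative ring; it is common
to affine varieties and their quotients.\<close>

definition function_algebra :: "'p variety \<Rightarrow> bool"
  where "function_algebra V \<longleftrightarrow> regfuns V \<subseteq> extensional (pts V) \<and>
    (\<forall>k. (\<lambda>p\<in>pts V. k) \<in> regfuns V) \<and>
    (\<forall>f\<in>regfuns V. \<forall>g\<in>regfuns V. (\<lambda>p\<in>pts V. f p + g p) \<in> regfuns V \<and> (\<lambda>p\<in>pts V. f p * g p) \<in> regfuns V)"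

lemma coord_ring_simps:
  "carrier (coord_ring V) = regfuns V"
  "f \<otimes>\<^bsub>coord_ring V\<^esub> g = (\<lambda>p\<in>pts V. f p * g p)"
  "f \<oplus>\<^bsub>coord_ring V\<^esub> g = (\<lambda>p\<in>pts V. f p + g p)"
  "\<one>\<^bsub>coord_ring V\<^esub> = (\<lambda>p\<in>pts V. 1)"
  "\<zero>\<^bsub>coord_ring V\<^esub> = (\<lambda>p\<in>pts V. 0)"
  by (simp_all add: coord_ring_def)

lemma cring_coord_ring:
  assumes "function_algebra V"
  shows "cring (coord_ring V)"
proof (rule cringI)
  have ext: "\<And>f p. f \<in> regfuns V \<Longrightarrow> p \<notin> pts V \<Longrightarrow> f p = undefined"
    using assms unfolding function_algebra_def by (auto simp: extensional_def)
  have cl: "\<And>k. (\<lambda>p\<in>pts V. k) \<in> regfuns V"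
    "\<And>f g. f \<in> regfuns V \<Longrightarrow> g \<in> regfuns V \<Longrightarrow> (\<lambda>p\<in>pts V. f p + g p) \<in> regfuns V"
    "\<And>f g. f \<in> regfuns V \<Longrightarrow> g \<in> regfuns V \<Longrightarrow> (\<lambda>p\<in>pts V. f p * g p) \<in> regfuns V"
    using assms unfolding function_algebra_def by blast+
  show "abelian_group (coord_ring V)"
  proof (rule abelian_groupI)
    fix f assume f: "f \<in> carrier (coord_ring V)"
    have "(\<lambda>p\<in>pts V. (\<lambda>p\<in>pts V. -1) p * f p) \<in> regfuns V"
      using f by (intro cl) (simp add: coord_ring_simps)
    then show "\<exists>g\<in>carrier (coord_ring V). g \<oplus>\<^bsub>coord_ring V\<^esub> f = \<zero>\<^bsub>coord_ring V\<^esub>"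
      by (intro bexI[of _ "\<lambda>p\<in>pts V. (\<lambda>p\<in>pts V. -1) p * f p"]) (auto simp: coord_ring_simps fun_eq_iff)
  qed (auto simp: coord_ring_simps cl fun_eq_iff algebra_simps ext)
  show "comm_monoid (coord_ring V)"
    by (rule comm_monoidI) (auto simp: coord_ring_simps cl fun_eq_iff algebra_simps ext)
qed (auto simp: coord_ring_simps fun_eq_iff algebra_simps)

lemma coord_ring_pow:
  assumes "function_algebra V" "f \<in> regfuns V"
  shows "f [^]\<^bsub>coord_ring V\<^esub> (n::nat) = (\<lambda>p\<in>pts V. f p ^ n)"
proof -
  interpret cring "coord_ring V" by (rule cring_coord_ring[OF assms(1)])
  show ?thesis
    by (induction n) (auto simp: coord_ring_simps fun_eq_iff restrict_def)
qed

lemma affine_pts [simp]: "pts (affine_variety C Z) = Z"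
  by (simp add: affine_variety_def)

lemma affine_regfunI: "f \<in> poly_funs C \<Longrightarrow> restrict f Z \<in> regfuns (affine_variety C Z)"
  by (auto simp: affine_variety_def)

lemma affine_regfunE:
  assumes "g \<in> regfuns (affine_variety C Z)"
  obtains f where "f \<in> poly_funs C" "g = restrict f Z"
  using assms by (auto simp: affine_variety_def)

lemma function_algebra_affine: "function_algebra (affine_variety C Z)"
  unfolding function_algebra_def affine_pts
proof (intro conjI allI ballI subsetI)
  fix g assume "g \<in> regfuns (affine_variety C Z)"
  then show "g \<in> extensional Z" by (rule affine_regfunE) simp
next
  fix k show "(\<lambda>p\<in>Z. k) \<in> regfuns (affine_variety C Z)"
    by (intro affine_regfunI poly_funs.const)
next
  fix f g assume "f \<in> regfuns (affine_variety C Z)" "g \<in> regfuns (affine_variety C Z)"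
  then obtain f' g' where f: "f' \<in> poly_funs C" "f = restrict f' Z" and g: "g' \<in> poly_funs C" "g = restrict g' Z"
    by (metis affine_regfunE)
  have "(\<lambda>p\<in>Z. f p + g p) = restrict (\<lambda>p. f' p + g' p) Z" "(\<lambda>p\<in>Z. f p * g p) = restrict (\<lambda>p. f' p * g' p) Z"
    unfolding f(2) g(2) by (auto simp: fun_eq_iff)
  then show "(\<lambda>p\<in>Z. f p + g p) \<in> regfuns (affine_variety C Z)" "(\<lambda>p\<in>Z. f p * g p) \<in> regfuns (affine_variety C Z)"
    using affine_regfunI[OF poly_funs.add[OF f(1) g(1)]] affine_regfunI[OF poly_funs.mult[OF f(1) g(1)]] by simp_all
qed

section \<open>Linear and polynomial relations\<close>

text \<open>Gaussian elimination: one unknown is expressed by the others through one equation.\<close>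

lemma homogeneous_solution:
  fixes a :: "'i \<Rightarrow> 'j \<Rightarrow> complex"
  assumes "finite J" "finite I" "card J < card I"
  shows "\<exists>c. (\<exists>i\<in>I. c i \<noteq> 0) \<and> (\<forall>j\<in>J. (\<Sum>i\<in>I. c i * a i j) = 0)"
  using assms
proof (induction J arbitrary: I a rule: finite_induct)
  case empty
  then have "I \<noteq> {}" by auto
  then show ?case by (auto intro!: exI[of _ "\<lambda>_. 1"])
next
  case (insert j J)
  show ?case
  proof (cases "\<forall>i\<in>I. a i j = 0")
    case True
    have "card J < card I" using insert by simp
    from insert.IH[OF insert.prems(1) this, of a] True show ?thesis by auto
  next
    case False
    then obtain i0 where i0: "i0 \<in> I" "a i0 j \<noteq> 0" by blast
    define I' where "I' = I - {i0}"
    have I': "finite I'" "card J < card I'" "i0 \<notin> I'" "I = insert i0 I'"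
      using insert i0 by (auto simp: I'_def)
    from insert.IH[OF I'(1,2), of "\<lambda>i k. a i k - a i j / a i0 j * a i0 k"]
    obtain c i1 where c: "i1 \<in> I'" "c i1 \<noteq> 0"
      "\<And>k. k \<in> J \<Longrightarrow> (\<Sum>i\<in>I'. c i * (a i k - a i j / a i0 j * a i0 k)) = 0" by blast
    define b where "b = c(i0 := - (\<Sum>i\<in>I'. c i * a i j) / a i0 j)"
    have sum: "(\<Sum>i\<in>I. b i * a i k) = (\<Sum>i\<in>I'. c i * a i k) - (\<Sum>i\<in>I'. c i * a i j) / a i0 j * a i0 k" for k
    proof -
      have "(\<Sum>i\<in>I'. b i * a i k) = (\<Sum>i\<in>I'. c i * a i k)"
        using I'(3) by (intro sum.cong) (auto simp: b_def)
      then show ?thesis unfolding I'(4) using I'(1,3) by (simp add: b_def)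
    qed
    have "(\<Sum>i\<in>I. b i * a i k) = 0" if k: "k \<in> insert j J" for k
    proof (cases "k = j")
      case True
      then show ?thesis unfolding sum using i0 by simp
    next
      case False
      then have "k \<in> J" using k by simp
      from c(3)[OF this] show ?thesis unfolding sum
        by (simp add: right_diff_distrib sum_subtractf sum_distrib_right sum_divide_distrib mult.assoc)
    qed
    moreover have "b i1 \<noteq> 0" "i1 \<in> I" using c(1,2) I'(3,4) by (auto simp: b_def)
    ultimately show ?thesis by blast
  qed
qed

text \<open>Applied to three nested sums, this isolates the lexicographically lowest monomial of a polynomial relation.\<close>

lemma split_least_power:
  fixes a :: "'b::comm_ring_1"
  assumes "i < N" "\<And>k. k < i \<Longrightarrow> h k = 0"
  shows "(\<Sum>k<N. a ^ k * h k) = a ^ i * (h i + a * (\<Sum>k\<in>{i<..<N}. a ^ (k - i - 1) * h k))"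
proof -
  have 1: "{..<N} = {..<i} \<union> ({i} \<union> {i<..<N})" using assms(1) by auto
  have "(\<Sum>k<N. a ^ k * h k) = (\<Sum>k<i. a ^ k * h k) + (a ^ i * h i + (\<Sum>k\<in>{i<..<N}. a ^ k * h k))"
  proof -
    have "(\<Sum>k<N. a ^ k * h k) = (\<Sum>k<i. a ^ k * h k) + (\<Sum>k\<in>{i} \<union> {i<..<N}. a ^ k * h k)"
      unfolding 1 by (rule sum.union_disjoint) auto
    also have "(\<Sum>k\<in>{i} \<union> {i<..<N}. a ^ k * h k) = (\<Sum>k\<in>{i}. a ^ k * h k) + (\<Sum>k\<in>{i<..<N}. a ^ k * h k)"
      by (rule sum.union_disjoint) auto
    finally show ?thesis by simp
  qed
  also have "(\<Sum>k<i. a ^ k * h k) = 0" by (rule sum.neutral) (simp add: assms(2))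
  also have "(\<Sum>k\<in>{i<..<N}. a ^ k * h k) = a ^ i * (a * (\<Sum>k\<in>{i<..<N}. a ^ (k - i - 1) * h k))"
    unfolding sum_distrib_left
  proof (rule sum.cong[OF refl])
    fix k assume "k \<in> {i<..<N}"
    then have "a ^ k = a ^ (i + 1 + (k - i - 1))" by simp
    then show "a ^ k * h k = a ^ i * (a * (a ^ (k - i - 1) * h k))"
      by (simp only: power_add power_one_right mult.assoc)
  qed
  finally show ?thesis by (simp add: distrib_left)
qed

section \<open>Double planes\<close>

text \<open>A double plane is the double cover of the plane with coordinates \<open>p, u\<close> branched along
\<open>f(p, u) = 0\<close>. All fibres of the quotient morphism are of this form, and so is the normal form of
type E7.\<close>

abbreviation dp_coords :: "(complex \<times> complex \<times> complex \<Rightarrow> complex) set"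
  where "dp_coords \<equiv> {\<lambda>(p, u, v). p, \<lambda>(p, u, v). u, \<lambda>(p, u, v). v}"

abbreviation dp_pts :: "(complex \<times> complex \<Rightarrow> complex) \<Rightarrow> (complex \<times> complex \<times> complex) set"
  where "dp_pts f \<equiv> {(p, u, v). v\<^sup>2 = f (p, u)}"

definition double_plane :: "(complex \<times> complex \<Rightarrow> complex) \<Rightarrow> (complex \<times> complex \<times> complex) variety"
  where "double_plane f = affine_variety dp_coords (dp_pts f)"

lemma double_plane_pts: "pts (double_plane f) = dp_pts f"
  by (simp add: double_plane_def)

lemma function_algebra_double_plane: "function_algebra (double_plane f)"
  unfolding double_plane_def by (rule function_algebra_affine)

lemma dp_coord_in:
  "(\<lambda>(p, u, v). p) \<in> poly_funs dp_coords" "(\<lambda>(p, u, v). u) \<in> poly_funs dp_coords" "(\<lambda>(p, u, v). v) \<in> poly_funs dp_coords"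
  by (simp_all add: poly_funs.coord)

lemma poly2_to_dp:
  assumes "A \<in> poly2"
  shows "(\<lambda>(p, u, v). A (p, u)) \<in> poly_funs dp_coords"
proof -
  have "(\<lambda>q. A (case q of (p, u, v) \<Rightarrow> (p, u))) \<in> poly_funs dp_coords"
    by (rule poly_funs_subst[OF assms]) (use dp_coord_in in \<open>auto simp: case_prod_unfold\<close>)
  then show ?thesis by (simp add: case_prod_unfold)
qed

lemma dp_regfunI:
  assumes "A \<in> poly2" "B \<in> poly2"
  shows "(\<lambda>(p, u, v)\<in>dp_pts f. A (p, u) + v * B (p, u)) \<in> regfuns (double_plane f)"
proof -
  have "(\<lambda>q. (case q of (p, u, v) \<Rightarrow> A (p, u)) + (case q of (p, u, v) \<Rightarrow> v) * (case q of (p, u, v) \<Rightarrow> B (p, u)))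
      \<in> poly_funs dp_coords"
    by (intro poly_funs.add poly_funs.mult poly2_to_dp assms dp_coord_in)
  then have "restrict (\<lambda>q. (case q of (p, u, v) \<Rightarrow> A (p, u)) + (case q of (p, u, v) \<Rightarrow> v) * (case q of (p, u, v) \<Rightarrow> B (p, u)))
      (dp_pts f) \<in> regfuns (double_plane f)"
    unfolding double_plane_def by (rule affine_regfunI)
  then show ?thesis by (simp add: case_prod_unfold)
qed

text \<open>Powers of \<open>v\<close> beyond the first are removed by \<open>v\<^sup>2 = f\<close>.\<close>

lemma dp_decomposition:
  assumes f: "f \<in> poly2" and g: "g \<in> poly_funs dp_coords"
  shows "\<exists>A\<in>poly2. \<exists>B\<in>poly2. \<forall>(p, u, v)\<in>dp_pts f. g (p, u, v) = A (p, u) + v * B (p, u)"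
  using g
proof induction
  case (coord c)
  have "\<forall>(p, u, v)\<in>dp_pts f. p = fst (p, u) + v * 0" "\<forall>(p, u, v)\<in>dp_pts f. u = snd (p, u) + v * 0"
    "\<forall>(p, u, v)\<in>dp_pts f. v = 0 + v * 1" by auto
  moreover have "(\<lambda>_. 0) \<in> poly2" "(\<lambda>_. 1) \<in> poly2" by (simp_all add: poly_funs.const)
  ultimately show ?case using coord poly2_coords
    by (elim insertE) (force intro: bexI[of _ "\<lambda>_. 0"] bexI[of _ "\<lambda>_. 1"] bexI[of _ fst] bexI[of _ snd])+
next
  case (const k)
  show ?case by (rule bexI[of _ "\<lambda>_. k"], rule bexI[of _ "\<lambda>_. 0"]) (auto simp: poly_funs.const)
next
  case (add g h)
  then obtain A B A' B' where A: "A \<in> poly2" "B \<in> poly2" "A' \<in> poly2" "B' \<in> poly2"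
    "\<forall>(p, u, v)\<in>dp_pts f. g (p, u, v) = A (p, u) + v * B (p, u)"
    "\<forall>(p, u, v)\<in>dp_pts f. h (p, u, v) = A' (p, u) + v * B' (p, u)" by blast
  show ?case
    by (rule bexI[of _ "\<lambda>q. A q + A' q"], rule bexI[of _ "\<lambda>q. B q + B' q"])
      (use A in \<open>auto simp: poly_funs.add algebra_simps\<close>)
next
  case (mult g h)
  then obtain A B A' B' where A: "A \<in> poly2" "B \<in> poly2" "A' \<in> poly2" "B' \<in> poly2"
    "\<forall>(p, u, v)\<in>dp_pts f. g (p, u, v) = A (p, u) + v * B (p, u)"
    "\<forall>(p, u, v)\<in>dp_pts f. h (p, u, v) = A' (p, u) + v * B' (p, u)" by blast
  have "g (p, u, v) * h (p, u, v) = (A (p, u) * A' (p, u) + f (p, u) * (B (p, u) * B' (p, u))) +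
      v * (A (p, u) * B' (p, u) + B (p, u) * A' (p, u))" if "(p, u, v) \<in> dp_pts f" for p u v
  proof -
    have v: "f (p, u) = v * v" using that by (simp add: power2_eq_square)
    have "g (p, u, v) = A (p, u) + v * B (p, u)" "h (p, u, v) = A' (p, u) + v * B' (p, u)"
      using A(5,6) that by auto
    then show ?thesis unfolding v by (simp add: algebra_simps)
  qed
  then show ?case
    by (intro bexI[of _ "\<lambda>q. A q * A' q + f q * (B q * B' q)"] bexI[of _ "\<lambda>q. A q * B' q + B q * A' q"])
      (use A f in \<open>auto simp: poly_funs.add poly_funs.mult\<close>)
qed

lemma dp_regfunE:
  assumes "f \<in> poly2" "g \<in> regfuns (double_plane f)"
  obtains A B where "A \<in> poly2" "B \<in> poly2" "g = (\<lambda>(p, u, v)\<in>dp_pts f. A (p, u) + v * B (p, u))"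
proof -
  obtain h where h: "h \<in> poly_funs dp_coords" "g = restrict h (dp_pts f)"
    using assms(2) unfolding double_plane_def by (rule affine_regfunE)
  obtain A B where AB: "A \<in> poly2" "B \<in> poly2"
    "\<forall>(p, u, v)\<in>dp_pts f. h (p, u, v) = A (p, u) + v * B (p, u)"
    using dp_decomposition[OF assms(1) h(1)] by blast
  have "g = (\<lambda>(p, u, v)\<in>dp_pts f. A (p, u) + v * B (p, u))"
    unfolding h(2) using AB(3) by (intro restrict_ext) auto
  with AB(1,2) show ?thesis by (rule that)
qed

text \<open>Both square roots \<open>\<plusminus>v\<close> of \<open>f(p, u)\<close> give points, so \<open>A = 0\<close> and \<open>v B = 0\<close>. Hence \<open>f B = 0\<close>, and
\<open>f\<close> can be cancelled.\<close>

lemma dp_unique: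
  assumes f: "f \<in> poly2" "f a \<noteq> 0" and AB: "A \<in> poly2" "B \<in> poly2"
    and zero: "\<And>p u v. v\<^sup>2 = f (p, u) \<Longrightarrow> A (p, u) + v * B (p, u) = 0"
  shows "A = (\<lambda>_. 0)" "B = (\<lambda>_. 0)"
proof -
  have eq: "A (p, u) = 0 \<and> B (p, u) * f (p, u) = 0" for p u
  proof -
    define v where "v = csqrt (f (p, u))"
    have v: "v\<^sup>2 = f (p, u)" by (simp add: v_def)
    have 1: "A (p, u) + v * B (p, u) = 0" using zero[OF v] .
    have 2: "A (p, u) - v * B (p, u) = 0" using zero[of "- v" p u] v by simp
    have "2 * A (p, u) = (A (p, u) + v * B (p, u)) + (A (p, u) - v * B (p, u))" by simp
    then have A: "A (p, u) = 0" unfolding 1 2 by simp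
    have "v * B (p, u) = 0" using 1 unfolding A by simp
    then have "v * (v * B (p, u)) = 0" by (simp only: mult_zero_right)
    then have "B (p, u) * f (p, u) = 0" unfolding v[symmetric] by (simp only: power2_eq_square ac_simps)
    with A show ?thesis by simp
  qed
  show "A = (\<lambda>_. 0)" using eq by (simp add: fun_eq_iff)
  show "B = (\<lambda>_. 0)" by (rule poly2_domain[OF AB(2) f]) (use eq in auto)
qed

subsection \<open>Three functions on a surface are dependent\<close>

definition dp_monomials :: "nat \<Rightarrow> (complex \<times> complex \<times> complex \<Rightarrow> complex) set"
  where "dp_monomials n = (\<lambda>(i, j, l) (p, u, v). p ^ i * u ^ j * v ^ l) ` ({..n} \<times> {..n} \<times> {..<2})"

lemma dp_monomials_mono: "n \<le> m \<Longrightarrow> dp_monomials n \<subseteq> dp_monomials m"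
  unfolding dp_monomials_def by (intro image_mono) auto

lemma dp_monomialE:
  assumes "m \<in> dp_monomials n"
  obtains i j l where "i \<le> n" "j \<le> n" "l < 2" "m = (\<lambda>(p, u, v). p ^ i * u ^ j * v ^ l)"
  using assms unfolding dp_monomials_def by auto

lemma dp_monomialI:
  "i \<le> n \<Longrightarrow> j \<le> n \<Longrightarrow> l < 2 \<Longrightarrow> (\<lambda>(p, u, v). p ^ i * u ^ j * v ^ l) \<in> dp_monomials n"
  unfolding dp_monomials_def by (rule image_eqI[of _ _ "(i, j, l)"]) auto

text \<open>Multiplication by \<open>g\<close> raises the degree by at most \<open>d\<close>. Stated for the monomials only, the
condition is inherited by sums and products, so that every polynomial function satisfies it for some
\<open>d\<close>.\<close>

definition dp_filtered :: "(complex \<times> complex \<Rightarrow> complex) \<Rightarrow> (complex \<times> complex \<times> complex \<Rightarrow> complex) \<Rightarrow> nat \<Rightarrow> bool"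
  where "dp_filtered f g d \<longleftrightarrow> (\<forall>n. \<forall>m\<in>dp_monomials n.
    (\<lambda>q. g q * m q) \<in> modspan (dp_pts f) {} (dp_monomials (n + d)))"

lemma dp_filtered_span:
  assumes "dp_filtered f g d" "h \<in> modspan (dp_pts f) {} (dp_monomials n)"
  shows "(\<lambda>q. g q * h q) \<in> modspan (dp_pts f) {} (dp_monomials (n + d))"
  using modspan_times[OF assms(2), of g] assms(1) unfolding dp_filtered_def by blast

lemma dp_filtered_mono: "dp_filtered f g d \<Longrightarrow> d \<le> d' \<Longrightarrow> dp_filtered f g d'"
  unfolding dp_filtered_def using modspan_mono[OF _ dp_monomials_mono] by (meson add_le_cancel_left)

lemma dp_filtered_const: "dp_filtered f (\<lambda>_. k) 0"
  unfolding dp_filtered_def by (simp add: modspan.smult poly_funs.const modspan.gen)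

lemma dp_filtered_add:
  assumes "dp_filtered f g d" "dp_filtered f h d'"
  shows "dp_filtered f (\<lambda>q. g q + h q) (max d d')"
proof -
  have "dp_filtered f g (max d d')" "dp_filtered f h (max d d')"
    using assms by (auto intro: dp_filtered_mono)
  then show ?thesis unfolding dp_filtered_def by (auto simp: distrib_right intro!: modspan.add)
qed

lemma dp_filtered_mult:
  assumes "dp_filtered f g d" "dp_filtered f h d'"
  shows "dp_filtered f (\<lambda>q. g q * h q) (d' + d)"
  unfolding dp_filtered_def
proof (intro allI ballI)
  fix n m assume "m \<in> dp_monomials n"
  then have "(\<lambda>q. h q * m q) \<in> modspan (dp_pts f) {} (dp_monomials (n + d'))"
    using assms(2) unfolding dp_filtered_def by blast
  from dp_filtered_span[OF assms(1) this]
  show "(\<lambda>q. g q * h q * m q) \<in> modspan (dp_pts f) {} (dp_monomials (n + (d' + d)))"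
    by (simp add: mult.assoc add.assoc)
qed

lemma dp_filtered_power: "dp_filtered f g d \<Longrightarrow> dp_filtered f (\<lambda>q. g q ^ n) (n * d)"
proof (induction n)
  case 0
  then show ?case using dp_filtered_const[of f 1] by simp
next
  case (Suc n)
  from dp_filtered_mult[OF Suc.prems Suc.IH[OF Suc.prems]] show ?case by (simp add: add.commute)
qed

lemma dp_filtered_pu: "dp_filtered f (\<lambda>(p, u, v). p) 1" "dp_filtered f (\<lambda>(p, u, v). u) 1"
proof -
  have "(\<lambda>q. (case q of (p, u, v) \<Rightarrow> p) * m q) \<in> dp_monomials (n + 1)"
    "(\<lambda>q. (case q of (p, u, v) \<Rightarrow> u) * m q) \<in> dp_monomials (n + 1)"
    if "m \<in> dp_monomials n" for m n
  proof -
    obtain i j l where m: "i \<le> n" "j \<le> n" "l < 2" "m = (\<lambda>(p, u, v). p ^ i * u ^ j * v ^ l)"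
      using \<open>m \<in> dp_monomials n\<close> by (rule dp_monomialE)
    show "(\<lambda>q. (case q of (p, u, v) \<Rightarrow> p) * m q) \<in> dp_monomials (n + 1)"
      using dp_monomialI[of "Suc i" "n + 1" j l] m by (simp add: case_prod_unfold mult.assoc)
    show "(\<lambda>q. (case q of (p, u, v) \<Rightarrow> u) * m q) \<in> dp_monomials (n + 1)"
      using dp_monomialI[of i "n + 1" "Suc j" l] m by (simp add: case_prod_unfold ac_simps)
  qed
  then show "dp_filtered f (\<lambda>(p, u, v). p) 1" "dp_filtered f (\<lambda>(p, u, v). u) 1"
    unfolding dp_filtered_def by (blast intro: modspan.gen)+
qed

lemma dp_filtered_poly2:
  assumes "A \<in> poly2"
  shows "\<exists>d. dp_filtered f (\<lambda>(p, u, v). A (p, u)) d"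
  using assms
proof induction
  case (coord c)
  then show ?case using dp_filtered_pu[of f] by (auto simp: case_prod_unfold)
next
  case (const k)
  then show ?case using dp_filtered_const[of f k] by (auto simp: case_prod_unfold)
next
  case (add g h)
  then show ?case using dp_filtered_add by (fastforce simp: case_prod_unfold)
next
  case (mult g h)
  then show ?case using dp_filtered_mult by (fastforce simp: case_prod_unfold)
qed

text \<open>The only case in which multiplication by \<open>v\<close> leaves the given monomials is
\<open>v \<cdot> v = f\<close>, whose degree is known.\<close>

lemma dp_filtered_v:
  assumes "f \<in> poly2"
  shows "\<exists>d. dp_filtered f (\<lambda>(p, u, v). v) d"
proof -
  obtain d where d: "dp_filtered f (\<lambda>(p, u, v). f (p, u)) d" using dp_filtered_poly2[OF assms] by blast
  have "(\<lambda>q. (case q of (p, u, v) \<Rightarrow> v) * m q) \<in> modspan (dp_pts f) {} (dp_monomials (n + d))"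
    if "m \<in> dp_monomials n" for m n
  proof -
    obtain i j l where m: "i \<le> n" "j \<le> n" "l < 2" "m = (\<lambda>(p, u, v). p ^ i * u ^ j * v ^ l)"
      using \<open>m \<in> dp_monomials n\<close> by (rule dp_monomialE)
    consider "l = 0" | "l = 1" using m(3) by linarith
    then show ?thesis
    proof cases
      case 1
      have "(\<lambda>q. (case q of (p, u, v) \<Rightarrow> v) * m q) \<in> dp_monomials (n + d)"
        using dp_monomialI[of i "n + d" j 1] m 1 by (simp add: case_prod_unfold ac_simps)
      then show ?thesis by (rule modspan.gen)
    next
      case 2
      have "(\<lambda>q. (case q of (p, u, v) \<Rightarrow> f (p, u)) * (case q of (p, u, v) \<Rightarrow> p ^ i * u ^ j * v ^ 0))
          \<in> modspan (dp_pts f) {} (dp_monomials (n + d))"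
        using d[unfolded dp_filtered_def, rule_format, OF dp_monomialI[OF m(1,2), of 0]] by (simp add: case_prod_unfold)
      then show ?thesis
        by (rule modspan.cong) (auto simp: m 2 power2_eq_square[symmetric] mult.left_commute[of _ "_ * _"] ac_simps)
    qed
  qed
  then show ?thesis unfolding dp_filtered_def by blast
qed

lemma dp_filtered_poly:
  assumes f: "f \<in> poly2" and g: "g \<in> poly_funs dp_coords"
  shows "\<exists>d. dp_filtered f g d"
  using g
proof induction
  case (coord c)
  then show ?case using dp_filtered_pu dp_filtered_v[OF f] by blast
qed (use dp_filtered_const dp_filtered_add dp_filtered_mult in blast)+

text \<open>The \<open>N\<^sup>3\<close> monomials in three functions of degree at most \<open>D\<close> lie in the span of the
\<open>2 (n + 1)\<^sup>2\<close> monomials of degree at most \<open>n = 3 D N\<close>. For large \<open>N\<close> there are more of the former,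
so they are linearly dependent. The coefficients are extended by zero outside the box, which
makes the choice of a lowest monomial below unrestricted.\<close>

lemma dp_monomials_dependent:
  assumes f: "f \<in> poly2" and g: "g0 \<in> poly_funs dp_coords" "g1 \<in> poly_funs dp_coords" "g2 \<in> poly_funs dp_coords"
  shows "\<exists>N C. (\<exists>i<N. \<exists>j<N. \<exists>k<N. C i j k \<noteq> 0) \<and> (\<forall>i j k. \<not> (i < N \<and> j < N \<and> k < N) \<longrightarrow> C i j k = (0::complex)) \<and>
    (\<forall>q\<in>dp_pts f. (\<Sum>i<N. g0 q ^ i * (\<Sum>j<N. g1 q ^ j * (\<Sum>k<N. g2 q ^ k * C i j k))) = 0)"
proof -
  obtain d0 d1 d2 where d: "dp_filtered f g0 d0" "dp_filtered f g1 d1" "dp_filtered f g2 d2"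
    using dp_filtered_poly[OF f g(1)] dp_filtered_poly[OF f g(2)] dp_filtered_poly[OF f g(3)]
    by (elim exE)
  define D where "D = max d0 (max d1 d2)"
  have D: "dp_filtered f g0 D" "dp_filtered f g1 D" "dp_filtered f g2 D"
    by (rule dp_filtered_mono[OF d(1)] dp_filtered_mono[OF d(2)] dp_filtered_mono[OF d(3)], simp add: D_def)+
  \<comment> \<open>Chosen with \<open>2 (3 D N + 1)\<^sup>2 < N\<^sup>3\<close>, as \<open>3 D N + 1 \<le> (3 D + 1) N\<close>.\<close>
  define N where "N = 2 * (3 * D + 1)\<^sup>2 + 1"
  define n where "n = 3 * D * N"
  define J where "J = {..n} \<times> {..n} \<times> {..<2::nat}"
  define box where "box = {..<N} \<times> {..<N} \<times> {..<N}"
  define mon where "mon = (\<lambda>(i, j, l) (p, u, v). p ^ i * u ^ j * v ^ l :: complex)"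
  define w where "w = (\<lambda>(i, j, k) q. g0 q ^ i * (g1 q ^ j * g2 q ^ k))"
  have N1: "1 \<le> N" by (simp add: N_def)
  have card: "card J < card box"
  proof -
    have "n + 1 \<le> (3 * D + 1) * N" using N1 by (simp add: n_def)
    then have "(n + 1) * (n + 1) \<le> ((3 * D + 1) * N) * ((3 * D + 1) * N)" by (rule mult_le_mono) (rule \<open>n + 1 \<le> (3 * D + 1) * N\<close>)
    then have "2 * ((n + 1) * (n + 1)) \<le> 2 * (3 * D + 1)\<^sup>2 * (N * N)"
      by (simp only: power2_eq_square ac_simps mult_le_cancel1)
    also have "\<dots> < N * (N * N)" using N1 by (intro mult_strict_right_mono) (simp_all add: N_def)
    finally show ?thesis by (simp add: J_def box_def card_cartesian_product algebra_simps)
  qed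
  have W: "\<exists>\<kappa>. \<forall>q\<in>dp_pts f. w x q = (\<Sum>y\<in>J. \<kappa> y * mon y q)" if x: "x \<in> box" for x
  proof -
    obtain i j k where ijk: "x = (i, j, k)" "i < N" "j < N" "k < N" using x by (auto simp: box_def)
    have "i * D \<le> N * D" "j * D \<le> N * D" "k * D \<le> N * D" using ijk(2-4) by simp_all
    moreover have "n = 3 * (N * D)" by (simp add: n_def)
    ultimately have le: "k * D + j * D + i * D \<le> n" by linarith
    have "dp_filtered f (w x) (k * D + j * D + i * D)"
      unfolding w_def ijk(1) prod.case by (intro dp_filtered_mult dp_filtered_power D)
    then have "dp_filtered f (w x) n" using le by (rule dp_filtered_mono)
    moreover have "(\<lambda>_. 1) \<in> dp_monomials 0"
      using dp_monomialI[of 0 0 0 0] by (simp add: case_prod_unfold)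
    ultimately have "(\<lambda>q. w x q * 1) \<in> modspan (dp_pts f) {} (dp_monomials (0 + n))"
      unfolding dp_filtered_def by fast
    then have "w x \<in> modspan (dp_pts f) {} (mon ` J)"
      by (simp add: dp_monomials_def mon_def J_def)
    then obtain c where c: "\<And>i. c i \<in> poly_funs {}" "\<And>q. q \<in> dp_pts f \<Longrightarrow> w x q = (\<Sum>y\<in>J. c y q * mon y q)"
      using modspan_sum_finite[of "w x" "dp_pts f" "{}" mon J] by (auto simp: J_def)
    have "\<forall>y. \<exists>k. c y = (\<lambda>_. k)" using poly_funs_empty c(1) by blast
    then obtain \<kappa> where "\<And>y. c y = (\<lambda>_. \<kappa> y)" by metis
    then show ?thesis using c(2) by auto
  qed
  have "\<exists>\<kappa>. \<forall>x\<in>box. \<forall>q\<in>dp_pts f. w x q = (\<Sum>y\<in>J. \<kappa> x y * mon y q)"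
    using W by (intro bchoice) blast
  then obtain \<kappa> where \<kappa>: "\<And>x q. x \<in> box \<Longrightarrow> q \<in> dp_pts f \<Longrightarrow> w x q = (\<Sum>y\<in>J. \<kappa> x y * mon y q)" by blast
  have fin: "finite J" "finite box" by (simp_all add: J_def box_def)
  obtain c x0 where c: "x0 \<in> box" "c x0 \<noteq> 0" "\<And>y. y \<in> J \<Longrightarrow> (\<Sum>x\<in>box. c x * \<kappa> x y) = 0"
    using homogeneous_solution[OF fin card, of \<kappa>] by blast
  define C where "C i j k = (if (i, j, k) \<in> box then c (i, j, k) else 0)" for i j k
  have "(\<Sum>i<N. g0 q ^ i * (\<Sum>j<N. g1 q ^ j * (\<Sum>k<N. g2 q ^ k * C i j k))) = 0" if q: "q \<in> dp_pts f" for q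
  proof -
    have "(\<Sum>i<N. g0 q ^ i * (\<Sum>j<N. g1 q ^ j * (\<Sum>k<N. g2 q ^ k * C i j k))) =
        (\<Sum>i<N. \<Sum>j<N. \<Sum>k<N. c (i, j, k) * w (i, j, k) q)"
      unfolding sum_distrib_left by (intro sum.cong refl) (simp add: C_def box_def w_def)
    also have "\<dots> = (\<Sum>x\<in>box. c x * w x q)"
      unfolding box_def by (simp add: sum.cartesian_product case_prod_unfold)
    also have "\<dots> = (\<Sum>x\<in>box. \<Sum>y\<in>J. c x * \<kappa> x y * mon y q)"
      by (intro sum.cong refl) (simp add: \<kappa>[OF _ q] sum_distrib_left mult.assoc)
    also have "\<dots> = (\<Sum>y\<in>J. (\<Sum>x\<in>box. c x * \<kappa> x y) * mon y q)"
      by (subst sum.swap) (simp add: sum_distrib_right)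
    also have "\<dots> = 0" by (rule sum.neutral) (simp add: c(3))
    finally show ?thesis .
  qed
  moreover have "\<exists>i<N. \<exists>j<N. \<exists>k<N. C i j k \<noteq> 0"
    using c(1,2) by (auto simp: C_def box_def)
  moreover have "\<forall>i j k. \<not> (i < N \<and> j < N \<and> k < N) \<longrightarrow> C i j k = 0"
    by (auto simp: C_def box_def)
  ultimately show ?thesis by blast
qed

lemma dp_lex_relation:
  assumes f: "f \<in> poly2" and g: "g0 \<in> poly_funs dp_coords" "g1 \<in> poly_funs dp_coords" "g2 \<in> poly_funs dp_coords"
  shows "\<exists>i j k x y z. x \<in> poly_funs dp_coords \<and> y \<in> poly_funs dp_coords \<and> z \<in> poly_funs dp_coords \<and>
    (\<forall>q\<in>dp_pts f. g0 q ^ i * (g1 q ^ j * (g2 q ^ k * (1 + g2 q * z q) + g1 q * y q) + g0 q * x q) = 0)"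
proof -
  obtain N C where C: "\<exists>i j k. C i j k \<noteq> (0::complex)" "\<And>i j k. \<not> (i < N \<and> j < N \<and> k < N) \<Longrightarrow> C i j k = 0"
    and rel: "\<And>q. q \<in> dp_pts f \<Longrightarrow>
      (\<Sum>i<N. g0 q ^ i * (\<Sum>j<N. g1 q ^ j * (\<Sum>k<N. g2 q ^ k * C i j k))) = 0"
    using dp_monomials_dependent[OF assms] by blast
  define i where "i = (LEAST i. \<exists>j k. C i j k \<noteq> 0)"
  have i: "\<exists>j k. C i j k \<noteq> 0" "\<And>i' j k. i' < i \<Longrightarrow> C i' j k = 0"
    unfolding i_def using LeastI_ex[OF C(1)] not_less_Least by blast+
  define j where "j = (LEAST j. \<exists>k. C i j k \<noteq> 0)"
  have j: "\<exists>k. C i j k \<noteq> 0" "\<And>j' k. j' < j \<Longrightarrow> C i j' k = 0"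
    unfolding j_def using LeastI_ex[OF i(1)] not_less_Least by blast+
  define k where "k = (LEAST k. C i j k \<noteq> 0)"
  have k: "C i j k \<noteq> 0" "\<And>k'. k' < k \<Longrightarrow> C i j k' = 0"
    unfolding k_def using LeastI_ex[OF j(1)] not_less_Least by blast+
  have lt: "i < N" "j < N" "k < N" using C(2) k(1) by blast+
  define c where "c = C i j k"
  have c: "c \<noteq> 0" using k(1) by (simp add: c_def)
  define z where "z q = (\<Sum>k'\<in>{k<..<N}. g2 q ^ (k' - k - 1) * C i j k') / c" for q
  define y where "y q = (\<Sum>j'\<in>{j<..<N}. g1 q ^ (j' - j - 1) * (\<Sum>k<N. g2 q ^ k * C i j' k)) / c" for q
  define x where "x q = (\<Sum>i'\<in>{i<..<N}. g0 q ^ (i' - i - 1) * (\<Sum>j<N. g1 q ^ j * (\<Sum>k<N. g2 q ^ k * C i' j k))) / c" for q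
  have xyz: "x \<in> poly_funs dp_coords" "y \<in> poly_funs dp_coords" "z \<in> poly_funs dp_coords"
    unfolding x_def y_def z_def
    by (intro poly_funs_divide poly_funs_sum poly_funs.mult poly_funs_power g poly_funs.const)+
  have "g0 q ^ i * (g1 q ^ j * (g2 q ^ k * (1 + g2 q * z q) + g1 q * y q) + g0 q * x q) = 0"
    if q: "q \<in> dp_pts f" for q
  proof -
    have Z: "(\<Sum>k<N. g2 q ^ k * C i j k) = g2 q ^ k * (c + g2 q * (c * z q))"
      by (subst split_least_power[OF lt(3)]) (use k(2) c in \<open>simp_all add: c_def z_def\<close>)
    have Y: "(\<Sum>j<N. g1 q ^ j * (\<Sum>k<N. g2 q ^ k * C i j k)) =
        g1 q ^ j * (g2 q ^ k * (c + g2 q * (c * z q)) + g1 q * (c * y q))"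
      unfolding Z[symmetric] by (subst split_least_power[OF lt(2)]) (use j(2) c in \<open>simp_all add: y_def\<close>)
    have "0 = g0 q ^ i * (g1 q ^ j * (g2 q ^ k * (c + g2 q * (c * z q)) + g1 q * (c * y q)) + g0 q * (c * x q))"
      unfolding rel[OF q, symmetric] Y[symmetric]
      by (subst split_least_power[OF lt(1)]) (use i(2) c in \<open>simp_all add: x_def\<close>)
    also have "\<dots> = c * (g0 q ^ i * (g1 q ^ j * (g2 q ^ k * (1 + g2 q * z q) + g1 q * y q) + g0 q * x q))"
      by (simp add: algebra_simps)
    finally show ?thesis using c by simp
  qed
  with xyz show ?thesis by blast
qed

lemma dp_lex_dependent:
  assumes f: "f \<in> poly2"
  shows "lex_dependent (coord_ring (double_plane f))"
  unfolding lex_dependent_def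
proof (intro ballI)
  let ?R = "coord_ring (double_plane f)"
  note fa = function_algebra_double_plane[of f]
  note pts = double_plane_pts[of f]
  have reg: "restrict h (dp_pts f) \<in> carrier ?R" if "h \<in> poly_funs dp_coords" for h
    using affine_regfunI[OF that] by (simp add: coord_ring_simps double_plane_def)
  fix a b c assume abc: "a \<in> carrier ?R" "b \<in> carrier ?R" "c \<in> carrier ?R"
  have rep: "\<exists>g\<in>poly_funs dp_coords. h = restrict g (dp_pts f)" if "h \<in> carrier ?R" for h
    using affine_regfunE[of h dp_coords "dp_pts f"] that by (auto simp: coord_ring_simps double_plane_def)
  obtain g0 g1 g2 where g: "g0 \<in> poly_funs dp_coords" "g1 \<in> poly_funs dp_coords" "g2 \<in> poly_funs dp_coords"
    "a = restrict g0 (dp_pts f)" "b = restrict g1 (dp_pts f)" "c = restrict g2 (dp_pts f)"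
    using rep abc by meson
  obtain i j k x y z where xyz: "x \<in> poly_funs dp_coords" "y \<in> poly_funs dp_coords" "z \<in> poly_funs dp_coords"
    and rel: "\<And>q. q \<in> dp_pts f \<Longrightarrow>
      g0 q ^ i * (g1 q ^ j * (g2 q ^ k * (1 + g2 q * z q) + g1 q * y q) + g0 q * x q) = 0"
    using dp_lex_relation[OF f g(1-3)] by blast
  have "a [^]\<^bsub>?R\<^esub> i \<otimes>\<^bsub>?R\<^esub> (b [^]\<^bsub>?R\<^esub> j \<otimes>\<^bsub>?R\<^esub> (c [^]\<^bsub>?R\<^esub> k \<otimes>\<^bsub>?R\<^esub> (\<one>\<^bsub>?R\<^esub> \<oplus>\<^bsub>?R\<^esub> c \<otimes>\<^bsub>?R\<^esub> restrict z (dp_pts f))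
        \<oplus>\<^bsub>?R\<^esub> b \<otimes>\<^bsub>?R\<^esub> restrict y (dp_pts f)) \<oplus>\<^bsub>?R\<^esub> a \<otimes>\<^bsub>?R\<^esub> restrict x (dp_pts f)) = \<zero>\<^bsub>?R\<^esub>"
    unfolding coord_ring_pow[OF fa abc(1)[unfolded coord_ring_simps]] coord_ring_pow[OF fa abc(2)[unfolded coord_ring_simps]]
      coord_ring_pow[OF fa abc(3)[unfolded coord_ring_simps]]
    unfolding coord_ring_simps pts g(4-6)
    by (rule restrict_ext) (simp only: restrict_apply' rel)
  then show "\<exists>(i::nat) (j::nat) (k::nat). \<exists>x\<in>carrier ?R. \<exists>y\<in>carrier ?R. \<exists>z\<in>carrier ?R.
      a [^]\<^bsub>?R\<^esub> i \<otimes>\<^bsub>?R\<^esub> (b [^]\<^bsub>?R\<^esub> j \<otimes>\<^bsub>?R\<^esub> (c [^]\<^bsub>?R\<^esub> k \<otimes>\<^bsub>?R\<^esub> (\<one>\<^bsub>?R\<^esub> \<oplus>\<^bsub>?R\<^esub> c \<otimes>\<^bsub>?R\<^esub> z)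
        \<oplus>\<^bsub>?R\<^esub> b \<otimes>\<^bsub>?R\<^esub> y) \<oplus>\<^bsub>?R\<^esub> a \<otimes>\<^bsub>?R\<^esub> x) = \<zero>\<^bsub>?R\<^esub>"
    using reg[OF xyz(1)] reg[OF xyz(2)] reg[OF xyz(3)] by blast
qed

subsection \<open>Singular points of double planes\<close>

text \<open>On a function \<open>A + v B\<close> the three derivations are \<open>\<partial>A/\<partial>p\<close>, \<open>\<partial>A/\<partial>u\<close> and \<open>B\<close>, evaluated at the point
\<open>(p, u)\<close>. The Leibniz rule holds because the correction \<open>f B B'\<close> in the product of two such
functions vanishes to second order there; this is where the singularity of the branch curve enters.\<close>

lemma dp_point_derivations:
  assumes f: "f \<in> poly2" "f a \<noteq> 0" and sing: "f (p, u) = 0"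
    "((\<lambda>s. f (s, u)) has_field_derivative 0) (at p)" "((\<lambda>s. f (p, s)) has_field_derivative 0) (at u)"
  defines "R \<equiv> coord_ring (double_plane f)" and "e \<equiv> \<lambda>g :: complex \<times> complex \<times> complex \<Rightarrow> complex. g (p, u, 0)"
  shows "\<exists>D1 D2 D3. point_derivation R e D1 \<and> point_derivation R e D2 \<and> point_derivation R e D3 \<and>
    (\<exists>m1\<in>carrier R. \<exists>m2\<in>carrier R. \<exists>m3\<in>carrier R. e m1 = 0 \<and> e m2 = 0 \<and> e m3 = 0 \<and>
      D1 m1 = 1 \<and> D2 m1 = 0 \<and> D3 m1 = 0 \<and> D1 m2 = 0 \<and> D2 m2 = 1 \<and> D3 m2 = 0 \<and>
      D1 m3 = 0 \<and> D2 m3 = 0 \<and> D3 m3 = 1)"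
proof -
  \<comment> \<open>Regular functions correspond to pairs \<open>(A, B)\<close>, and \<open>fA\<close>, \<open>fB\<close> below are the inverse maps.\<close>
  define pr where "pr A B = (\<lambda>(p, u, v)\<in>dp_pts f. A (p, u) + v * B (p, u))" for A B :: "complex \<times> complex \<Rightarrow> complex"
  note pts = double_plane_pts[of f]
  have carr: "g \<in> carrier R \<longleftrightarrow> (\<exists>A\<in>poly2. \<exists>B\<in>poly2. g = pr A B)" for g
  proof
    assume "g \<in> carrier R"
    then have "g \<in> regfuns (double_plane f)" by (simp add: R_def coord_ring_simps)
    then obtain A B where "A \<in> poly2" "B \<in> poly2" "g = pr A B"
      unfolding pr_def by (rule dp_regfunE[OF f(1)])
    then show "\<exists>A\<in>poly2. \<exists>B\<in>poly2. g = pr A B" by blast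
  next
    assume "\<exists>A\<in>poly2. \<exists>B\<in>poly2. g = pr A B"
    then show "g \<in> carrier R" using dp_regfunI[of _ _ f] by (auto simp: R_def coord_ring_simps pr_def)
  qed
  have uniq: "A = A' \<and> B = B'" if "pr A B = pr A' B'" "A \<in> poly2" "B \<in> poly2" "A' \<in> poly2" "B' \<in> poly2" for A B A' B'
  proof -
    have zero: "A (p, u) - A' (p, u) + v * (B (p, u) - B' (p, u)) = 0" if v: "v\<^sup>2 = f (p, u)" for p u v
    proof -
      have "pr A B (p, u, v) = pr A' B' (p, u, v)" using \<open>pr A B = pr A' B'\<close> by simp
      then show ?thesis using v by (simp add: pr_def algebra_simps)
    qed
    have "(\<lambda>q. A q - A' q) = (\<lambda>_. 0)"
      by (rule dp_unique(1)[OF f poly_funs_diff[OF that(2,4)] poly_funs_diff[OF that(3,5)]]) (rule zero)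
    moreover have "(\<lambda>q. B q - B' q) = (\<lambda>_. 0)"
      by (rule dp_unique(2)[OF f poly_funs_diff[OF that(2,4)] poly_funs_diff[OF that(3,5)]]) (rule zero)
    ultimately show ?thesis by (simp add: fun_eq_iff)
  qed
  define fA where "fA g = (SOME A. A \<in> poly2 \<and> (\<exists>B\<in>poly2. g = pr A B))" for g
  define fB where "fB g = (SOME B. B \<in> poly2 \<and> g = pr (fA g) B)" for g
  have sel: "fA (pr A B) = A" "fB (pr A B) = B" if "A \<in> poly2" "B \<in> poly2" for A B
  proof -
    have "fA (pr A B) \<in> poly2 \<and> (\<exists>B'\<in>poly2. pr A B = pr (fA (pr A B)) B')"
      unfolding fA_def by (rule someI[of _ A]) (use that in blast)
    then obtain B' where B': "fA (pr A B) \<in> poly2" "B' \<in> poly2" "pr A B = pr (fA (pr A B)) B'" by (elim conjE bexE)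
    show 1: "fA (pr A B) = A" by (rule conjunct1[OF uniq[OF B'(3) that B'(1,2)], symmetric])
    have "fB (pr A B) \<in> poly2 \<and> pr A B = pr (fA (pr A B)) (fB (pr A B))"
      unfolding fB_def by (rule someI[of _ B]) (use that 1 in simp)
    then have "fB (pr A B) \<in> poly2" "pr A B = pr A (fB (pr A B))" unfolding 1 by simp_all
    from uniq[OF this(2) that that(1) this(1)] show "fB (pr A B) = B" by simp
  qed
  define dd :: "(complex \<Rightarrow> complex) \<Rightarrow> complex \<Rightarrow> complex" where "dd h s = (THE D. (h has_field_derivative D) (at s))" for h s
  have dd: "dd h s = D" if "(h has_field_derivative D) (at s)" for h s D
    unfolding dd_def using that DERIV_unique by blast
  define D1 where "D1 g = dd (\<lambda>s. fA g (s, u)) p" for g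
  define D2 where "D2 g = dd (\<lambda>s. fA g (p, s)) u" for g
  define D3 where "D3 g = fB g (p, u)" for g
  have der: "((\<lambda>s. A (s, u)) has_field_derivative D1 (pr A B)) (at p)" "((\<lambda>s. A (p, s)) has_field_derivative D2 (pr A B)) (at u)"
    if "A \<in> poly2" "B \<in> poly2" for A B
  proof -
    obtain d where d: "((\<lambda>s. A (s, u)) has_field_derivative d) (at p)"
      using poly2_partial_derivatives(1)[OF \<open>A \<in> poly2\<close>] by blast
    then show "((\<lambda>s. A (s, u)) has_field_derivative D1 (pr A B)) (at p)"
      unfolding D1_def sel[OF that] dd[OF d] .
    obtain d where d: "((\<lambda>s. A (p, s)) has_field_derivative d) (at u)"
      using poly2_partial_derivatives(2)[OF \<open>A \<in> poly2\<close>] by blast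
    then show "((\<lambda>s. A (p, s)) has_field_derivative D2 (pr A B)) (at u)"
      unfolding D2_def sel[OF that] dd[OF d] .
  qed
  have D3: "D3 (pr A B) = B (p, u)" if "A \<in> poly2" "B \<in> poly2" for A B
    unfolding D3_def sel[OF that] ..
  have e: "e (pr A B) = A (p, u)" for A B unfolding e_def pr_def using sing(1) by simp
  have rules: "D1 (g \<oplus>\<^bsub>R\<^esub> h) = D1 g + D1 h \<and> D1 (g \<otimes>\<^bsub>R\<^esub> h) = e g * D1 h + e h * D1 g"
    "D2 (g \<oplus>\<^bsub>R\<^esub> h) = D2 g + D2 h \<and> D2 (g \<otimes>\<^bsub>R\<^esub> h) = e g * D2 h + e h * D2 g"
    "D3 (g \<oplus>\<^bsub>R\<^esub> h) = D3 g + D3 h \<and> D3 (g \<otimes>\<^bsub>R\<^esub> h) = e g * D3 h + e h * D3 g"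
    if gh: "g \<in> carrier R" "h \<in> carrier R" for g h
  proof -
    obtain A B where A: "A \<in> poly2" "B \<in> poly2" "g = pr A B" using gh(1) unfolding carr by blast
    obtain A' B' where A': "A' \<in> poly2" "B' \<in> poly2" "h = pr A' B'" using gh(2) unfolding carr by blast
    define As where "As = (\<lambda>q. A q + A' q)"
    define Bs where "Bs = (\<lambda>q. B q + B' q)"
    define Am where "Am = (\<lambda>q. A q * A' q + f q * (B q * B' q))"
    define Bm where "Bm = (\<lambda>q. A q * B' q + B q * A' q)"
    have in2: "As \<in> poly2" "Bs \<in> poly2" "Am \<in> poly2" "Bm \<in> poly2"
      unfolding As_def Bs_def Am_def Bm_def using A A' f by (auto intro!: poly_funs.add poly_funs.mult)
    have add: "g \<oplus>\<^bsub>R\<^esub> h = pr As Bs"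
      unfolding R_def coord_ring_simps pts A(3) A'(3)
      by (auto simp: fun_eq_iff pr_def As_def Bs_def algebra_simps)
    have mult: "g \<otimes>\<^bsub>R\<^esub> h = pr Am Bm"
    proof -
      have "(A (p, u) + v * B (p, u)) * (A' (p, u) + v * B' (p, u)) = Am (p, u) + v * Bm (p, u)"
        if "v\<^sup>2 = f (p, u)" for p u v
        unfolding Am_def Bm_def that[symmetric] by (simp add: algebra_simps power2_eq_square)
      then show ?thesis
        unfolding R_def coord_ring_simps pts A(3) A'(3) by (auto simp: fun_eq_iff pr_def)
    qed
    note dA = der[OF A(1,2)] and dA' = der[OF A'(1,2)]
    note ds = der[OF in2(1,2)] and dm = der[OF in2(3,4)]
    obtain b1 b2 b1' b2' where b: "((\<lambda>s. B (s, u)) has_field_derivative b1) (at p)" "((\<lambda>s. B (p, s)) has_field_derivative b2) (at u)"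
      "((\<lambda>s. B' (s, u)) has_field_derivative b1') (at p)" "((\<lambda>s. B' (p, s)) has_field_derivative b2') (at u)"
      using poly2_partial_derivatives[OF A(2)] poly2_partial_derivatives[OF A'(2)] by meson
    show "D1 (g \<oplus>\<^bsub>R\<^esub> h) = D1 g + D1 h \<and> D1 (g \<otimes>\<^bsub>R\<^esub> h) = e g * D1 h + e h * D1 g"
      unfolding add mult unfolding A(3) A'(3) e
      using DERIV_unique[OF ds(1)[unfolded As_def] DERIV_add[OF dA(1) dA'(1)]]
        DERIV_unique[OF dm(1)[unfolded Am_def] DERIV_add[OF DERIV_mult[OF dA(1) dA'(1)] DERIV_mult[OF sing(2) DERIV_mult[OF b(1,3)]]]]
      by (simp add: sing(1) As_def Am_def algebra_simps)
    show "D2 (g \<oplus>\<^bsub>R\<^esub> h) = D2 g + D2 h \<and> D2 (g \<otimes>\<^bsub>R\<^esub> h) = e g * D2 h + e h * D2 g"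
      unfolding add mult unfolding A(3) A'(3) e
      using DERIV_unique[OF ds(2)[unfolded As_def] DERIV_add[OF dA(2) dA'(2)]]
        DERIV_unique[OF dm(2)[unfolded Am_def] DERIV_add[OF DERIV_mult[OF dA(2) dA'(2)] DERIV_mult[OF sing(3) DERIV_mult[OF b(2,4)]]]]
      by (simp add: sing(1) As_def Am_def algebra_simps)
    show "D3 (g \<oplus>\<^bsub>R\<^esub> h) = D3 g + D3 h \<and> D3 (g \<otimes>\<^bsub>R\<^esub> h) = e g * D3 h + e h * D3 g"
      unfolding add mult unfolding A(3) A'(3) e D3[OF in2(1,2)] D3[OF in2(3,4)] D3[OF A(1,2)] D3[OF A'(1,2)]
      by (simp add: Bs_def Bm_def mult.commute)
  qed
  define c1 where "c1 q = fst q - p" for q :: "complex \<times> complex"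
  define c2 where "c2 q = snd q - u" for q :: "complex \<times> complex"
  have c: "c1 \<in> poly2" "c2 \<in> poly2" "(\<lambda>_. 0) \<in> poly2" "(\<lambda>_. 1) \<in> poly2"
    unfolding c1_def c2_def by (auto intro!: poly_funs_diff poly_funs.const poly2_coords)
  have vals: "D1 (pr c1 (\<lambda>_. 0)) = 1" "D2 (pr c1 (\<lambda>_. 0)) = 0" "D1 (pr c2 (\<lambda>_. 0)) = 0" "D2 (pr c2 (\<lambda>_. 0)) = 1"
    "D1 (pr (\<lambda>_. 0) (\<lambda>_. 1)) = 0" "D2 (pr (\<lambda>_. 0) (\<lambda>_. 1)) = 0"
    unfolding D1_def D2_def sel[OF c(1,3)] sel[OF c(2,3)] sel[OF c(3,4)]
    by (rule dd, auto simp: c1_def c2_def intro!: derivative_eq_intros)+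
  show ?thesis
  proof (intro exI conjI)
    show "point_derivation R e D1" "point_derivation R e D2" "point_derivation R e D3"
      unfolding point_derivation_def using rules by blast+
    have mem: "pr c1 (\<lambda>_. 0) \<in> carrier R" "pr c2 (\<lambda>_. 0) \<in> carrier R" "pr (\<lambda>_. 0) (\<lambda>_. 1) \<in> carrier R"
      unfolding carr using c by blast+
    show "\<exists>m1\<in>carrier R. \<exists>m2\<in>carrier R. \<exists>m3\<in>carrier R. e m1 = 0 \<and> e m2 = 0 \<and> e m3 = 0 \<and>
      D1 m1 = 1 \<and> D2 m1 = 0 \<and> D3 m1 = 0 \<and> D1 m2 = 0 \<and> D2 m2 = 1 \<and> D3 m2 = 0 \<and>
      D1 m3 = 0 \<and> D2 m3 = 0 \<and> D3 m3 = 1"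
      by (rule bexI[OF _ mem(1)], rule bexI[OF _ mem(2)], rule bexI[OF _ mem(3)])
        (simp add: vals e D3 c c1_def[of "(p, u)"] c2_def[of "(p, u)"])
  qed
qed

text \<open>The isomorphism \<open>h\<close> transports the evaluation, the derivations and the relations to \<open>R\<close>, so the
localization of \<open>R\<close> need not be compared with that of the double plane.\<close>

theorem double_plane_singular:
  assumes f: "f \<in> poly2" "f a \<noteq> 0" and sing: "f (p, u) = 0"
    "((\<lambda>s. f (s, u)) has_field_derivative 0) (at p)" "((\<lambda>s. f (p, s)) has_field_derivative 0) (at u)"
    and R: "cring R" and h: "h \<in> ring_iso R (coord_ring (double_plane f))"
  shows "singular R"
proof -
  let ?S = "coord_ring (double_plane f)"
  note fa = function_algebra_double_plane[of f]
  have S: "cring ?S" by (rule cring_coord_ring[OF fa])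
  have P: "(p, u, 0) \<in> pts (double_plane f)" using sing(1) by (simp add: double_plane_def)
  define e where "e = (\<lambda>g :: complex \<times> complex \<times> complex \<Rightarrow> complex. g (p, u, 0))"
  have hc: "\<And>a. a \<in> carrier R \<Longrightarrow> h a \<in> carrier ?S" and bij: "bij_betw h (carrier R) (carrier ?S)"
    and hm: "\<And>a b. a \<in> carrier R \<Longrightarrow> b \<in> carrier R \<Longrightarrow> h (a \<otimes>\<^bsub>R\<^esub> b) = h a \<otimes>\<^bsub>?S\<^esub> h b"
    and ha: "\<And>a b. a \<in> carrier R \<Longrightarrow> b \<in> carrier R \<Longrightarrow> h (a \<oplus>\<^bsub>R\<^esub> b) = h a \<oplus>\<^bsub>?S\<^esub> h b"
    and h1: "h \<one>\<^bsub>R\<^esub> = \<one>\<^bsub>?S\<^esub>"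
    using ring_iso_memE[OF h] by blast+
  have pre: "\<exists>a\<in>carrier R. h a = s" if "s \<in> carrier ?S" for s
    using bij that unfolding bij_betw_def by (metis imageE)
  interpret complex_point R "\<lambda>a. e (h a)"
    using R by (intro complex_point.intro complex_point_axioms.intro)
      (simp_all add: hm ha h1 e_def coord_ring_simps P)
  obtain D1 D2 D3 m1 m2 m3 where D: "point_derivation ?S e D1" "point_derivation ?S e D2" "point_derivation ?S e D3"
    and m: "m1 \<in> carrier ?S" "m2 \<in> carrier ?S" "m3 \<in> carrier ?S" "e m1 = 0" "e m2 = 0" "e m3 = 0"
      "D1 m1 = 1" "D2 m1 = 0" "D3 m1 = 0" "D1 m2 = 0" "D2 m2 = 1" "D3 m2 = 0" "D1 m3 = 0" "D2 m3 = 0" "D3 m3 = 1"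
    using dp_point_derivations[OF f sing] unfolding e_def by blast
  have DR: "point_derivation R (\<lambda>a. e (h a)) (\<lambda>a. D (h a))" if "point_derivation ?S e D" for D
    using that unfolding point_derivation_def by (simp add: hc hm ha)
  obtain n1 n2 n3 where n: "n1 \<in> carrier R" "n2 \<in> carrier R" "n3 \<in> carrier R" "h n1 = m1" "h n2 = m2" "h n3 = m3"
    using pre m(1-3) by meson
  have inv: "inv_into (carrier R) h \<in> ring_iso ?S R"
    by (rule ring_iso_set_sym[OF cring.axioms(1)[OF R] h])
  have dep: "lex_dependent R"
    by (rule lex_dependent_surj[OF S R _ _ dp_lex_dependent[OF f(1)], of "inv_into (carrier R) h"])
      (use ring_iso_memE(5)[OF inv] inv in \<open>auto simp: ring_iso_def bij_betw_def\<close>)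
  have const: "\<exists>a\<in>carrier R. e (h a) = k" for k
  proof -
    have "(\<lambda>q\<in>pts (double_plane f). k) \<in> carrier ?S" using fa by (simp add: function_algebra_def coord_ring_simps)
    from pre[OF this] show ?thesis using P unfolding e_def by (metis restrict_apply')
  qed
  have "singular_point R {a \<in> carrier R. e (h a) = 0}"
    by (rule singular_pointI[OF dep const DR[OF D(1)] DR[OF D(2)] DR[OF D(3)] n(1) _ n(2) _ n(3)])
      (simp_all add: n(4-6) m)
  then show ?thesis unfolding singular_def by blast
qed

section \<open>The orbits of the symmetric group and functions on them\<close>

abbreviation "Xorbit \<equiv> orbit Omega (\<lambda>g. g)"

lemma carrier_Omega: "carrier Omega = generate (BijGroup X_pts) {sigma, rho}"
  by (simp add: Omega_def)

lemma generators_in_Bij: "{sigma, rho} \<subseteq> carrier (BijGroup X_pts)"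
  using sigma_Bij rho_Bij by blast

lemma Omega_in_Bij:
  assumes "g \<in> carrier Omega"
  shows "g \<in> Bij X_pts"
proof -
  have "g \<in> carrier (BijGroup X_pts)"
    by (rule group.generate_in_carrier[OF group_BijGroup generators_in_Bij assms[unfolded carrier_Omega]])
  then show ?thesis by (simp add: BijGroup_def)
qed

lemma mult_Omega:
  assumes "g \<in> carrier Omega" "h \<in> carrier Omega" "q \<in> X_pts"
  shows "(g \<otimes>\<^bsub>BijGroup X_pts\<^esub> h) q = g (h q)"
  using Omega_in_Bij[OF assms(1)] Omega_in_Bij[OF assms(2)] assms(3) by (simp add: BijGroup_def compose_def)

text \<open>Invariance under the two generators suffices; the six elements of the group are never enumerated.\<close>

lemma Omega_invariant:
  assumes g: "g \<in> carrier Omega" and inv: "\<And>q. q \<in> X_pts \<Longrightarrow> F (sigma q) = F q" "\<And>q. q \<in> X_pts \<Longrightarrow> F (rho q) = F q"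
    and q: "q \<in> X_pts"
  shows "g q \<in> X_pts \<and> F (g q) = F q"
  using g q unfolding carrier_Omega
proof (induction arbitrary: q rule: generate.induct)
  case one
  then show ?case by (simp add: BijGroup_def)
next
  case (incl h)
  then show ?case
    using assms(2,3)[OF incl.prems] sigma_in_X[OF incl.prems] rho_in_X[OF incl.prems] by auto
next
  case (inv h)
  have h: "h \<in> Bij X_pts" using inv.hyps generators_in_Bij by (auto simp: BijGroup_def)
  define r where "r = inv_into X_pts h q"
  have r: "r \<in> X_pts" "h r = q" using h inv.prems unfolding r_def
    by (auto simp: Bij_def bij_betw_def inv_into_into f_inv_into_f)
  have "F (h r) = F r" using inv.hyps assms(2,3)[OF r(1)] by auto
  moreover have "(inv\<^bsub>BijGroup X_pts\<^esub> h) q = r"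
    using inv.prems by (simp add: inv_BijGroup[OF h] r_def)
  ultimately show ?case using r by simp
next
  case (eng h1 h2)
  have "(h1 \<otimes>\<^bsub>BijGroup X_pts\<^esub> h2) q = h1 (h2 q)"
    by (rule mult_Omega) (use eng in \<open>simp_all add: carrier_Omega\<close>)
  then show ?case using eng.IH eng.prems by metis
qed

lemma orbit_const:
  assumes "\<And>q. q \<in> X_pts \<Longrightarrow> F (sigma q) = F q" "\<And>q. q \<in> X_pts \<Longrightarrow> F (rho q) = F q" "q \<in> X_pts"
  shows "F ` Xorbit q = {F q}"
proof -
  have id: "(\<lambda>x\<in>X_pts. x) \<in> carrier Omega"
    using generate.one[of "BijGroup X_pts" "{sigma, rho}"] unfolding carrier_Omega by (simp add: BijGroup_def)
  have "q = (\<lambda>x\<in>X_pts. x) q" using assms(3) by simp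
  then have q: "q \<in> Xorbit q"
    unfolding orbit_def by (intro CollectI exI[of _ "\<lambda>x\<in>X_pts. x"] conjI id)
  have const: "F r = F q" if r: "r \<in> Xorbit q" for r
  proof -
    obtain g where g: "g \<in> carrier Omega" "r = g q" using r unfolding orbit_def by blast
    from Omega_invariant[of g F, OF g(1) assms] show ?thesis unfolding g(2) by (rule conjunct2)
  qed
  show ?thesis
  proof (intro equalityI subsetI)
    fix c assume "c \<in> F ` Xorbit q"
    then show "c \<in> {F q}" using const by (elim imageE) simp
  next
    fix c assume "c \<in> {F q}"
    then show "c \<in> F ` Xorbit q" using q by (simp only: singleton_iff) (rule imageI)
  qed
qed

lemma orbit_generator_subset:
  assumes "h \<in> {sigma, rho}" "q \<in> X_pts"
  shows "Xorbit (h q) \<subseteq> Xorbit q"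
proof
  fix r assume "r \<in> Xorbit (h q)"
  then obtain g where g: "g \<in> carrier Omega" "r = g (h q)" unfolding orbit_def by blast
  have h: "h \<in> carrier Omega" using generate.incl[OF assms(1)] by (simp add: carrier_Omega)
  have "g \<otimes>\<^bsub>BijGroup X_pts\<^esub> h \<in> carrier Omega"
    unfolding carrier_Omega by (rule generate.eng[OF g(1)[unfolded carrier_Omega] h[unfolded carrier_Omega]])
  moreover have "(g \<otimes>\<^bsub>BijGroup X_pts\<^esub> h) q = r" using mult_Omega[OF g(1) h assms(2)] g(2) by simp
  ultimately show "r \<in> Xorbit q" unfolding orbit_def by blast
qed

lemma orbit_generators:
  assumes q: "q \<in> X_pts"
  shows "Xorbit (sigma q) = Xorbit q" "Xorbit (rho q) = Xorbit q"
proof -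
  note s = orbit_generator_subset[of sigma] and r = orbit_generator_subset[of rho]
  show "Xorbit (sigma q) = Xorbit q"
    using s[OF _ q] s[OF _ sigma_in_X[OF q]] sigma_sigma[OF q] by auto
  show "Xorbit (rho q) = Xorbit q"
    using r[OF _ q] r[OF _ rho_in_X[OF q]] r[OF _ rho_in_X[OF rho_in_X[OF q]]] rho_rho_rho[OF q] by auto
qed

lemma pts_X_quot: "pts X_quot = Xorbit ` X_pts"
  by (simp add: X_quot_def quotient_variety_def orbits_def X_var_def affine_variety_def Setcompr_eq_image del: split_paired_Ex)

lemma pts_X_var [simp]: "pts X_var = X_pts"
  by (simp add: X_var_def)

lemma regfuns_X_quot: "g \<in> regfuns X_quot \<longleftrightarrow> g \<in> extensional (pts X_quot) \<and> (\<lambda>q\<in>X_pts. g (Xorbit q)) \<in> regfuns X_var"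
  by (simp add: X_quot_def quotient_variety_def)

abbreviation "ct2 \<equiv> \<lambda>(x, y, z, t2, t6). t2 :: complex"
abbreviation "ct6 \<equiv> \<lambda>(x, y, z, t2, t6). t6 :: complex"

abbreviation X_coords :: "(point5 \<Rightarrow> complex) set"
  where "X_coords \<equiv> {\<lambda>(x, y, z, t2, t6). x, \<lambda>(x, y, z, t2, t6). y, \<lambda>(x, y, z, t2, t6). z, ct2, ct6}"

text \<open>The function on orbits induced by an invariant function. Only for a function that is constant on orbits
does \<open>the_elem\<close> have a meaning here.\<close>

definition descend :: "(point5 \<Rightarrow> complex) \<Rightarrow> point5 set \<Rightarrow> complex"
  where "descend G = (\<lambda>orb\<in>pts X_quot. the_elem (G ` orb))"

lemma descend_orbit:
  assumes "\<And>q. q \<in> X_pts \<Longrightarrow> G (sigma q) = G q" "\<And>q. q \<in> X_pts \<Longrightarrow> G (rho q) = G q" "q \<in> X_pts"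
  shows "descend G (Xorbit q) = G q"
  using assms(3) orbit_const[of G, OF assms] by (simp add: descend_def pts_X_quot)

lemma descend_regfun:
  assumes "G \<in> poly_funs X_coords" "\<And>q. q \<in> X_pts \<Longrightarrow> G (sigma q) = G q" "\<And>q. q \<in> X_pts \<Longrightarrow> G (rho q) = G q"
  shows "descend G \<in> regfuns X_quot"
  unfolding regfuns_X_quot
proof
  show "descend G \<in> extensional (pts X_quot)" by (simp add: descend_def)
  have "(\<lambda>q\<in>X_pts. descend G (Xorbit q)) = restrict G X_pts"
    by (rule restrict_ext) (rule descend_orbit[of G, OF assms(2,3)])
  then show "(\<lambda>q\<in>X_pts. descend G (Xorbit q)) \<in> regfuns X_var"
    unfolding X_var_def using affine_regfunI[OF assms(1)] by simp
qed

section \<open>The ring of invariants\<close>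

text \<open>The invariants \<open>p = xy + yw + wx\<close>, \<open>u\<close> and \<open>v\<close>, where \<open>w = t2/2 - x - y\<close>. The last one is the product
of two functions on which the group acts by the sign.\<close>

definition inv_p :: "point5 \<Rightarrow> complex"
  where "inv_p = (\<lambda>(x, y, z, t2, t6). x * y + (x + y) * (t2 / 2 - x - y))"

definition inv_u :: "point5 \<Rightarrow> complex"
  where "inv_u = (\<lambda>(x, y, z, t2, t6). z\<^sup>2)"

definition inv_v :: "point5 \<Rightarrow> complex"
  where "inv_v = (\<lambda>(x, y, z, t2, t6). z * (x - y) * (x - (t2 / 2 - x - y)) * (y - (t2 / 2 - x - y)))"

text \<open>The equation of the branch curve: \<open>u\<close> times the discriminant of the cubic
\<open>T\<^sup>3 - a T\<^sup>2 + p T - c\<close>. Here \<open>c\<close> is the product of the roots \<open>x y w\<close>, computed from the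
equation of the deformation.\<close>

definition branch :: "complex \<times> complex \<Rightarrow> complex \<times> complex \<Rightarrow> complex"
  where "branch = (\<lambda>(t2, t6) (p, u). let a = t2 / 2; c = (t6 + t2 ^ 3 / 108) / 4 - u in
    u * (a\<^sup>2 * p\<^sup>2 - 4 * p ^ 3 - 4 * a ^ 3 * c + 18 * a * p * c - 27 * c\<^sup>2))"

text \<open>The parametrization of the total space by affine 4-space, in which the group acts by permuting
\<open>x, y, w\<close>. Identities between functions on the total space become polynomial identities in free variables.\<close>

definition X_pt :: "complex \<Rightarrow> complex \<Rightarrow> complex \<Rightarrow> complex \<Rightarrow> point5"
  where "X_pt x y w z = (x, y, z, 2 * (x + y + w), 4 * (z\<^sup>2 + x * y * w) - (2 * (x + y + w)) ^ 3 / 108)"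

lemma X_pt_in: "X_pt x y w z \<in> X_pts"
  by (simp add: X_pt_def X_pts_def field_simps)

lemma X_ptE:
  assumes "q \<in> X_pts"
  obtains x y w z where "q = X_pt x y w z"
proof -
  obtain x y z t2 t6 where q: "q = (x, y, z, t2, t6)" by (cases q)
  define w where "w = - x - y + 1/2 * t2"
  have t2: "t2 = 2 * (x + y + w)" by (simp add: w_def)
  have "z\<^sup>2 = x * y * (x + y) - 1/2 * t2 * x * y + 1/4 * (t6 + 1/108 * t2^3)"
    using assms by (simp add: q X_pts_def)
  also have "x * y * (x + y) - 1/2 * t2 * x * y = - (x * y * w)" by (simp add: w_def algebra_simps)
  finally have t6: "t6 = 4 * (z\<^sup>2 + x * y * w) - t2 ^ 3 / 108" by (simp add: field_simps)
  have "q = X_pt x y w z" unfolding X_pt_def t2[symmetric] using t6 q by simp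
  then show ?thesis by (rule that)
qed

lemma sigma_rho_X_pt: "sigma (X_pt x y w z) = X_pt x w y (- z)" "rho (X_pt x y w z) = X_pt y w x z"
proof -
  have h: "- x - y + 1/2 * (2 * (x + y + w)) = w" by (simp add: field_simps)
  show "sigma (X_pt x y w z) = X_pt x w y (- z)" "rho (X_pt x y w z) = X_pt y w x z"
    using X_pt_in[of x y w z] unfolding X_pt_def sigma_def rho_def
    by (simp_all only: restrict_apply' prod.case h) (simp_all add: ac_simps)
qed

lemma invariants_X_pt:
  "inv_p (X_pt x y w z) = x * y + y * w + w * x"
  "inv_u (X_pt x y w z) = z\<^sup>2"
  "inv_v (X_pt x y w z) = z * (x - y) * (x - w) * (y - w)"
proof -
  have h: "2 * (x + y + w) / 2 - x - y = w" by (simp add: field_simps)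
  show "inv_p (X_pt x y w z) = x * y + y * w + w * x"
    "inv_u (X_pt x y w z) = z\<^sup>2"
    "inv_v (X_pt x y w z) = z * (x - y) * (x - w) * (y - w)"
    unfolding X_pt_def inv_p_def inv_u_def inv_v_def prod.case h by (simp_all add: algebra_simps)
qed

lemma alpha_X_pt: "alpha (X_pt x y w z) = (2 * (x + y + w), 4 * (z\<^sup>2 + x * y * w) - (2 * (x + y + w)) ^ 3 / 108)"
  by (simp add: X_pt_def alpha_def)

lemma alpha_coords: "alpha q = (ct2 q, ct6 q)"
  by (cases q) (simp add: alpha_def)

lemma invariants:
  assumes "q \<in> X_pts"
  shows "inv_p (sigma q) = inv_p q" "inv_p (rho q) = inv_p q" "inv_u (sigma q) = inv_u q" "inv_u (rho q) = inv_u q"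
    "inv_v (sigma q) = inv_v q" "inv_v (rho q) = inv_v q" "alpha (sigma q) = alpha q" "alpha (rho q) = alpha q"
proof -
  obtain x y w z where q: "q = X_pt x y w z" using assms by (rule X_ptE)
  show "inv_p (sigma q) = inv_p q" "inv_p (rho q) = inv_p q" "inv_u (sigma q) = inv_u q" "inv_u (rho q) = inv_u q"
    "inv_v (sigma q) = inv_v q" "inv_v (rho q) = inv_v q" "alpha (sigma q) = alpha q" "alpha (rho q) = alpha q"
    unfolding q sigma_rho_X_pt invariants_X_pt alpha_X_pt by (simp_all add: algebra_simps)
qed

lemma alpha_bar_orbit: "q \<in> X_pts \<Longrightarrow> alpha_bar (Xorbit q) = alpha q"
  unfolding alpha_bar_def by (subst orbit_const) (simp_all add: invariants)

lemma discriminant_identity: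
  fixes x y w :: complex
  shows "((x - y) * (x - w) * (y - w))\<^sup>2 = (x + y + w)\<^sup>2 * (x * y + y * w + w * x)\<^sup>2 - 4 * (x * y + y * w + w * x) ^ 3
      - 4 * (x + y + w) ^ 3 * (x * y * w) + 18 * (x + y + w) * (x * y + y * w + w * x) * (x * y * w) - 27 * (x * y * w)\<^sup>2"
  by (simp add: algebra_simps power2_eq_square power3_eq_cube)

lemma branch_X_pt:
  "branch (2 * (x + y + w), 4 * (u + x * y * w) - (2 * (x + y + w)) ^ 3 / 108) (x * y + y * w + w * x, u) =
    u * ((x - y) * (x - w) * (y - w))\<^sup>2"
proof -
  have a: "2 * (x + y + w) / 2 = x + y + w" by (simp add: field_simps)
  have c: "(4 * (u + x * y * w) - (2 * (x + y + w)) ^ 3 / 108 + (2 * (x + y + w)) ^ 3 / 108) / 4 - u = x * y * w" by (simp add: field_simps)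
  show ?thesis unfolding branch_def prod.case Let_def a c discriminant_identity ..
qed

lemma inv_v_square: "q \<in> X_pts \<Longrightarrow> (inv_v q)\<^sup>2 = branch (alpha q) (inv_p q, inv_u q)"
proof (erule X_ptE)
  fix x y w z assume q: "q = X_pt x y w z"
  show "(inv_v q)\<^sup>2 = branch (alpha q) (inv_p q, inv_u q)"
    unfolding q alpha_X_pt invariants_X_pt branch_X_pt by (simp add: power_mult_distrib)
qed

abbreviation "inv_coords \<equiv> {ct2, ct6, inv_p, inv_u}"

lemma inv_poly_invariant:
  assumes "s \<in> poly_funs inv_coords" "q \<in> X_pts"
  shows "s (sigma q) = s q" "s (rho q) = s q"
  using assms(1)
  by (induction, use invariants[OF assms(2)] in \<open>auto simp: alpha_coords\<close>)

lemma inv_in_X_coords: "inv_p \<in> poly_funs X_coords" "inv_u \<in> poly_funs X_coords" "inv_v \<in> poly_funs X_coords"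
proof -
  have c: "(\<lambda>q. fst q) \<in> poly_funs X_coords" "(\<lambda>q. fst (snd q)) \<in> poly_funs X_coords" "(\<lambda>q. fst (snd (snd q))) \<in> poly_funs X_coords"
    "(\<lambda>q. fst (snd (snd (snd q)))) \<in> poly_funs X_coords"
    by (rule poly_funs.coord, simp add: case_prod_unfold)+
  show "inv_p \<in> poly_funs X_coords" "inv_u \<in> poly_funs X_coords" "inv_v \<in> poly_funs X_coords"
    unfolding inv_p_def inv_u_def inv_v_def case_prod_unfold by (intro poly_funs_intros c[unfolded case_prod_unfold])+
qed

text \<open>The total space is finite over the quotient. The monomials \<open>x\<^sup>i y\<^sup>j z\<^sup>k\<close> with \<open>i < 3\<close>,
\<open>j < 2\<close>, \<open>k < 2\<close> generate its functions over the polynomials in \<open>t2\<close>, \<open>t6\<close>, \<open>p\<close>, \<open>u\<close>: higher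
powers are reduced by the cubic with root \<open>x\<close>, by the quadratic with root \<open>y\<close> that remains after dividing
off \<open>x\<close>, and by \<open>z\<^sup>2 = u\<close>.\<close>

definition X_mon :: "nat \<times> nat \<times> nat \<Rightarrow> point5 \<Rightarrow> complex"
  where "X_mon = (\<lambda>(i, j, k) (x, y, z, t2, t6). x ^ i * y ^ j * z ^ k)"

abbreviation "X_gens \<equiv> X_mon ` ({..<3} \<times> {..<2} \<times> {..<2})"
abbreviation "X_span \<equiv> modspan X_pts inv_coords X_gens"

lemma inv_coord_in: "ct2 \<in> poly_funs inv_coords" "ct6 \<in> poly_funs inv_coords"
  "inv_p \<in> poly_funs inv_coords" "inv_u \<in> poly_funs inv_coords"
  by (simp_all add: poly_funs.coord)

text \<open>The elementary symmetric functions \<open>x + y + w\<close> and \<open>x y w\<close>, expressed by the invariants.\<close>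

definition e1 :: "point5 \<Rightarrow> complex" where "e1 q = ct2 q / 2"
definition e3 :: "point5 \<Rightarrow> complex" where "e3 q = (ct6 q + ct2 q ^ 3 / 108) / 4 - inv_u q"

lemma e_X_pt: "e1 (X_pt x y w z) = x + y + w" "e3 (X_pt x y w z) = x * y * w"
proof -
  show "e1 (X_pt x y w z) = x + y + w" by (simp add: e1_def X_pt_def field_simps)
  show "e3 (X_pt x y w z) = x * y * w" unfolding e3_def invariants_X_pt by (simp add: X_pt_def field_simps)
qed

lemma e_in: "e1 \<in> poly_funs inv_coords" "e3 \<in> poly_funs inv_coords"
  unfolding e1_def e3_def by (intro poly_funs_intros inv_coord_in)+

lemma X_mon_X_pt: "X_mon (i, j, k) (X_pt x y w z) = x ^ i * y ^ j * z ^ k"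
  by (simp add: X_mon_def X_pt_def)

lemma X_gen: "i < 3 \<Longrightarrow> j < 2 \<Longrightarrow> k < 2 \<Longrightarrow> X_mon (i, j, k) \<in> X_span"
  by (rule modspan.gen) auto

lemma X_span_times_x:
  assumes "m \<in> X_gens"
  shows "(\<lambda>q. (case q of (x, y, z, t2, t6) \<Rightarrow> x) * m q) \<in> X_span"
proof -
  obtain i j k where m: "m = X_mon (i, j, k)" "i < 3" "j < 2" "k < 2" using assms by auto
  show ?thesis
  proof (cases "i = 2")
    case False
    have "X_mon (Suc i, j, k) \<in> X_span" by (rule X_gen) (use m False in auto)
    then show ?thesis by (rule modspan.cong) (auto simp: m X_mon_def)
  next
    case True
    have "(\<lambda>q. (e1 q * X_mon (2, j, k) q + (- inv_p q) * X_mon (1, j, k) q) + e3 q * X_mon (0, j, k) q) \<in> X_span"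
      by (intro modspan.add modspan.smult e_in poly_funs_uminus inv_coord_in X_gen) (use m in auto)
    then show ?thesis
    proof (rule modspan.cong)
      fix q assume "q \<in> X_pts"
      then obtain x y w z where q: "q = X_pt x y w z" by (rule X_ptE)
      have x: "(case X_pt x y w z of (x, y, z, t2, t6) \<Rightarrow> x) = x" by (simp add: X_pt_def)
      show "(case q of (x, y, z, t2, t6) \<Rightarrow> x) * m q =
          (e1 q * X_mon (2, j, k) q + (- inv_p q) * X_mon (1, j, k) q) + e3 q * X_mon (0, j, k) q"
        unfolding q m(1) True X_mon_X_pt e_X_pt invariants_X_pt x by (simp add: algebra_simps power2_eq_square)
    qed
  qed
qed

lemma X_span_times_y:
  assumes "m \<in> X_gens"
  shows "(\<lambda>q. (case q of (x, y, z, t2, t6) \<Rightarrow> y) * m q) \<in> X_span"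
proof -
  obtain i j k where m: "m = X_mon (i, j, k)" "i < 3" "j < 2" "k < 2" using assms by auto
  let ?x = "\<lambda>q :: point5. case q of (x, y, z, t2, t6) \<Rightarrow> x"
  show ?thesis
  proof (cases "j = 1")
    case False
    have "X_mon (i, Suc j, k) \<in> X_span" by (rule X_gen) (use m False in auto)
    then show ?thesis by (rule modspan.cong) (auto simp: m X_mon_def)
  next
    case True
    have x: "(\<lambda>q. ?x q * h q) \<in> X_span" if "h \<in> X_span" for h
      using that X_span_times_x by (rule modspan_times)
    have "(\<lambda>q. (-1) * (?x q * (?x q * X_mon (i, 0, k) q)) + ((-1) * (?x q * X_mon (i, 1, k) q)
        + (e1 q * (?x q * X_mon (i, 0, k) q) + (e1 q * X_mon (i, 1, k) q + (- inv_p q) * X_mon (i, 0, k) q)))) \<in> X_span"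
      by (intro modspan.add modspan.smult e_in poly_funs_uminus inv_coord_in poly_funs.const x X_gen) (use m in auto)
    then show ?thesis
    proof (rule modspan.cong)
      fix q assume "q \<in> X_pts"
      then obtain x y w z where q: "q = X_pt x y w z" by (rule X_ptE)
      have xy: "(case X_pt x y w z of (x, y, z, t2, t6) \<Rightarrow> x) = x" "(case X_pt x y w z of (x, y, z, t2, t6) \<Rightarrow> y) = y"
        by (simp_all add: X_pt_def)
      show "(case q of (x, y, z, t2, t6) \<Rightarrow> y) * m q =
          (-1) * (?x q * (?x q * X_mon (i, 0, k) q)) + ((-1) * (?x q * X_mon (i, 1, k) q)
        + (e1 q * (?x q * X_mon (i, 0, k) q) + (e1 q * X_mon (i, 1, k) q + (- inv_p q) * X_mon (i, 0, k) q)))"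
        unfolding q m(1) True X_mon_X_pt e_X_pt invariants_X_pt xy by (simp add: algebra_simps)
    qed
  qed
qed

lemma X_span_times_z:
  assumes "m \<in> X_gens"
  shows "(\<lambda>q. (case q of (x, y, z, t2, t6) \<Rightarrow> z) * m q) \<in> X_span"
proof -
  obtain i j k where m: "m = X_mon (i, j, k)" "i < 3" "j < 2" "k < 2" using assms by auto
  show ?thesis
  proof (cases "k = 1")
    case False
    have "X_mon (i, j, Suc k) \<in> X_span" by (rule X_gen) (use m False in auto)
    then show ?thesis by (rule modspan.cong) (auto simp: m X_mon_def)
  next
    case True
    have "(\<lambda>q. inv_u q * X_mon (i, j, 0) q) \<in> X_span"
      by (intro modspan.smult inv_coord_in X_gen) (use m in auto)
    then show ?thesis
      by (rule modspan.cong) (auto simp: m True X_mon_def inv_u_def power2_eq_square)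
  qed
qed

lemma X_poly_in_span:
  assumes "f \<in> poly_funs X_coords"
  shows "f \<in> X_span"
proof -
  have "X_mon (0, 0, 0) \<in> X_span" by (rule X_gen) auto
  then have "(\<lambda>q. f q * X_mon (0, 0, 0) q) \<in> X_span"
  proof (rule modspan_times_poly[OF assms])
    fix c m assume c: "c \<in> X_coords" and m: "m \<in> X_gens"
    note times = X_span_times_x[OF m] X_span_times_y[OF m] X_span_times_z[OF m]
      modspan.smult[OF inv_coord_in(1) modspan.gen[OF m]] modspan.smult[OF inv_coord_in(2) modspan.gen[OF m]]
    from c show "(\<lambda>q. c q * m q) \<in> X_span"
      by (elim insertE emptyE; hypsubst) (rule times)+
  qed
  then show ?thesis by (rule modspan.cong) (auto simp: X_mon_def)
qed

definition inv_mon :: "nat \<times> nat \<times> nat \<Rightarrow> point5 \<Rightarrow> complex"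
  where "inv_mon = (\<lambda>(i, j, l) q. inv_p q ^ i * inv_u q ^ j * inv_v q ^ l)"

text \<open>The exponents of the basis \<open>p\<^sup>i u\<^sup>j v\<^sup>l\<close> of the invariants over the base.\<close>

definition inv_index :: "(nat \<times> nat \<times> nat) set"
  where "inv_index = {(i, j, l). l < 2}"

abbreviation "inv_span \<equiv> modspan X_pts {ct2, ct6} (inv_mon ` inv_index)"

lemma inv_gen: "l < 2 \<Longrightarrow> inv_mon (i, j, l) \<in> inv_span"
  by (rule modspan.gen) (auto simp: inv_index_def)

lemma inv_span_times:
  assumes "s \<in> poly_funs inv_coords" "h \<in> inv_span"
  shows "(\<lambda>q. s q * h q) \<in> inv_span"
proof (rule modspan_times_poly[OF assms])
  fix c m assume c: "c \<in> inv_coords" and m: "m \<in> inv_mon ` inv_index"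
  then obtain i j l where m': "m = inv_mon (i, j, l)" "l < 2" by (auto simp: inv_index_def)
  have "(\<lambda>q. inv_p q * m q) \<in> inv_span"
    by (rule modspan.cong[OF inv_gen[of l "Suc i" j]]) (simp_all add: m' inv_mon_def)
  moreover have "(\<lambda>q. inv_u q * m q) \<in> inv_span"
    by (rule modspan.cong[OF inv_gen[of l i "Suc j"]]) (simp_all add: m' inv_mon_def)
  moreover have "(\<lambda>q. ct2 q * m q) \<in> inv_span" "(\<lambda>q. ct6 q * m q) \<in> inv_span"
    by (intro modspan.smult modspan.gen m poly_funs.coord; simp)+
  ultimately show "(\<lambda>q. c q * m q) \<in> inv_span" using c by (elim insertE) simp_all
qed

text \<open>The average over the group. It is linear over invariant functions and fixes them, so invariants are
spanned by the averages of module generators of the full ring; only twelve of these have to be computed.\<close>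

definition reynolds :: "(point5 \<Rightarrow> complex) \<Rightarrow> point5 \<Rightarrow> complex"
  where "reynolds G q = (G q + G (rho q) + G (rho (rho q)) + G (sigma q) + G (sigma (rho q)) + G (sigma (rho (rho q)))) / 6"

text \<open>The averages of monomials in \<open>x, y\<close> alone are symmetric functions. Those of monomials with a factor \<open>z\<close> are
\<open>z\<close> times an antisymmetric function; by degree, only \<open>x\<^sup>2 y z\<close> survives and yields \<open>v/6\<close>.\<close>

lemma reynolds_gen:
  assumes "m \<in> X_gens"
  shows "reynolds m \<in> inv_span"
proof -
  obtain i j k where m: "m = X_mon (i, j, k)" "i < 3" "j < 2" "k < 2" using assms by auto
  have span: "reynolds m \<in> inv_span" if s: "s1 \<in> poly_funs inv_coords" "s2 \<in> poly_funs inv_coords"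
    and eq: "\<And>x y w z. x ^ i * y ^ j * z ^ k + y ^ i * w ^ j * z ^ k + w ^ i * x ^ j * z ^ k +
      x ^ i * w ^ j * (- z) ^ k + y ^ i * x ^ j * (- z) ^ k + w ^ i * y ^ j * (- z) ^ k =
      6 * (s1 (X_pt x y w z) + s2 (X_pt x y w z) * inv_v (X_pt x y w z))" for s1 s2
  proof -
    have "(\<lambda>q. s1 q * inv_mon (0, 0, 0) q + s2 q * inv_mon (0, 0, 1) q) \<in> inv_span"
      using s by (intro modspan.add inv_span_times inv_gen) auto
    then show ?thesis
    proof (rule modspan.cong)
      fix q assume "q \<in> X_pts"
      then obtain x y w z where q: "q = X_pt x y w z" by (rule X_ptE)
      show "reynolds m q = s1 q * inv_mon (0, 0, 0) q + s2 q * inv_mon (0, 0, 1) q"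
        unfolding reynolds_def m(1) q sigma_rho_X_pt X_mon_X_pt eq[of x y z w] by (simp add: inv_mon_def)
    qed
  qed
  note vals = e_X_pt invariants_X_pt
  have ijk: "i = 0 \<or> i = 1 \<or> i = 2" "j = 0 \<or> j = 1" "k = 0 \<or> k = 1" using m(2-4) by linarith+
  consider "i = 0" "j = 0" "k = 0" | "i = 1" "j = 0" "k = 0" | "i = 2" "j = 0" "k = 0"
    | "i = 0" "j = 1" "k = 0" | "i = 1" "j = 1" "k = 0" | "i = 2" "j = 1" "k = 0"
    | "i = 2" "j = 1" "k = 1" | "k = 1" "i = 0 \<or> i = 1 \<or> j = 0"
    using ijk by (elim disjE; simp)
  then show ?thesis
  proof cases
    case 1
    show ?thesis
      by (rule span[of "\<lambda>_. 1" "\<lambda>_. 0"], intro poly_funs_intros, intro poly_funs_intros) (simp add: 1)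
  next
    case 2
    show ?thesis
      by (rule span[of "\<lambda>q. e1 q / 3" "\<lambda>_. 0"], intro poly_funs_intros e_in, intro poly_funs_intros)
        (simp add: 2 vals)
  next
    case 3
    show ?thesis
      by (rule span[of "\<lambda>q. (e1 q * e1 q - 2 * inv_p q) / 3" "\<lambda>_. 0"], intro poly_funs_intros e_in inv_coord_in,
          intro poly_funs_intros) (simp add: 3 vals algebra_simps power2_eq_square)
  next
    case 4
    show ?thesis
      by (rule span[of "\<lambda>q. e1 q / 3" "\<lambda>_. 0"], intro poly_funs_intros e_in, intro poly_funs_intros)
        (simp add: 4 vals)
  next
    case 5
    show ?thesis
      by (rule span[of "\<lambda>q. inv_p q / 3" "\<lambda>_. 0"], intro poly_funs_intros inv_coord_in, intro poly_funs_intros)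
        (simp add: 5 vals algebra_simps)
  next
    case 6
    show ?thesis
      by (rule span[of "\<lambda>q. (e1 q * inv_p q - 3 * e3 q) / 6" "\<lambda>_. 0"], intro poly_funs_intros e_in inv_coord_in,
          intro poly_funs_intros) (simp add: 6 vals algebra_simps power2_eq_square)
  next
    case 7
    show ?thesis
      by (rule span[of "\<lambda>_. 0" "\<lambda>_. 1 / 6"], intro poly_funs_intros, intro poly_funs_intros)
        (simp add: 7 vals algebra_simps power2_eq_square)
  next
    case 8
    have z: "x ^ i * y ^ j * z ^ k + y ^ i * w ^ j * z ^ k + w ^ i * x ^ j * z ^ k +
      x ^ i * w ^ j * (- z) ^ k + y ^ i * x ^ j * (- z) ^ k + w ^ i * y ^ j * (- z) ^ k = 0" for x y w z :: complex
      using 8 ijk by (elim disjE; simp add: algebra_simps)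
    show ?thesis
      by (rule span[of "\<lambda>_. 0" "\<lambda>_. 0"], intro poly_funs_intros, intro poly_funs_intros) (simp add: z)
  qed
qed

lemma reynolds_span: "f \<in> X_span \<Longrightarrow> reynolds f \<in> inv_span"
proof (induction rule: modspan.induct)
  case (gen m)
  then show ?case by (rule reynolds_gen)
next
  case zero
  show ?case by (simp add: reynolds_def[abs_def] modspan.zero)
next
  case (add f g)
  show ?case by (rule modspan.cong[OF modspan.add[OF add.IH]]) (simp add: reynolds_def add_divide_distrib)
next
  case (smult s f)
  show ?case
  proof (rule modspan.cong[OF inv_span_times[OF smult.hyps(1) smult.IH]])
    fix q assume q: "q \<in> X_pts"
    note r = rho_in_X[OF q] rho_in_X[OF rho_in_X[OF q]]
    show "reynolds (\<lambda>p. s p * f p) q = s q * reynolds f q"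
      using inv_poly_invariant[OF smult.hyps(1)] q r by (simp add: reynolds_def algebra_simps)
  qed
next
  case (cong f g)
  show ?case
  proof (rule modspan.cong[OF cong.IH])
    fix q assume q: "q \<in> X_pts"
    note r = rho_in_X[OF q] rho_in_X[OF rho_in_X[OF q]]
    show "reynolds g q = reynolds f q"
      using cong.hyps(2) q r sigma_in_X by (simp add: reynolds_def)
  qed
qed

theorem invariant_in_span:
  assumes "G \<in> poly_funs X_coords" "\<And>q. q \<in> X_pts \<Longrightarrow> G (sigma q) = G q" "\<And>q. q \<in> X_pts \<Longrightarrow> G (rho q) = G q"
  shows "G \<in> inv_span"
proof (rule modspan.cong[OF reynolds_span[OF X_poly_in_span[OF assms(1)]]])
  fix q assume q: "q \<in> X_pts"
  note r = rho_in_X[OF q] rho_in_X[OF rho_in_X[OF q]]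
  show "G q = reynolds G q" using assms(2,3) q r by (simp add: reynolds_def)
qed

section \<open>Points of the quotient\<close>

lemma cubic_root:
  fixes A B C :: complex
  shows "\<exists>x. x ^ 3 + A * x\<^sup>2 + B * x + C = 0"
proof -
  let ?p = "[:C, B, A, 1:]"
  have "degree ?p = 3" by simp
  then have "\<not> constant (poly ?p)" by (simp add: constant_degree)
  then obtain x where "poly ?p x = 0" using fundamental_theorem_of_algebra by blast
  then show ?thesis by (intro exI[of _ x]) (simp add: algebra_simps power2_eq_square power3_eq_cube)
qed

text \<open>The roots \<open>x, y, w\<close> of the cubic with the prescribed coefficients and a square root \<open>z\<close> of \<open>u\<close> determine
\<open>v\<close> up to sign; the sign is adjusted by that of \<open>z\<close>.\<close>

lemma X_point_over:
  assumes v: "v\<^sup>2 = branch b (p, u)"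
  shows "\<exists>q\<in>X_pts. alpha q = b \<and> inv_p q = p \<and> inv_u q = u \<and> inv_v q = v"
proof -
  obtain t2 t6 where b: "b = (t2, t6)" by (cases b)
  define a where "a = t2 / 2"
  define e where "e = (t6 + t2 ^ 3 / 108) / 4 - u"
  obtain x where "x ^ 3 + (- a) * x\<^sup>2 + p * x + (- e) = 0" using cubic_root by blast
  then have x: "x ^ 3 + p * x = a * x\<^sup>2 + e" by (simp add: algebra_simps)
  define r where "r = p - x * (a - x)"
  define d where "d = csqrt ((a - x)\<^sup>2 - 4 * r)"
  have d: "d\<^sup>2 = (a - x)\<^sup>2 - 4 * r" by (simp add: d_def)
  define y w where "y = (a - x + d) / 2" and "w = (a - x - d) / 2"
  have s: "x + y + w = a" by (simp add: y_def w_def field_simps)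
  have yw: "y * w = r"
  proof -
    have "y * w = ((a - x)\<^sup>2 - d\<^sup>2) / 4" by (simp add: y_def w_def field_simps power2_eq_square)
    then show ?thesis by (simp add: d)
  qed
  have "y + w = a - x" using s by (simp add: algebra_simps)
  then have "x * y + y * w + w * x = x * (a - x) + y * w" by (simp add: algebra_simps flip: \<open>y + w = a - x\<close>)
  then have pp: "x * y + y * w + w * x = p" by (simp add: yw r_def)
  have "x * y * w = x * r" by (simp add: yw mult.assoc)
  also have "\<dots> = e" using x by (simp add: r_def algebra_simps power2_eq_square power3_eq_cube)
  finally have ee: "x * y * w = e" .
  have al: "alpha (X_pt x y w z) = b" if "z\<^sup>2 = u" for z
  proof -
    have 1: "2 * (x + y + w) = t2" unfolding s by (simp add: a_def)
    have "4 * (u + e) - t2 ^ 3 / 108 = t6" by (simp add: e_def field_simps)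
    then show ?thesis unfolding alpha_X_pt 1 ee that b by simp
  qed
  define z where "z = csqrt u"
  have z: "z\<^sup>2 = u" "(- z)\<^sup>2 = u" by (simp_all add: z_def)
  have iv: "inv_p (X_pt x y w z') = p" "inv_u (X_pt x y w z') = z'\<^sup>2" for z'
    by (simp_all only: invariants_X_pt pp)
  have "(inv_v (X_pt x y w z))\<^sup>2 = v\<^sup>2"
    unfolding inv_v_square[OF X_pt_in] v al[OF z(1)] iv z(1) ..
  then consider "inv_v (X_pt x y w z) = v" | "inv_v (X_pt x y w z) = - v" by (auto simp: power2_eq_iff)
  then show ?thesis
  proof cases
    case 1
    then show ?thesis using al[OF z(1)] iv z(1) by (intro bexI[OF _ X_pt_in[of x y w z]]) simp
  next
    case 2
    then have "inv_v (X_pt x y w (- z)) = v" by (simp add: invariants_X_pt)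
    then show ?thesis using al[OF z(2)] iv z(2) by (intro bexI[OF _ X_pt_in[of x y w "- z"]]) simp
  qed
qed

lemma branch_poly2: "branch b \<in> poly2"
proof -
  obtain t2 t6 where b: "b = (t2, t6)" by (cases b)
  show ?thesis unfolding b branch_def prod.case Let_def case_prod_unfold
    by (intro poly_funs_intros poly2_coords[unfolded fst_def snd_def] poly2_coords)
qed

text \<open>For \<open>u = 1\<close> the equation is a cubic in \<open>p\<close> with leading coefficient \<open>-4\<close>.\<close>

lemma branch_nonzero: "\<exists>a. branch b a \<noteq> 0"
proof (rule ccontr)
  assume z: "\<not> (\<exists>a. branch b a \<noteq> 0)"
  obtain t2 t6 where b: "b = (t2, t6)" by (cases b)
  define a where "a = t2 / 2"
  define c where "c = (t6 + t2 ^ 3 / 108) / 4 - 1"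
  have "poly [:- 4 * a ^ 3 * c - 27 * c\<^sup>2, 18 * a * c, a\<^sup>2, -4:] p = branch b (p, 1)" for p
    unfolding b branch_def prod.case Let_def a_def[symmetric] c_def[symmetric]
    by (simp add: algebra_simps power2_eq_square power3_eq_cube)
  then have "\<forall>p. poly [:- 4 * a ^ 3 * c - 27 * c\<^sup>2, 18 * a * c, a\<^sup>2, -4:] p = 0" using z by simp
  then have "[:- 4 * a ^ 3 * c - 27 * c\<^sup>2, 18 * a * c, a\<^sup>2, -4:] = 0" by (simp only: poly_all_0_iff_0)
  then show False by simp
qed

section \<open>The quotient as a free module over the base\<close>

lemma poly2_coeffs_zero:
  fixes k :: "nat \<Rightarrow> nat \<Rightarrow> complex"
  assumes "\<And>p u. (\<Sum>i\<le>N. \<Sum>j\<le>N. k i j * p ^ i * u ^ j) = 0" "i \<le> N" "j \<le> N"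
  shows "k i j = 0"
proof -
  have "\<forall>i\<le>N. (\<Sum>j\<le>N. k i j * u ^ j) = 0" for u
  proof -
    have "(\<Sum>i\<le>N. (\<Sum>j\<le>N. k i j * u ^ j) * p ^ i) = 0" for p
      using assms(1)[of p u] by (simp add: sum_distrib_right sum_distrib_left ac_simps)
    then show ?thesis using polyfun_eq_0[of "\<lambda>i. \<Sum>j\<le>N. k i j * u ^ j" N] by blast
  qed
  then have "(\<Sum>j\<le>N. k i j * u ^ j) = 0" for u using assms(2) by blast
  then show ?thesis using polyfun_eq_0[of "k i" N] assms(3) by blast
qed

definition dp_mon :: "nat \<times> nat \<times> nat \<Rightarrow> complex \<times> complex \<times> complex \<Rightarrow> complex"
  where "dp_mon = (\<lambda>(i, j, l) (p, u, v). p ^ i * u ^ j * v ^ l)"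

lemma dp_mon_independent:
  assumes f: "f \<in> poly2" "f a \<noteq> 0" and J: "finite J" "J \<subseteq> inv_index"
    and zero: "\<And>r. r \<in> dp_pts f \<Longrightarrow> (\<Sum>x\<in>J. k x * dp_mon x r) = 0"
  shows "\<forall>x\<in>J. k x = 0"
proof -
  define k' where "k' x = (if x \<in> J then k x else 0)" for x
  define N where "N = Max (insert 0 (fst ` J \<union> (\<lambda>x. fst (snd x)) ` J))"
  have le: "i \<le> N \<and> j \<le> N \<and> l < 2" if "(i, j, l) \<in> J" for i j l
  proof -
    have "i \<in> insert 0 (fst ` J \<union> (\<lambda>x. fst (snd x)) ` J)" "j \<in> insert 0 (fst ` J \<union> (\<lambda>x. fst (snd x)) ` J)"
      using that by force+
    then show ?thesis unfolding N_def using J that by (auto simp: inv_index_def intro!: Max_ge)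
  qed
  define A where "A l = (\<lambda>(p, u). \<Sum>i\<le>N. \<Sum>j\<le>N. k' (i, j, l) * p ^ i * u ^ j)" for l
  have A: "A l \<in> poly2" for l
    unfolding A_def case_prod_unfold by (intro poly_funs_sum poly_funs_intros poly2_coords)
  have "A 0 (p, u) + v * A 1 (p, u) = 0" if v: "v\<^sup>2 = f (p, u)" for p u v
  proof -
    have sub: "J \<subseteq> {..N} \<times> {..N} \<times> {..<2}" using le by auto
    have "0 = (\<Sum>x\<in>J. k' x * dp_mon x (p, u, v))" using zero[of "(p, u, v)"] v by (simp add: k'_def)
    also have "\<dots> = (\<Sum>x\<in>{..N} \<times> {..N} \<times> {..<2}. k' x * dp_mon x (p, u, v))"
      by (rule sum.mono_neutral_left) (use sub in \<open>auto simp: k'_def\<close>)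
    also have "\<dots> = (\<Sum>i\<le>N. \<Sum>j\<le>N. \<Sum>l<2. k' (i, j, l) * (p ^ i * u ^ j * v ^ l))"
      by (simp add: sum.cartesian_product dp_mon_def case_prod_unfold)
    also have "\<dots> = A 0 (p, u) + v * A 1 (p, u)"
      by (simp add: A_def numeral_2_eq_2 sum.distrib sum_distrib_left algebra_simps)
    finally show ?thesis by simp
  qed
  then have "A 0 = (\<lambda>_. 0)" "A 1 = (\<lambda>_. 0)"
    using dp_unique(1)[OF f A A, of 0 1] dp_unique(2)[OF f A A, of 0 1] by blast+
  then have zero': "(\<Sum>i\<le>N. \<Sum>j\<le>N. k' (i, j, l) * p ^ i * u ^ j) = 0" if "l < 2" for l p u
  proof -
    have "l = 0 \<or> l = 1" using \<open>l < 2\<close> by linarith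
    then have "A l (p, u) = 0" using \<open>A 0 = (\<lambda>_. 0)\<close> \<open>A 1 = (\<lambda>_. 0)\<close> by auto
    then show ?thesis by (simp add: A_def)
  qed
  show ?thesis
  proof
    fix x assume x: "x \<in> J"
    obtain i j l where ijl: "x = (i, j, l)" by (cases x)
    have "k' (i, j, l) = 0"
      by (rule poly2_coeffs_zero[where N = N and k = "\<lambda>i j. k' (i, j, l)"]) (use le[of i j l] x ijl zero' in auto)
    then show "k x = 0" using x ijl by (simp add: k'_def)
  qed
qed

lemma base_regfuns: "regfuns base_var = poly2" and base_pts: "pts base_var = UNIV"
proof -
  have c: "{\<lambda>(t2, t6). t2, \<lambda>(t2, t6). t6} = {fst, snd :: complex \<times> complex \<Rightarrow> complex}"
    by (simp add: case_prod_unfold)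
  show "regfuns base_var = poly2" unfolding base_var_def affine_variety_def c by (auto simp: restrict_UNIV)
  show "pts base_var = UNIV" by (simp add: base_var_def)
qed

lemma base_poly_pullback:
  assumes "f \<in> poly_funs {ct2, ct6}"
  shows "\<exists>b\<in>poly2. f = (\<lambda>q. b (alpha q))"
  using assms
proof induction
  case (coord c)
  then show ?case
  proof (elim insertE emptyE)
    assume "c = ct2"
    then show ?thesis by (intro bexI[OF _ poly2_coords(1)]) (auto simp: alpha_def)
  next
    assume "c = ct6"
    then show ?thesis by (intro bexI[OF _ poly2_coords(2)]) (auto simp: alpha_def)
  qed
next
  case (const k)
  show ?case by (rule bexI[of _ "\<lambda>_. k"]) (auto intro: poly_funs.const)
next
  case (add f g)
  then obtain b b' where "b \<in> poly2" "f = (\<lambda>q. b (alpha q))" "b' \<in> poly2" "g = (\<lambda>q. b' (alpha q))" by blast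
  then show ?case by (intro bexI[of _ "\<lambda>t. b t + b' t"]) (auto intro: poly_funs.add)
next
  case (mult f g)
  then obtain b b' where "b \<in> poly2" "f = (\<lambda>q. b (alpha q))" "b' \<in> poly2" "g = (\<lambda>q. b' (alpha q))" by blast
  then show ?case by (intro bexI[of _ "\<lambda>t. b t * b' t"]) (auto intro: poly_funs.mult)
qed

lemma function_algebra_X_quot: "function_algebra X_quot"
proof -
  have X: "function_algebra X_var" unfolding X_var_def by (rule function_algebra_affine)
  have orb: "Xorbit q \<in> pts X_quot" if "q \<in> X_pts" for q using that by (simp add: pts_X_quot)
  show ?thesis
    unfolding function_algebra_def
  proof (intro conjI allI ballI subsetI)
    fix g assume "g \<in> regfuns X_quot"
    then show "g \<in> extensional (pts X_quot)" by (simp add: regfuns_X_quot)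
  next
    fix k :: complex
    have "(\<lambda>q\<in>X_pts. (\<lambda>p\<in>pts X_quot. k) (Xorbit q)) = (\<lambda>q\<in>X_pts. k)"
      by (rule restrict_ext) (simp add: orb)
    then show "(\<lambda>p\<in>pts X_quot. k) \<in> regfuns X_quot"
      using X by (simp add: regfuns_X_quot function_algebra_def)
  next
    fix f g assume f: "f \<in> regfuns X_quot" and g: "g \<in> regfuns X_quot"
    define f' g' where "f' = (\<lambda>q\<in>X_pts. f (Xorbit q))" and "g' = (\<lambda>q\<in>X_pts. g (Xorbit q))"
    have fg: "f' \<in> regfuns X_var" "g' \<in> regfuns X_var"
      using f g by (simp_all add: regfuns_X_quot f'_def g'_def)
    have "(\<lambda>q\<in>X_pts. (\<lambda>p\<in>pts X_quot. f p + g p) (Xorbit q)) = (\<lambda>q\<in>X_pts. f' q + g' q)"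
      by (rule restrict_ext) (simp add: orb f'_def g'_def)
    then show "(\<lambda>p\<in>pts X_quot. f p + g p) \<in> regfuns X_quot"
      using X fg by (simp add: regfuns_X_quot function_algebra_def)
    have "(\<lambda>q\<in>X_pts. (\<lambda>p\<in>pts X_quot. f p * g p) (Xorbit q)) = (\<lambda>q\<in>X_pts. f' q * g' q)"
      by (rule restrict_ext) (simp add: orb f'_def g'_def)
    then show "(\<lambda>p\<in>pts X_quot. f p * g p) \<in> regfuns X_quot"
      using X fg by (simp add: regfuns_X_quot function_algebra_def)
  qed
qed

text \<open>Together with \<open>coefficients_vanish\<close> this says that the monomials form a basis over the functions on the
base.\<close>

theorem quotient_expansion:
  assumes g: "g \<in> regfuns X_quot"
  shows "\<exists>J c. finite J \<and> J \<subseteq> inv_index \<and> (\<forall>x. c x \<in> poly2) \<and> (\<forall>x. x \<notin> J \<longrightarrow> c x = (\<lambda>_. 0)) \<and>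
    (\<forall>q\<in>X_pts. g (Xorbit q) = (\<Sum>x\<in>J. c x (alpha q) * inv_mon x q))"
proof -
  have "(\<lambda>q\<in>X_pts. g (Xorbit q)) \<in> regfuns X_var" using g by (simp add: regfuns_X_quot)
  then obtain G where G: "G \<in> poly_funs X_coords" "(\<lambda>q\<in>X_pts. g (Xorbit q)) = restrict G X_pts"
    unfolding X_var_def by (rule affine_regfunE)
  have Gq: "G q = g (Xorbit q)" if "q \<in> X_pts" for q using fun_cong[OF G(2), of q] that by simp
  have "G \<in> inv_span"
    by (rule invariant_in_span[OF G(1)]) (simp_all add: Gq sigma_in_X rho_in_X orbit_generators)
  then obtain J c where c: "finite J" "J \<subseteq> inv_index" "\<And>x. c x \<in> poly_funs {ct2, ct6}"
    "\<And>q. q \<in> X_pts \<Longrightarrow> G q = (\<Sum>x\<in>J. c x q * inv_mon x q)"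
    using modspan_sum[of G X_pts "{ct2, ct6}" inv_mon inv_index] by blast
  have "\<forall>x. \<exists>b. b \<in> poly2 \<and> c x = (\<lambda>q. b (alpha q))" using base_poly_pullback[OF c(3)] by blast
  then obtain b where b: "\<And>x. b x \<in> poly2" "\<And>x. c x = (\<lambda>q. b x (alpha q))" by metis
  define b' where "b' x = (if x \<in> J then b x else (\<lambda>_. 0))" for x
  have "\<forall>x. b' x \<in> poly2" "\<forall>x. x \<notin> J \<longrightarrow> b' x = (\<lambda>_. 0)"
    by (simp_all add: b'_def b(1) poly_funs.const)
  moreover have "\<forall>q\<in>X_pts. g (Xorbit q) = (\<Sum>x\<in>J. b' x (alpha q) * inv_mon x q)"
    by (simp add: Gq[symmetric] c(4) b(2) b'_def)
  ultimately show ?thesis using c(1,2) by blast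
qed

lemma inv_mon_in_X_coords: "inv_mon x \<in> poly_funs X_coords"
  by (cases x) (simp only: inv_mon_def prod.case, intro poly_funs_intros inv_in_X_coords)

lemma inv_mon_invariant:
  assumes "q \<in> X_pts"
  shows "inv_mon x (sigma q) = inv_mon x q" "inv_mon x (rho q) = inv_mon x q"
  by (simp_all add: inv_mon_def case_prod_unfold invariants[OF assms])

lemma descend_inv_mon:
  "descend (inv_mon x) \<in> regfuns X_quot"
  "q \<in> X_pts \<Longrightarrow> descend (inv_mon x) (Xorbit q) = inv_mon x q"
  using descend_regfun[OF inv_mon_in_X_coords] descend_orbit[of "inv_mon x"] inv_mon_invariant by blast+

lemma pullback_alpha_bar:
  assumes "b \<in> poly2"
  shows "pullback X_quot alpha_bar b \<in> regfuns X_quot"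
    and "q \<in> X_pts \<Longrightarrow> pullback X_quot alpha_bar b (Xorbit q) = b (alpha q)"
proof -
  have v: "pullback X_quot alpha_bar b (Xorbit q) = b (alpha q)" if "q \<in> X_pts" for q
    using that by (simp add: pullback_def pts_X_quot alpha_bar_orbit)
  then show "q \<in> X_pts \<Longrightarrow> pullback X_quot alpha_bar b (Xorbit q) = b (alpha q)" .
  have "(\<lambda>q. b (ct2 q, ct6 q)) \<in> poly_funs X_coords"
    by (rule poly_funs_subst[OF assms]) (auto intro: poly_funs.coord)
  then have "(\<lambda>q. b (alpha q)) \<in> poly_funs X_coords" by (simp add: alpha_coords)
  from affine_regfunI[OF this] have "restrict (\<lambda>q. b (alpha q)) X_pts \<in> regfuns X_var"
    unfolding X_var_def .
  moreover have "(\<lambda>q\<in>X_pts. pullback X_quot alpha_bar b (Xorbit q)) = restrict (\<lambda>q. b (alpha q)) X_pts"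
    by (rule restrict_ext) (rule v)
  ultimately show "pullback X_quot alpha_bar b \<in> regfuns X_quot"
    by (simp add: regfuns_X_quot pullback_def)
qed

section \<open>Flatness\<close>

text \<open>Independence holds fibre by fibre, not only over the function field of the base. This is what makes the
scheme-theoretic fibres reduced.\<close>

lemma coefficients_vanish:
  assumes J: "finite J" "J \<subseteq> inv_index"
    and zero: "\<And>q. q \<in> X_pts \<Longrightarrow> alpha q = b \<Longrightarrow> (\<Sum>x\<in>J. k x * inv_mon x q) = 0"
  shows "\<forall>x\<in>J. k x = 0"
proof -
  obtain a where a: "branch b a \<noteq> 0" using branch_nonzero by blast
  show ?thesis
  proof (rule dp_mon_independent[OF branch_poly2 a J])
    fix r assume r: "r \<in> dp_pts (branch b)"
    obtain p u v where puv: "r = (p, u, v)" by (cases r)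
    then obtain q where q: "q \<in> X_pts" "alpha q = b" "inv_p q = p" "inv_u q = u" "inv_v q = v"
      using X_point_over[of v b p u] r by auto
    have "dp_mon x r = inv_mon x q" for x by (simp add: dp_mon_def inv_mon_def puv q case_prod_unfold)
    then show "(\<Sum>x\<in>J. k x * dp_mon x r) = 0" using zero[OF q(1,2)] by simp
  qed
qed

text \<open>The equational criterion holds for a free module: the relations between the coefficients of each basis element
are relations over the base.\<close>

lemma alpha_bar_flat: "flat_morphism X_quot base_var alpha_bar"
  unfolding flat_morphism_def
proof (intro conjI allI impI)
  show "morphism X_quot base_var alpha_bar"
    unfolding morphism_def base_regfuns base_pts using pullback_alpha_bar(1) by blast
next
  fix n :: nat and a :: "nat \<Rightarrow> complex \<times> complex \<Rightarrow> complex" and m :: "nat \<Rightarrow> point5 set \<Rightarrow> complex"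
  assume *: "(\<forall>i<n. a i \<in> regfuns base_var \<and> m i \<in> regfuns X_quot) \<and>
    (\<forall>p\<in>pts X_quot. (\<Sum>i<n. a i (alpha_bar p) * m i p) = 0)"
  have "\<forall>i\<in>{..<n}. \<exists>Jc. finite (fst Jc) \<and> fst Jc \<subseteq> inv_index \<and> (\<forall>x. snd Jc x \<in> poly2) \<and> (\<forall>x. x \<notin> fst Jc \<longrightarrow> snd Jc x = (\<lambda>_. 0)) \<and>
    (\<forall>q\<in>X_pts. m i (Xorbit q) = (\<Sum>x\<in>fst Jc. snd Jc x (alpha q) * inv_mon x q))"
    using quotient_expansion * by (auto simp: split_paired_Ex)
  from bchoice[OF this] obtain Jc where Jc: "\<And>i. i < n \<Longrightarrow> finite (fst (Jc i)) \<and> fst (Jc i) \<subseteq> inv_index \<and>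
      (\<forall>x. snd (Jc i) x \<in> poly2) \<and> (\<forall>x. x \<notin> fst (Jc i) \<longrightarrow> snd (Jc i) x = (\<lambda>_. 0)) \<and>
      (\<forall>q\<in>X_pts. m i (Xorbit q) = (\<Sum>x\<in>fst (Jc i). snd (Jc i) x (alpha q) * inv_mon x q))" by (auto simp: Ball_def)
  define J where "J = (\<Union>i<n. fst (Jc i))"
  define c where "c i = snd (Jc i)" for i
  have J: "finite J" "J \<subseteq> inv_index"
    unfolding J_def using Jc by (blast intro: finite_UN_I finite_lessThan)+
  have c: "c i x \<in> poly2" if "i < n" for i x using Jc[OF that] unfolding c_def by blast
  have m: "m i (Xorbit q) = (\<Sum>x\<in>J. c i x (alpha q) * inv_mon x q)" if i: "i < n" and q: "q \<in> X_pts" for i q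
  proof -
    have "m i (Xorbit q) = (\<Sum>x\<in>fst (Jc i). c i x (alpha q) * inv_mon x q)"
      using Jc[OF i] q by (simp add: c_def)
    also have "\<dots> = (\<Sum>x\<in>J. c i x (alpha q) * inv_mon x q)"
      by (rule sum.mono_neutral_left[OF J(1)]) (use Jc[OF i] i in \<open>auto simp: J_def c_def\<close>)
    finally show ?thesis .
  qed
  have rel: "\<forall>x\<in>J. (\<Sum>i<n. a i b * c i x b) = 0" for b
  proof (rule coefficients_vanish[OF J])
    fix q assume q: "q \<in> X_pts" "alpha q = b"
    have "(\<Sum>x\<in>J. (\<Sum>i<n. a i b * c i x b) * inv_mon x q) = (\<Sum>i<n. a i b * (\<Sum>x\<in>J. c i x b * inv_mon x q))"
      unfolding sum_distrib_right sum_distrib_left by (subst sum.swap) (simp add: mult.assoc)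
    also have "\<dots> = (\<Sum>i<n. a i (alpha_bar (Xorbit q)) * m i (Xorbit q))"
      by (intro sum.cong refl) (simp add: m q alpha_bar_orbit)
    also have "\<dots> = 0" using * q(1) pts_X_quot by blast
    finally show "(\<Sum>x\<in>J. (\<Sum>i<n. a i b * c i x b) * inv_mon x q) = 0" .
  qed
  obtain e where e: "bij_betw e {0..<card J} J" using ex_bij_betw_nat_finite[OF J(1)] by blast
  then have e': "bij_betw e {..<card J} J" by (simp add: lessThan_atLeast0)
  have "\<forall>i<n. \<forall>p\<in>pts X_quot. m i p = (\<Sum>j<card J. c i (e j) (alpha_bar p) * descend (inv_mon (e j)) p)"
  proof (intro allI impI ballI)
    fix i p assume i: "i < n" and "p \<in> pts X_quot"
    then obtain q where q: "q \<in> X_pts" "p = Xorbit q" by (auto simp: pts_X_quot)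
    show "m i p = (\<Sum>j<card J. c i (e j) (alpha_bar p) * descend (inv_mon (e j)) p)"
      unfolding q(2) m[OF i q(1)] alpha_bar_orbit[OF q(1)] descend_inv_mon(2)[OF q(1)]
      by (rule sum.reindex_bij_betw[OF e', symmetric])
  qed
  moreover have "\<forall>j<card J. \<forall>q\<in>pts base_var. (\<Sum>i<n. a i q * c i (e j) q) = 0"
    using rel bij_betwE[OF e'] by simp
  moreover have "\<forall>i<n. \<forall>j<card J. c i (e j) \<in> regfuns base_var" by (simp add: base_regfuns c)
  moreover have "\<forall>j<card J. descend (inv_mon (e j)) \<in> regfuns X_quot" by (simp add: descend_inv_mon)
  ultimately show "\<exists>(k::nat) b m'.
        (\<forall>i<n. \<forall>j<k. b i j \<in> regfuns base_var) \<and> (\<forall>j<k. m' j \<in> regfuns X_quot) \<and>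
        (\<forall>i<n. \<forall>p\<in>pts X_quot. m i p = (\<Sum>j<k. b i j (alpha_bar p) * m' j p)) \<and>
        (\<forall>j<k. \<forall>q\<in>pts base_var. (\<Sum>i<n. a i q * b i j q) = 0)"
    by (intro exI[of _ "card J"] exI[of _ "\<lambda>i j. c i (e j)"] exI[of _ "\<lambda>j. descend (inv_mon (e j))"]) simp
qed

section \<open>The fibres are double planes\<close>

text \<open>A chosen preimage in the total space of a point of the fibre, which is described by the invariants. No choice
matters, as regular functions on the quotient depend on the invariants only.\<close>

definition lift_point :: "complex \<times> complex \<Rightarrow> complex \<times> complex \<times> complex \<Rightarrow> point5"
  where "lift_point b = (\<lambda>(p, u, v). SOME q. q \<in> X_pts \<and> alpha q = b \<and> inv_p q = p \<and> inv_u q = u \<and> inv_v q = v)"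

lemma lift_point:
  assumes "(p, u, v) \<in> dp_pts (branch b)"
  shows "lift_point b (p, u, v) \<in> X_pts" "alpha (lift_point b (p, u, v)) = b" "inv_p (lift_point b (p, u, v)) = p"
    "inv_u (lift_point b (p, u, v)) = u" "inv_v (lift_point b (p, u, v)) = v"
proof -
  have "\<exists>q. q \<in> X_pts \<and> alpha q = b \<and> inv_p q = p \<and> inv_u q = u \<and> inv_v q = v"
  proof -
    have "v\<^sup>2 = branch b (p, u)" using assms by simp
    from X_point_over[OF this] show ?thesis by blast
  qed
  from someI_ex[OF this]
  show "lift_point b (p, u, v) \<in> X_pts" "alpha (lift_point b (p, u, v)) = b" "inv_p (lift_point b (p, u, v)) = p"
    "inv_u (lift_point b (p, u, v)) = u" "inv_v (lift_point b (p, u, v)) = v"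
    unfolding lift_point_def by simp_all
qed

text \<open>Restriction of functions to the fibre over \<open>b\<close>, read as functions on the double plane. Being an evaluation at
chosen points, it is clearly a ring homomorphism.\<close>

definition fibre_eval :: "complex \<times> complex \<Rightarrow> (point5 set \<Rightarrow> complex) \<Rightarrow> complex \<times> complex \<times> complex \<Rightarrow> complex"
  where "fibre_eval b g = (\<lambda>r\<in>dp_pts (branch b). g (Xorbit (lift_point b r)))"

lemma lift_orbit: "r \<in> dp_pts (branch b) \<Longrightarrow> Xorbit (lift_point b r) \<in> pts X_quot"
  using lift_point(1) by (cases r) (auto simp: pts_X_quot simp del: mem_Collect_eq)

lemma fibre_eval_expansion:
  assumes "\<And>q. q \<in> X_pts \<Longrightarrow> g (Xorbit q) = (\<Sum>x\<in>J. c x (alpha q) * inv_mon x q)" "r \<in> dp_pts (branch b)"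
  shows "fibre_eval b g r = (\<Sum>x\<in>J. c x b * dp_mon x r)"
proof -
  obtain p u v where r: "r = (p, u, v)" by (cases r)
  note l = lift_point[OF assms(2)[unfolded r]]
  have "inv_mon x (lift_point b r) = dp_mon x r" for x
    unfolding r inv_mon_def dp_mon_def by (simp add: l(3-5) case_prod_unfold)
  then show ?thesis using assms(2) by (simp only: fibre_eval_def restrict_apply' assms(1)[OF l(1)[folded r]] l(2)[folded r])
qed

lemma fibre_eval_regfun:
  assumes "g \<in> regfuns X_quot"
  shows "fibre_eval b g \<in> regfuns (double_plane (branch b))"
proof -
  obtain J c where c: "\<And>q. q \<in> X_pts \<Longrightarrow> g (Xorbit q) = (\<Sum>x\<in>J. c x (alpha q) * inv_mon x q)"
    using quotient_expansion[OF assms] by blast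
  have mon: "dp_mon x \<in> poly_funs dp_coords" for x
    using dp_coord_in by (cases x) (simp add: dp_mon_def case_prod_unfold poly_funs_intros)
  have "fibre_eval b g = restrict (\<lambda>r. \<Sum>x\<in>J. c x b * dp_mon x r) (dp_pts (branch b))"
    using fibre_eval_expansion[OF c] by (intro ext) (auto simp: fibre_eval_def)
  moreover have "restrict (\<lambda>r. \<Sum>x\<in>J. c x b * dp_mon x r) (dp_pts (branch b)) \<in> regfuns (double_plane (branch b))"
    unfolding double_plane_def by (intro affine_regfunI poly_funs_sum poly_funs.mult poly_funs.const mon)
  ultimately show ?thesis by simp
qed

lemma fibre_eval_hom: "fibre_eval b \<in> ring_hom (coord_ring X_quot) (coord_ring (double_plane (branch b)))"
proof (rule ring_hom_memI, unfold coord_ring_simps double_plane_pts)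
  show "fibre_eval b g \<in> regfuns (double_plane (branch b))" if "g \<in> regfuns X_quot" for g
    by (rule fibre_eval_regfun[OF that])
  show "fibre_eval b (\<lambda>q\<in>pts X_quot. g q * h q) = (\<lambda>r\<in>dp_pts (branch b). fibre_eval b g r * fibre_eval b h r)"
    "fibre_eval b (\<lambda>q\<in>pts X_quot. g q + h q) = (\<lambda>r\<in>dp_pts (branch b). fibre_eval b g r + fibre_eval b h r)"
    "fibre_eval b (\<lambda>q\<in>pts X_quot. 1) = (\<lambda>r\<in>dp_pts (branch b). 1)" for g h
    unfolding fibre_eval_def by (rule restrict_ext, simp only: restrict_apply' lift_orbit)+
qed

lemma fibre_eval_surj: "fibre_eval b ` carrier (coord_ring X_quot) = carrier (coord_ring (double_plane (branch b)))"
  unfolding coord_ring_simps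
proof (intro equalityI subsetI)
  fix h assume "h \<in> fibre_eval b ` regfuns X_quot"
  then show "h \<in> regfuns (double_plane (branch b))" using fibre_eval_regfun by blast
next
  fix h assume "h \<in> regfuns (double_plane (branch b))"
  then obtain H where H: "H \<in> poly_funs dp_coords" "h = restrict H (dp_pts (branch b))"
    unfolding double_plane_def by (rule affine_regfunE)
  define G where "G q = H (inv_p q, inv_u q, inv_v q)" for q
  have "G \<in> poly_funs X_coords" unfolding G_def
    by (rule poly_funs_subst[OF H(1)]) (use inv_in_X_coords in auto)
  moreover have inv: "G (sigma q) = G q" "G (rho q) = G q" if "q \<in> X_pts" for q
    by (simp_all add: G_def invariants[OF that])
  ultimately have 1: "descend G \<in> regfuns X_quot" by (rule descend_regfun)
  have "fibre_eval b (descend G) r = h r" for r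
  proof (cases "r \<in> dp_pts (branch b)")
    case True
    obtain p u v where r: "r = (p, u, v)" by (cases r)
    note l = lift_point[OF True[unfolded r]]
    have "descend G (Xorbit (lift_point b r)) = G (lift_point b r)"
      unfolding r by (rule descend_orbit[of G, OF inv l(1)])
    also have "\<dots> = H r" unfolding r G_def l(3-5) ..
    finally show ?thesis using True by (simp add: fibre_eval_def H(2))
  next
    case False
    then show ?thesis by (simp add: fibre_eval_def H(2))
  qed
  then have "h = fibre_eval b (descend G)" by (simp add: fun_eq_iff)
  then show "h \<in> fibre_eval b ` regfuns X_quot" using 1 by (rule image_eqI)
qed

lemma fibre_eval_ring_hom_ring:
  "ring_hom_ring (coord_ring X_quot) (coord_ring (double_plane (branch b))) (fibre_eval b)"
  by (intro ring_hom_ringI2 cring.axioms(1)[OF cring_coord_ring] function_algebra_X_quot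
      function_algebra_double_plane fibre_eval_hom)

lemma fibre_gen_subset:
  "pullback X_quot alpha_bar ` {g \<in> regfuns base_var. g b = 0} \<subseteq> carrier (coord_ring X_quot)"
  using pullback_alpha_bar(1) by (auto simp: base_regfuns coord_ring_simps)

text \<open>A function in the kernel has, in the expansion over the base, coefficients that vanish at \<open>b\<close>; each of them
is one of the generators of the fibre ideal. This is where independence of the monomials on the single fibre is
used.\<close>

lemma fibre_kernel:
  "a_kernel (coord_ring X_quot) (coord_ring (double_plane (branch b))) (fibre_eval b) = fibre_ideal X_quot base_var alpha_bar b"
proof (intro equalityI)
  let ?R = "coord_ring X_quot"
  let ?S = "coord_ring (double_plane (branch b))"
  let ?G = "pullback X_quot alpha_bar ` {g \<in> regfuns base_var. g b = 0}"
  interpret R: cring ?R by (rule cring_coord_ring[OF function_algebra_X_quot])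
  interpret h: ring_hom_ring ?R ?S "fibre_eval b" by (rule fibre_eval_ring_hom_ring)
  have "?G \<subseteq> a_kernel ?R ?S (fibre_eval b)"
  proof
    fix k assume "k \<in> ?G"
    then obtain g where g: "g \<in> poly2" "g b = 0" "k = pullback X_quot alpha_bar g" by (auto simp: base_regfuns)
    have "k (Xorbit (lift_point b r)) = 0" if "r \<in> dp_pts (branch b)" for r
    proof -
      obtain p u v where r: "r = (p, u, v)" by (cases r)
      note l = lift_point[OF that[unfolded r]]
      show ?thesis unfolding r g(3) pullback_alpha_bar(2)[OF g(1) l(1)] l(2) g(2) ..
    qed
    then have "fibre_eval b k = (\<lambda>r\<in>dp_pts (branch b). 0)" unfolding fibre_eval_def by (intro restrict_ext)
    then show "k \<in> a_kernel ?R ?S (fibre_eval b)"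
      unfolding a_kernel_def' using pullback_alpha_bar(1)[OF g(1)]
      by (simp add: coord_ring_simps double_plane_pts g(3))
  qed
  then show "fibre_ideal X_quot base_var alpha_bar b \<subseteq> a_kernel ?R ?S (fibre_eval b)"
    unfolding fibre_ideal_def by (rule R.genideal_minimal[OF h.kernel_is_ideal])
  interpret I: ideal "fibre_ideal X_quot base_var alpha_bar b" ?R
    unfolding fibre_ideal_def by (rule R.genideal_ideal[OF fibre_gen_subset])
  show "a_kernel ?R ?S (fibre_eval b) \<subseteq> fibre_ideal X_quot base_var alpha_bar b"
  proof
    fix g assume "g \<in> a_kernel ?R ?S (fibre_eval b)"
    then have g: "g \<in> regfuns X_quot" "fibre_eval b g = (\<lambda>r\<in>dp_pts (branch b). 0)"
      unfolding a_kernel_def' by (simp_all add: coord_ring_simps double_plane_pts)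
    obtain J c where c: "finite J" "J \<subseteq> inv_index" "\<And>x. c x \<in> poly2"
      "\<And>q. q \<in> X_pts \<Longrightarrow> g (Xorbit q) = (\<Sum>x\<in>J. c x (alpha q) * inv_mon x q)"
      using quotient_expansion[OF g(1)] by blast
    obtain a where a: "branch b a \<noteq> 0" using branch_nonzero by blast
    have c0: "\<forall>x\<in>J. c x b = 0"
    proof (rule dp_mon_independent[OF branch_poly2 a c(1,2)])
      fix r assume r: "r \<in> dp_pts (branch b)"
      show "(\<Sum>x\<in>J. c x b * dp_mon x r) = 0"
        using fibre_eval_expansion[OF c(4) r] fun_cong[OF g(2), of r] r by simp
    qed
    have gen: "pullback X_quot alpha_bar (c x) \<in> fibre_ideal X_quot base_var alpha_bar b" if "x \<in> J" for x
      unfolding fibre_ideal_def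
      by (rule subsetD[OF R.genideal_self[OF fibre_gen_subset]]) (use that c0 c(3) in \<open>auto simp: base_regfuns\<close>)
    define s where "s K = (\<lambda>p\<in>pts X_quot. \<Sum>x\<in>K. pullback X_quot alpha_bar (c x) p * descend (inv_mon x) p)" for K
    have "s K \<in> fibre_ideal X_quot base_var alpha_bar b" if "finite K" "K \<subseteq> J" for K
      using that
    proof induction
      case empty
      have "s {} = \<zero>\<^bsub>?R\<^esub>" by (simp add: s_def coord_ring_simps)
      then show ?case by simp
    next
      case (insert x K)
      have d: "descend (inv_mon x) \<in> carrier ?R" by (simp add: coord_ring_simps descend_inv_mon)
      have "s (insert x K) = (pullback X_quot alpha_bar (c x) \<otimes>\<^bsub>?R\<^esub> descend (inv_mon x)) \<oplus>\<^bsub>?R\<^esub> s K"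
        unfolding s_def coord_ring_simps using insert.hyps by (intro restrict_ext) simp
      moreover have "pullback X_quot alpha_bar (c x) \<otimes>\<^bsub>?R\<^esub> descend (inv_mon x) \<in> fibre_ideal X_quot base_var alpha_bar b"
        by (rule I.I_r_closed[OF gen d]) (use insert.prems in simp)
      ultimately show ?case using insert.IH insert.prems
        additive_subgroup.a_closed[OF I.is_additive_subgroup] by simp
    qed
    from this[OF c(1) order_refl] have "s J \<in> fibre_ideal X_quot base_var alpha_bar b" .
    moreover have "g = s J"
    proof
      fix p
      show "g p = s J p"
      proof (cases "p \<in> pts X_quot")
        case True
        then obtain q where q: "q \<in> X_pts" "p = Xorbit q" by (auto simp: pts_X_quot)
        show ?thesis unfolding s_def using True
          by (simp add: q(2) c(4)[OF q(1)] pullback_alpha_bar(2)[OF c(3) q(1)] descend_inv_mon(2)[OF q(1)])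
      next
        case False
        then show ?thesis using g(1) by (simp add: s_def regfuns_X_quot extensional_def)
      qed
    qed
    ultimately show "g \<in> fibre_ideal X_quot base_var alpha_bar b" by simp
  qed
qed

definition fibre_iso :: "complex \<times> complex \<Rightarrow> (point5 set \<Rightarrow> complex) set \<Rightarrow> complex \<times> complex \<times> complex \<Rightarrow> complex"
  where "fibre_iso b = (\<lambda>K. the_elem (fibre_eval b ` K))"

theorem fibre_iso:
  "fibre_iso b \<in> ring_iso (fibre_ring X_quot base_var alpha_bar b) (coord_ring (double_plane (branch b)))"
proof -
  interpret h: ring_hom_ring "coord_ring X_quot" "coord_ring (double_plane (branch b))" "fibre_eval b"
    by (rule fibre_eval_ring_hom_ring)
  show ?thesis
    using h.FactRing_iso_set[OF fibre_eval_surj] unfolding fibre_kernel fibre_ring_def fibre_iso_def .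
qed

lemma fibre_iso_coset:
  assumes "g \<in> regfuns X_quot"
  shows "fibre_iso b (fibre_ideal X_quot base_var alpha_bar b +>\<^bsub>coord_ring X_quot\<^esub> g) = fibre_eval b g"
proof -
  interpret h: ring_hom_ring "coord_ring X_quot" "coord_ring (double_plane (branch b))" "fibre_eval b"
    by (rule fibre_eval_ring_hom_ring)
  show ?thesis using h.the_elem_simp[of g] assms unfolding fibre_kernel fibre_iso_def by (simp add: coord_ring_simps)
qed

lemma fibre_ring_cring: "cring (fibre_ring X_quot base_var alpha_bar b)"
proof -
  interpret R: cring "coord_ring X_quot" by (rule cring_coord_ring[OF function_algebra_X_quot])
  interpret I: ideal "fibre_ideal X_quot base_var alpha_bar b" "coord_ring X_quot"
    unfolding fibre_ideal_def by (rule R.genideal_ideal[OF fibre_gen_subset])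
  show ?thesis unfolding fibre_ring_def by (rule I.quotient_is_cring) (rule R.is_cring)
qed

text \<open>The singular point lies over an intersection of the line \<open>u = 0\<close> with the discriminant curve \<open>D = 0\<close>.\<close>

theorem fibre_singular: "singular (fibre_ring X_quot base_var alpha_bar b)"
proof -
  obtain t2 t6 where b: "b = (t2, t6)" by (cases b)
  define a where "a = t2 / 2"
  define c where "c = (t6 + t2 ^ 3 / 108) / 4"
  define D where "D p u = a\<^sup>2 * p\<^sup>2 - 4 * p ^ 3 - 4 * a ^ 3 * (c - u) + 18 * a * p * (c - u) - 27 * (c - u)\<^sup>2" for p u
  have br: "branch b (p, u) = u * D p u" for p u
    by (simp add: b branch_def Let_def a_def c_def D_def)
  obtain p where "p ^ 3 + (- a\<^sup>2 / 4) * p\<^sup>2 + (- 18 * a * c / 4) * p + (4 * a ^ 3 * c + 27 * c\<^sup>2) / 4 = 0"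
    using cubic_root by blast
  moreover have "D p 0 = -4 * (p ^ 3 + (- a\<^sup>2 / 4) * p\<^sup>2 + (- 18 * a * c / 4) * p + (4 * a ^ 3 * c + 27 * c\<^sup>2) / 4)"
    by (simp add: D_def field_simps)
  ultimately have D0: "D p 0 = 0" by simp
  obtain x where x: "branch b x \<noteq> 0" using branch_nonzero by blast
  show ?thesis
  proof (rule double_plane_singular[OF branch_poly2 x _ _ _ fibre_ring_cring fibre_iso])
    show "branch b (p, 0) = 0" by (simp add: br)
    show "((\<lambda>s. branch b (s, 0)) has_field_derivative 0) (at p)" by (simp add: br)
    have "((\<lambda>s. D p s) has_field_derivative (4 * a ^ 3 - 18 * a * p + 54 * c)) (at 0)"
      unfolding D_def by (auto intro!: derivative_eq_intros simp: algebra_simps)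
    from DERIV_mult[OF DERIV_ident this]
    show "((\<lambda>s. branch b (p, s)) has_field_derivative 0) (at 0)" by (simp add: br D0)
  qed
qed

section \<open>The special fibre has type E7\<close>

lemma affine_variety_iso:
  assumes \<psi>: "\<And>r. r \<in> Z' \<Longrightarrow> \<psi> r \<in> Z" and \<chi>: "\<And>r. r \<in> Z \<Longrightarrow> \<chi> r \<in> Z'"
    and inv: "\<And>r. r \<in> Z' \<Longrightarrow> \<chi> (\<psi> r) = r" "\<And>r. r \<in> Z \<Longrightarrow> \<psi> (\<chi> r) = r"
    and poly: "\<And>c. c \<in> C \<Longrightarrow> (\<lambda>r. c (\<psi> r)) \<in> poly_funs C'" "\<And>c. c \<in> C' \<Longrightarrow> (\<lambda>r. c (\<chi> r)) \<in> poly_funs C"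
  shows "(\<lambda>g. \<lambda>r\<in>Z'. g (\<psi> r)) \<in> ring_iso (coord_ring (affine_variety C Z)) (coord_ring (affine_variety C' Z'))"
proof (rule ring_iso_memI, unfold coord_ring_simps affine_pts)
  have mem: "(\<lambda>r\<in>Z'. g (\<psi> r)) \<in> regfuns (affine_variety C' Z')" if g: "g \<in> regfuns (affine_variety C Z)" for g
  proof -
    obtain f where f: "f \<in> poly_funs C" "g = restrict f Z" using g by (rule affine_regfunE)
    have "(\<lambda>r\<in>Z'. g (\<psi> r)) = restrict (\<lambda>r. f (\<psi> r)) Z'" by (rule restrict_ext) (simp add: f(2) \<psi>)
    then show ?thesis using affine_regfunI[OF poly_funs_subst[OF f(1) poly(1)]] by simp
  qed
  have mem': "(\<lambda>r\<in>Z. g (\<chi> r)) \<in> regfuns (affine_variety C Z)" if g: "g \<in> regfuns (affine_variety C' Z')" for g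
  proof -
    obtain f where f: "f \<in> poly_funs C'" "g = restrict f Z'" using g by (rule affine_regfunE)
    have "(\<lambda>r\<in>Z. g (\<chi> r)) = restrict (\<lambda>r. f (\<chi> r)) Z" by (rule restrict_ext) (simp add: f(2) \<chi>)
    then show ?thesis using affine_regfunI[OF poly_funs_subst[OF f(1) poly(2)]] by simp
  qed
  show "(\<lambda>r\<in>Z'. g (\<psi> r)) \<in> regfuns (affine_variety C' Z')" if "g \<in> regfuns (affine_variety C Z)" for g
    by (rule mem[OF that])
  show "(\<lambda>r\<in>Z'. (\<lambda>p\<in>Z. g p * h p) (\<psi> r)) = (\<lambda>p\<in>Z'. (\<lambda>r\<in>Z'. g (\<psi> r)) p * (\<lambda>r\<in>Z'. h (\<psi> r)) p)" for g h :: "_ \<Rightarrow> complex"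
    by (rule restrict_ext) (simp add: \<psi>)
  show "(\<lambda>r\<in>Z'. (\<lambda>p\<in>Z. g p + h p) (\<psi> r)) = (\<lambda>p\<in>Z'. (\<lambda>r\<in>Z'. g (\<psi> r)) p + (\<lambda>r\<in>Z'. h (\<psi> r)) p)" for g h :: "_ \<Rightarrow> complex"
    by (rule restrict_ext) (simp add: \<psi>)
  show "(\<lambda>r\<in>Z'. (\<lambda>p\<in>Z. 1 :: complex) (\<psi> r)) = (\<lambda>p\<in>Z'. 1)"
    by (rule restrict_ext) (simp add: \<psi>)
  have ext: "g = restrict g A" if "g \<in> regfuns (affine_variety B A)" for g A B
    using that by (auto elim!: affine_regfunE)
  show "bij_betw (\<lambda>g. \<lambda>r\<in>Z'. g (\<psi> r)) (regfuns (affine_variety C Z)) (regfuns (affine_variety C' Z'))"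
  proof (rule bij_betw_byWitness[where f' = "\<lambda>g. \<lambda>r\<in>Z. g (\<chi> r)"])
    show "\<forall>g\<in>regfuns (affine_variety C Z). (\<lambda>r\<in>Z. (\<lambda>r\<in>Z'. g (\<psi> r)) (\<chi> r)) = g"
    proof
      fix g assume g: "g \<in> regfuns (affine_variety C Z)"
      have "(\<lambda>r\<in>Z. (\<lambda>r\<in>Z'. g (\<psi> r)) (\<chi> r)) = restrict g Z" by (rule restrict_ext) (simp add: \<chi> inv)
      then show "(\<lambda>r\<in>Z. (\<lambda>r\<in>Z'. g (\<psi> r)) (\<chi> r)) = g" using ext[OF g] by simp
    qed
    show "\<forall>g\<in>regfuns (affine_variety C' Z'). (\<lambda>r\<in>Z'. (\<lambda>r\<in>Z. g (\<chi> r)) (\<psi> r)) = g"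
    proof
      fix g assume g: "g \<in> regfuns (affine_variety C' Z')"
      have "(\<lambda>r\<in>Z'. (\<lambda>r\<in>Z. g (\<chi> r)) (\<psi> r)) = restrict g Z'" by (rule restrict_ext) (simp add: \<psi> inv)
      then show "(\<lambda>r\<in>Z'. (\<lambda>r\<in>Z. g (\<chi> r)) (\<psi> r)) = g" using ext[OF g] by simp
    qed
    show "(\<lambda>g. \<lambda>r\<in>Z'. g (\<psi> r)) ` regfuns (affine_variety C Z) \<subseteq> regfuns (affine_variety C' Z')"
      by (rule image_subsetI) (rule mem)
    show "(\<lambda>g. \<lambda>r\<in>Z. g (\<chi> r)) ` regfuns (affine_variety C' Z') \<subseteq> regfuns (affine_variety C Z)"
      by (rule image_subsetI) (rule mem')
  qed
qed

text \<open>The scaling factors solve \<open>v\<^sup>2 = -4 p\<^sup>3 u - 27 u\<^sup>3\<close> against \<open>z\<^sup>2 = - x y\<^sup>3 - x\<^sup>3\<close>: with \<open>p = 108 y\<close> and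
\<open>u = 432 x\<close> both terms have coefficient \<open>6\<^sup>12\<close>, a square.\<close>

lemma E7_branch: "branch (0, 0) (108 * y, 432 * x) = - (6 ^ 12 * (x ^ 3 + x * y ^ 3))"
  by (simp add: branch_def Let_def algebra_simps power2_eq_square power3_eq_cube)

definition to_E7 :: "complex \<times> complex \<times> complex \<Rightarrow> complex \<times> complex \<times> complex"
  where "to_E7 = (\<lambda>(p, u, v). (u / 432, p / 108, v / 6 ^ 6))"

definition from_E7 :: "complex \<times> complex \<times> complex \<Rightarrow> complex \<times> complex \<times> complex"
  where "from_E7 = (\<lambda>(x, y, z). (108 * y, 432 * x, 6 ^ 6 * z))"

lemma from_E7_mem: "(108 * y, 432 * x, 6 ^ 6 * z) \<in> dp_pts (branch (0, 0)) \<longleftrightarrow> x ^ 3 + x * y ^ 3 + z\<^sup>2 = 0"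
proof -
  have "(6 ^ 6 * z)\<^sup>2 = 6 ^ 12 * z\<^sup>2" by (simp add: power_mult_distrib)
  moreover have "6 ^ 12 * z\<^sup>2 = - (6 ^ 12 * (x ^ 3 + x * y ^ 3)) \<longleftrightarrow> z\<^sup>2 = - (x ^ 3 + x * y ^ 3)"
    by (simp only: mult_minus_right[symmetric] mult_cancel_left) simp
  moreover have "z\<^sup>2 = - (x ^ 3 + x * y ^ 3) \<longleftrightarrow> x ^ 3 + x * y ^ 3 + z\<^sup>2 = 0"
    by (metis add.commute add.right_inverse minus_unique)
  ultimately show ?thesis by (simp only: mem_Collect_eq prod.case E7_branch)
qed

lemma E7_iso:
  "(\<lambda>g. \<lambda>r\<in>dp_pts (branch (0, 0)). g (to_E7 r)) \<in> ring_iso (coord_ring E7_var) (coord_ring (double_plane (branch (0, 0))))"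
  unfolding E7_var_def double_plane_def
proof (rule affine_variety_iso[where \<chi> = from_E7])
  have ft: "from_E7 (to_E7 r) = r" "to_E7 (from_E7 r) = r" for r
    by (cases r; simp add: from_E7_def to_E7_def)+
  show "from_E7 (to_E7 r) = r" "to_E7 (from_E7 r) = r" for r by (rule ft)+
  have mem: "from_E7 r \<in> dp_pts (branch (0, 0)) \<longleftrightarrow> r \<in> {(x, y, z). x ^ 3 + x * y ^ 3 + z\<^sup>2 = 0}" for r
  proof -
    obtain x y z where r: "r = (x, y, z)" by (cases r)
    show ?thesis unfolding r from_E7_def prod.case from_E7_mem by simp
  qed
  show "from_E7 r \<in> dp_pts (branch (0, 0))" if "r \<in> {(x, y, z). x ^ 3 + x * y ^ 3 + z\<^sup>2 = 0}" for r
    by (rule mem[THEN iffD2, OF that])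
  show "to_E7 r \<in> {(x, y, z). x ^ 3 + x * y ^ 3 + z\<^sup>2 = 0}" if "r \<in> dp_pts (branch (0, 0))" for r
    by (rule mem[of "to_E7 r", THEN iffD1]) (unfold ft(1), rule that)
  show "(\<lambda>r. c (to_E7 r)) \<in> poly_funs dp_coords" if "c \<in> {\<lambda>(x, y, z). x, \<lambda>(x, y, z). y, \<lambda>(x, y, z). z}" for c
    using that dp_coord_in by (auto simp: to_E7_def case_prod_unfold intro!: poly_funs_divide)
  show "(\<lambda>r. c (from_E7 r)) \<in> poly_funs {\<lambda>(x, y, z). x, \<lambda>(x, y, z). y, \<lambda>(x, y, z). z}" if "c \<in> dp_coords" for c
    using that dp_coord_in by (auto simp: from_E7_def case_prod_unfold intro!: poly_funs.mult poly_funs.const)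
qed

text \<open>The isomorphism is the composition of the rescaling with the inverse of \<open>fibre_iso\<close>; both respect constants, since
they are given by evaluation at points.\<close>

lemma E7_special_fibre:
  "\<exists>h \<in> ring_iso (coord_ring E7_var) (fibre_ring X_quot base_var alpha_bar (0, 0)).
    \<forall>k. h (\<lambda>p\<in>pts E7_var. k) = fibre_ideal X_quot base_var alpha_bar (0, 0) +>\<^bsub>coord_ring X_quot\<^esub> (\<lambda>p\<in>pts X_quot. k)"
proof -
  let ?F = "fibre_ring X_quot base_var alpha_bar (0, 0)"
  define j where "j = (\<lambda>g :: complex \<times> complex \<times> complex \<Rightarrow> complex. \<lambda>r\<in>dp_pts (branch (0, 0)). g (to_E7 r))"
  define i where "i = inv_into (carrier ?F) (fibre_iso (0, 0))"
  have i: "i \<in> ring_iso (coord_ring (double_plane (branch (0, 0)))) ?F"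
    unfolding i_def by (rule ring_iso_set_sym[OF cring.axioms(1)[OF fibre_ring_cring] fibre_iso])
  have h: "i \<circ> j \<in> ring_iso (coord_ring E7_var) ?F"
    by (rule ring_iso_set_trans[OF _ i]) (unfold j_def, rule E7_iso)
  have "(i \<circ> j) (\<lambda>p\<in>pts E7_var. k) = fibre_ideal X_quot base_var alpha_bar (0, 0) +>\<^bsub>coord_ring X_quot\<^esub> (\<lambda>p\<in>pts X_quot. k)" for k
  proof -
    let ?c = "fibre_ideal X_quot base_var alpha_bar (0, 0) +>\<^bsub>coord_ring X_quot\<^esub> (\<lambda>p\<in>pts X_quot. k)"
    have k: "(\<lambda>p\<in>pts X_quot. k) \<in> regfuns X_quot"
      using function_algebra_X_quot by (simp add: function_algebra_def)
    have "?c \<in> carrier ?F"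
    proof -
      interpret R: cring "coord_ring X_quot" by (rule cring_coord_ring[OF function_algebra_X_quot])
      have "fibre_ideal X_quot base_var alpha_bar (0, 0) \<subseteq> carrier (coord_ring X_quot)"
        unfolding fibre_ideal_def by (rule ideal.Icarr[OF R.genideal_ideal[OF fibre_gen_subset], THEN subsetI])
      from R.a_rcosetsI[OF this k[folded coord_ring_simps(1)]]
      show ?thesis by (simp add: fibre_ring_def FactRing_def)
    qed
    moreover have "fibre_iso (0, 0) ?c = j (\<lambda>p\<in>pts E7_var. k)"
    proof -
      have E: "to_E7 r \<in> pts E7_var" if "r \<in> dp_pts (branch (0, 0))" for r
      proof -
        obtain x y z where xyz: "to_E7 r = (x, y, z)" by (cases "to_E7 r")
        then have "r = (108 * y, 432 * x, 6 ^ 6 * z)" by (cases r) (auto simp: to_E7_def)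
        then have "x ^ 3 + x * y ^ 3 + z\<^sup>2 = 0" using that from_E7_mem by metis
        then show ?thesis by (simp add: xyz E7_var_def)
      qed
      have "fibre_eval (0, 0) (\<lambda>p\<in>pts X_quot. k) = j (\<lambda>p\<in>pts E7_var. k)"
        unfolding fibre_eval_def j_def by (rule restrict_ext) (simp only: restrict_apply' lift_orbit E)
      then show ?thesis using fibre_iso_coset[OF k] by simp
    qed
    moreover have "inj_on (fibre_iso (0, 0)) (carrier ?F)"
      using ring_iso_memE(5)[OF fibre_iso] by (rule bij_betw_imp_inj_on)
    ultimately show ?thesis unfolding i_def comp_def by (intro inv_into_f_eq)
  qed
  with h show ?thesis by blast
qed

theorem mainTheorem7:
  shows "deformation X_quot base_var alpha_bar (0, 0) E7_var \<and>
    (\<forall>t2 t6 :: complex. singular (fibre_ring X_quot base_var alpha_bar (t2, t6)))"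
  using alpha_bar_flat E7_special_fibre fibre_singular by (simp add: deformation_def base_pts)

end
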